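(* Suppose that one of the following three conditions holds for a separable Lorentzian pre-length space $X$. (i) $X$ is a first-countable BMS-Lorentzian length space with compact causal diamonds, empty bubbling boundary, empty spacelike boundary, and timelike extensions. (ii) $X$ is a globally hyperbolic BM-length metric spacetime. (iii) $X$ is a globally hyperbolic KS-Lorentzian length space. Then $(\mathcal{C}^s_X,d_J)$ is a non-empty extended metric space. If $X$ is in addition timelike path-connected (which it is in case (iii) by definition), then $(\mathcal{C}_X,d_J)$ is an extended metric space. If in addition through every point of $X$ there exists a Cauchy complete timelike curve, then $(\mathcal{C}^w_X,d_J)$ is an extended metric space.
   Context: Lorentzian pre-length spaces. An extended time separation function on a set $X$ is a map $\ell:X\times X\to\{-\infty\}\cup[0,\infty]$ with $\ell(x,x)\ge0$ and $\ell(x,y)+\ell(y,z)\le\ell(x,z)$ (convention $-\infty+\infty=-\infty$). Put $d=\max(0,\ell)$; $x\le y$ iff $\ell(x,y)\ge0$; $x\ll y$ iff $d(x,y)>0$; $J^+(x)=\{y:x\le y\}$, $J^-(x)=\{y:y\le x\}$, $I^+(x)=\{y:x\ll y\}$, $I^-(x)=\{y:y\ll x\}$, $J^\pm(K)=\bigcup_{x\in K}J^\pm(x)$. A Lorentzian pre-length space is such a pair with a topology for which all $I^\pm(x)$ are open. Causal: $\le$ is antisymmetric. Globally hyperbolic: causal, $\le$ closed in $X\times X$, and $J^+(K)\cap J^-(K)$ compact for all compact $K$. Causal diamonds are the sets $J^+(x)\cap J^-(y)$. Boundaries: $\partial^\pm_{ca}X=\{x:J^\pm(x)=\{x\}\}$,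 $\partial^\pm_{ch}X=\{x:I^\pm(x)=\emptyset\}$; the bubbling boundary is empty if $\partial^+_{ca}X=\partial^+_{ch}X$ and $\partial^-_{ca}X=\partial^-_{ch}X$; the spacelike boundary is $\partial^+_{ch}X\cap\partial^-_{ch}X$. Curves are continuous maps from (possibly degenerate) intervals $I\subset\mathbb{R}$. A curve $\gamma$ is causal if $t<s$ implies $\gamma(t)\le\gamma(s)$ and $\gamma$ is not constant on any nondegenerate subinterval; timelike if $t<s$ implies $\gamma(t)\ll\gamma(s)$. $X$ is causally (timelike) path-connected if any $x\le y$ ($x\ll y$) can be connected by a causal (timelike) curve. $X$ has timelike extensions if for every $x\notin\partial^+_{ch}X$ (resp. $x\notin\partial^-_{ch}X$) there is a nonconstant timelike curve starting (resp. ending) at $x$. $L(\gamma)=\inf\sum_i d(\gamma(t_i),\gamma(t_{i+1}))$ over partitions of $[a,b]$. $X$ is geodesic if for all $x\le y$ there is a causal curve $\gamma$ from $x$ to $y$ with $L(\gamma)=d(x,y)$. A causal curve $\gamma:I\to X$ is future extendible if there exist an order-preserving homeomorphism $\varphi:I\to\hat I$ onto an interval, an interval $\tilde I\supset\hat I$ containing some $t$ with $t>s$ for all $s\in\hat I$, and a causal curve $\tilde\gamma:\tilde I\to X$ with $\tilde\gamma|_{\hat I}=\gamma\circ\varphi^{-1}$; otherwise future inextendible. Past versions are analogous; inextendible means both. A timelike curve is inextendible if it is so as a causal curve. A timelike curve $\gamma:I\to X$ is Cauchy complete if it is inextendible and: if $d(\gamma(t_0),\gamma(\cdot))$ is bounded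 on $[t_0,\infty)\cap I$ for some $t_0\in I$, then $\sup I\in I$; and if $d(\gamma(\cdot),\gamma(t_0))$ is bounded on $(-\infty,t_0]\cap I$ for some $t_0\in I$, then $\inf I\in I$. $\mathcal{C}_X$ (Cauchy sets), $\mathcal{C}^s_X$ (strong Cauchy sets), $\mathcal{C}^w_X$ (weak Cauchy sets) are the sets of subsets of $X$ that are intersected exactly once by every inextendible timelike curve, every inextendible causal curve, every Cauchy complete timelike curve, respectively. $d_J(A,B)=\sup_{x\in A,y\in B}(d(x,y)+d(y,x))$. An extended metric is a metric that may take the value $\infty$. BMS-Lorentzian length spaces. A Lorentzian metric space (Bykov–Minguzzi–Suhr) is a set $X$ with $d:X\times X\to[0,\infty)$ such that (1) $d(x,y)+d(y,z)\le d(x,z)$ whenever $d(x,y),d(y,z)>0$; (2) there is a topology on $X$ for which $d$ is continuous and for all $x,y\in X$, $\varepsilon>0$ the set $\{(x',y'):d(x',y')\ge\varepsilon\}\cap(\overline{I(x,y)}\times\overline{I(x,y)})$ is compact, where $I(x,y)=\{z:d(x,z)>0,\ d(z,y)>0\}$; (3) for all $x\neq y$ there is $z$ with $d(x,z)\ne d(y,z)$ or $d(z,x)\ne d(z,y)$. It is equipped with some topology as in (2) and regarded as a Lorentzian pre-length space with $x\le y$ iff $d(z,x)\le d(z,y)$ and $d(y,z)\le d(x,z)$ for all $z$, and $\ell=d$ where $x\le y$, $\ell=-\infty$ otherwise. A BMS-Lorentzian length space is a geodesic Lorentzian metric space. BM-length metric spacetimes. A first-countable, causal Lorentzian pre-length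 space such that (1) $\ell$ is upper semicontinuous and $d$ lower semicontinuous; (2) every $x\in X$ equals $\gamma(1/2)$ for some timelike curve $\gamma:[0,1]\to X$; (3) for $x\ll y$, $d(x,y)$ is the supremum of the lengths of (injective) causal curves from $x$ to $y$. KS-Lorentzian length spaces. A KS-Lorentzian pre-length space is a Lorentzian pre-length space with a metric $\rho$ inducing its topology such that $d$ is lower semicontinuous; here all curves, and all notions defined via curves, are in terms of curves locally Lipschitz with respect to $\rho$. It is a KS-Lorentzian length space if: (1) every point has a neighborhood $U$ such that $p_n,q_n\in U$, $p_n\le q_n$, $p_n\to p\in\overline U$, $q_n\to q\in\overline U$ imply $p\le q$; (2) it is causally and timelike path-connected; (3) every $x$ has an open neighborhood $\Omega_x$ such that (a) for some $C>0$ all causal curves in $\Omega_x$ have $\rho$-arclength at most $C$, (b) $I^\pm(y)\cap\Omega_x\ne\emptyset$ for all $y\in\Omega_x$, and there is a continuous $\omega_x:\Omega_x\times\Omega_x\to[0,\infty)$ making $\Omega_x$ with the restrictions of $\rho,\ll,\le$ a KS-Lorentzian pre-length space with Lorentzian distance $\omega_x$, (c) for all $p\le q$, $p\ne q$ in $\Omega_x$ there is a causal curve $\gamma_{p,q}$ in $\Omega_x$ from $p$ to $q$ of maximal length among causal curves from $p$ to $q$ in $\Omega_x$, with $L(\gamma_{p,q})=\omega_x(p,q)\le d(p,q)$; (4) for $x\ll y$, $d(x,y)$ is the supremum of the lengths of causal curves from $x$ to $y$. *)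

theory Defs
  imports "HOL-Analysis.Analysis"
begin

text \<open>
  The space \<open>X\<close> is \<open>topspace T\<close> for an abstract topology \<open>T\<close>; values of the time separation
  \<open>l\<close> outside \<open>topspace T\<close> are irrelevant throughout.
\<close>

section \<open>Topological preliminaries\<close>

definition usc_map :: "'a topology \<Rightarrow> ('a \<Rightarrow> 'b::linorder) \<Rightarrow> bool" where
  "usc_map T f \<longleftrightarrow> (\<forall>a. openin T {x \<in> topspace T. f x < a})"

definition lsc_map :: "'a topology \<Rightarrow> ('a \<Rightarrow> 'b::linorder) \<Rightarrow> bool" where
  "lsc_map T f \<longleftrightarrow> (\<forall>a. openin T {x \<in> topspace T. a < f x})"

definition extended_metric_on :: "'b set \<Rightarrow> ('b \<Rightarrow> 'b \<Rightarrow> ennreal) \<Rightarrow> bool" where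
  "extended_metric_on M D \<longleftrightarrow>
    (\<forall>A\<in>M. \<forall>B\<in>M. D A B = 0 \<longleftrightarrow> A = B) \<and>
    (\<forall>A\<in>M. \<forall>B\<in>M. D A B = D B A) \<and>
    (\<forall>A\<in>M. \<forall>B\<in>M. \<forall>E\<in>M. D A E \<le> D A B + D B E)"


section \<open>Lorentzian pre-length spaces\<close>

text \<open>
  The convention \<open>-\<infinity> + \<infinity> = -\<infinity>\<close> makes the triangle inequality vacuous as soon as one summand
  is \<open>-\<infinity>\<close>. The library's \<open>ereal\<close> addition has \<open>-\<infinity> + \<infinity> = \<infinity>\<close>, hence the explicit guard.
\<close>

definition extended_time_separation :: "'a set \<Rightarrow> ('a \<Rightarrow> 'a \<Rightarrow> ereal) \<Rightarrow> bool" where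
  "extended_time_separation X l \<longleftrightarrow>
    (\<forall>x\<in>X. \<forall>y\<in>X. l x y = -\<infinity> \<or> 0 \<le> l x y) \<and>
    (\<forall>x\<in>X. 0 \<le> l x x) \<and>
    (\<forall>x\<in>X. \<forall>y\<in>X. \<forall>z\<in>X. l x y \<noteq> -\<infinity> \<and> l y z \<noteq> -\<infinity> \<longrightarrow> l x y + l y z \<le> l x z)"

definition tdist :: "('a \<Rightarrow> 'a \<Rightarrow> ereal) \<Rightarrow> 'a \<Rightarrow> 'a \<Rightarrow> ennreal" where
  "tdist l x y = e2ennreal (max 0 (l x y))"

definition causal_le :: "('a \<Rightarrow> 'a \<Rightarrow> ereal) \<Rightarrow> 'a \<Rightarrow> 'a \<Rightarrow> bool" where
  "causal_le l x y \<longleftrightarrow> 0 \<le> l x y"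

definition chron :: "('a \<Rightarrow> 'a \<Rightarrow> ereal) \<Rightarrow> 'a \<Rightarrow> 'a \<Rightarrow> bool" where
  "chron l x y \<longleftrightarrow> 0 < tdist l x y"

definition J_plus :: "'a set \<Rightarrow> ('a \<Rightarrow> 'a \<Rightarrow> ereal) \<Rightarrow> 'a \<Rightarrow> 'a set" where
  "J_plus X l x = {y \<in> X. causal_le l x y}"

definition J_minus :: "'a set \<Rightarrow> ('a \<Rightarrow> 'a \<Rightarrow> ereal) \<Rightarrow> 'a \<Rightarrow> 'a set" where
  "J_minus X l x = {y \<in> X. causal_le l y x}"

definition I_plus :: "'a set \<Rightarrow> ('a \<Rightarrow> 'a \<Rightarrow> ereal) \<Rightarrow> 'a \<Rightarrow> 'a set" where
  "I_plus X l x = {y \<in> X. chron l x y}"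

definition I_minus :: "'a set \<Rightarrow> ('a \<Rightarrow> 'a \<Rightarrow> ereal) \<Rightarrow> 'a \<Rightarrow> 'a set" where
  "I_minus X l x = {y \<in> X. chron l y x}"

definition lorentzian_prelength_space :: "'a topology \<Rightarrow> ('a \<Rightarrow> 'a \<Rightarrow> ereal) \<Rightarrow> bool" where
  "lorentzian_prelength_space T l \<longleftrightarrow>
    extended_time_separation (topspace T) l \<and>
    (\<forall>x \<in> topspace T. openin T (I_plus (topspace T) l x) \<and> openin T (I_minus (topspace T) l x))"

definition causal_space :: "'a topology \<Rightarrow> ('a \<Rightarrow> 'a \<Rightarrow> ereal) \<Rightarrow> bool" where
  "causal_space T l \<longleftrightarrow> antisymp_on (topspace T) (causal_le l)"

definition globally_hyperbolic :: "'a topology \<Rightarrow> ('a \<Rightarrow> 'a \<Rightarrow> ereal) \<Rightarrow> bool" where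
  "globally_hyperbolic T l \<longleftrightarrow>
    causal_space T l \<and>
    closedin (prod_topology T T) {(x, y). x \<in> topspace T \<and> y \<in> topspace T \<and> causal_le l x y} \<and>
    (\<forall>K. compactin T K \<longrightarrow>
      compactin T ((\<Union>x\<in>K. J_plus (topspace T) l x) \<inter> (\<Union>x\<in>K. J_minus (topspace T) l x)))"

definition compact_causal_diamonds :: "'a topology \<Rightarrow> ('a \<Rightarrow> 'a \<Rightarrow> ereal) \<Rightarrow> bool" where
  "compact_causal_diamonds T l \<longleftrightarrow>
    (\<forall>x \<in> topspace T. \<forall>y \<in> topspace T.
      compactin T (J_plus (topspace T) l x \<inter> J_minus (topspace T) l y))"

definition ca_boundary_plus :: "'a set \<Rightarrow> ('a \<Rightarrow> 'a \<Rightarrow> ereal) \<Rightarrow> 'a set" where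
  "ca_boundary_plus X l = {x \<in> X. J_plus X l x = {x}}"

definition ca_boundary_minus :: "'a set \<Rightarrow> ('a \<Rightarrow> 'a \<Rightarrow> ereal) \<Rightarrow> 'a set" where
  "ca_boundary_minus X l = {x \<in> X. J_minus X l x = {x}}"

definition ch_boundary_plus :: "'a set \<Rightarrow> ('a \<Rightarrow> 'a \<Rightarrow> ereal) \<Rightarrow> 'a set" where
  "ch_boundary_plus X l = {x \<in> X. I_plus X l x = {}}"

definition ch_boundary_minus :: "'a set \<Rightarrow> ('a \<Rightarrow> 'a \<Rightarrow> ereal) \<Rightarrow> 'a set" where
  "ch_boundary_minus X l = {x \<in> X. I_minus X l x = {}}"

definition empty_bubbling_boundary :: "'a set \<Rightarrow> ('a \<Rightarrow> 'a \<Rightarrow> ereal) \<Rightarrow> bool" where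
  "empty_bubbling_boundary X l \<longleftrightarrow>
    ca_boundary_plus X l = ch_boundary_plus X l \<and> ca_boundary_minus X l = ch_boundary_minus X l"

definition spacelike_boundary :: "'a set \<Rightarrow> ('a \<Rightarrow> 'a \<Rightarrow> ereal) \<Rightarrow> 'a set" where
  "spacelike_boundary X l = ch_boundary_plus X l \<inter> ch_boundary_minus X l"


section \<open>Curves\<close>

text \<open>
  A curve is a pair of a nonempty interval \<open>I\<close> and a function \<open>\<gamma>\<close>, of which only the values on \<open>I\<close>
  matter. All notions below that involve curves take as parameter the class \<open>C\<close> of admitted curves:
  all continuous curves (\<open>curve T\<close>), or the locally Lipschitz ones (\<open>lipschitz_curve T \<rho>\<close>) as in the
  setting of Kunzinger and Saemann (KS).
\<close>

type_synonym 'a curve_class = "real set \<Rightarrow> (real \<Rightarrow> 'a) \<Rightarrow> bool"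

definition curve :: "'a topology \<Rightarrow> 'a curve_class" where
  "curve T I \<gamma> \<longleftrightarrow> is_interval I \<and> I \<noteq> {} \<and> continuous_map (top_of_set I) T \<gamma>"

definition lipschitz_curve :: "'a topology \<Rightarrow> ('a \<Rightarrow> 'a \<Rightarrow> real) \<Rightarrow> 'a curve_class" where
  "lipschitz_curve T \<rho> I \<gamma> \<longleftrightarrow> curve T I \<gamma> \<and>
    (\<forall>t\<in>I. \<exists>e>0. \<exists>L. \<forall>r \<in> I \<inter> ball t e. \<forall>s \<in> I \<inter> ball t e. \<rho> (\<gamma> r) (\<gamma> s) \<le> L * \<bar>r - s\<bar>)"

definition causal_curve :: "('a \<Rightarrow> 'a \<Rightarrow> ereal) \<Rightarrow> 'a curve_class \<Rightarrow> 'a curve_class" where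
  "causal_curve l C I \<gamma> \<longleftrightarrow> C I \<gamma> \<and>
    (\<forall>t\<in>I. \<forall>s\<in>I. t < s \<longrightarrow> causal_le l (\<gamma> t) (\<gamma> s)) \<and>
    (\<forall>J\<subseteq>I. is_interval J \<and> (\<exists>a\<in>J. \<exists>b\<in>J. a < b) \<longrightarrow> \<not> \<gamma> constant_on J)"

definition timelike_curve :: "('a \<Rightarrow> 'a \<Rightarrow> ereal) \<Rightarrow> 'a curve_class \<Rightarrow> 'a curve_class" where
  "timelike_curve l C I \<gamma> \<longleftrightarrow> C I \<gamma> \<and>
    (\<forall>t\<in>I. \<forall>s\<in>I. t < s \<longrightarrow> chron l (\<gamma> t) (\<gamma> s))"

definition joins :: "(real \<Rightarrow> 'a) \<Rightarrow> real \<Rightarrow> real \<Rightarrow> 'a \<Rightarrow> 'a \<Rightarrow> bool" where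
  "joins \<gamma> a b x y \<longleftrightarrow> a \<le> b \<and> \<gamma> a = x \<and> \<gamma> b = y"

definition causally_path_connected ::
    "'a set \<Rightarrow> ('a \<Rightarrow> 'a \<Rightarrow> ereal) \<Rightarrow> 'a curve_class \<Rightarrow> bool" where
  "causally_path_connected X l C \<longleftrightarrow>
    (\<forall>x\<in>X. \<forall>y\<in>X. causal_le l x y \<longrightarrow>
      (\<exists>a b \<gamma>. joins \<gamma> a b x y \<and> causal_curve l C {a..b} \<gamma>))"

definition timelike_path_connected ::
    "'a set \<Rightarrow> ('a \<Rightarrow> 'a \<Rightarrow> ereal) \<Rightarrow> 'a curve_class \<Rightarrow> bool" where
  "timelike_path_connected X l C \<longleftrightarrow>
    (\<forall>x\<in>X. \<forall>y\<in>X. chron l x y \<longrightarrow>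
      (\<exists>a b \<gamma>. joins \<gamma> a b x y \<and> timelike_curve l C {a..b} \<gamma>))"

definition timelike_extensions ::
    "'a set \<Rightarrow> ('a \<Rightarrow> 'a \<Rightarrow> ereal) \<Rightarrow> 'a curve_class \<Rightarrow> bool" where
  "timelike_extensions X l C \<longleftrightarrow>
    (\<forall>x \<in> X - ch_boundary_plus X l. \<exists>I \<gamma>. timelike_curve l C I \<gamma> \<and> \<not> \<gamma> constant_on I \<and>
      (\<exists>a\<in>I. (\<forall>t\<in>I. a \<le> t) \<and> \<gamma> a = x)) \<and>
    (\<forall>x \<in> X - ch_boundary_minus X l. \<exists>I \<gamma>. timelike_curve l C I \<gamma> \<and> \<not> \<gamma> constant_on I \<and>
      (\<exists>b\<in>I. (\<forall>t\<in>I. t \<le> b) \<and> \<gamma> b = x))"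

text \<open>
  Partitions \<open>a = t 0 < \<dots> < t n = b\<close>; the only partition of \<open>[a, a]\<close> has \<open>n = 0\<close>, so that
  degenerate curves have length 0.
\<close>

definition partitions :: "real \<Rightarrow> real \<Rightarrow> (nat \<times> (nat \<Rightarrow> real)) set" where
  "partitions a b = {(n, t). t 0 = a \<and> t n = b \<and> (\<forall>i<n. t i < t (Suc i))}"

definition lor_length :: "('a \<Rightarrow> 'a \<Rightarrow> ereal) \<Rightarrow> real \<Rightarrow> real \<Rightarrow> (real \<Rightarrow> 'a) \<Rightarrow> ennreal" where
  "lor_length l a b \<gamma> =
    (INF (n, t) \<in> partitions a b. \<Sum>i<n. tdist l (\<gamma> (t i)) (\<gamma> (t (Suc i))))"

definition arclength :: "('a \<Rightarrow> 'a \<Rightarrow> real) \<Rightarrow> real set \<Rightarrow> (real \<Rightarrow> 'a) \<Rightarrow> ennreal" where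
  "arclength \<rho> I \<gamma> =
    (SUP (n, t) \<in> {(n, t). (\<forall>i\<le>n. t i \<in> I) \<and> (\<forall>i<n. t i < t (Suc i))}.
      \<Sum>i<(n::nat). ennreal (\<rho> (\<gamma> (t i)) (\<gamma> (t (Suc i)))))"

definition geodesic_space :: "'a set \<Rightarrow> ('a \<Rightarrow> 'a \<Rightarrow> ereal) \<Rightarrow> 'a curve_class \<Rightarrow> bool" where
  "geodesic_space X l C \<longleftrightarrow>
    (\<forall>x\<in>X. \<forall>y\<in>X. causal_le l x y \<longrightarrow>
      (\<exists>a b \<gamma>. joins \<gamma> a b x y \<and> causal_curve l C {a..b} \<gamma> \<and> lor_length l a b \<gamma> = tdist l x y))"

definition future_extendible :: "('a \<Rightarrow> 'a \<Rightarrow> ereal) \<Rightarrow> 'a curve_class \<Rightarrow> 'a curve_class" where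
  "future_extendible l C I \<gamma> \<longleftrightarrow>
    (\<exists>I' \<phi> \<psi> K \<gamma>'. is_interval I' \<and> homeomorphism I I' \<phi> \<psi> \<and> strict_mono_on I \<phi> \<and>
      is_interval K \<and> I' \<subseteq> K \<and> (\<exists>t\<in>K. \<forall>s\<in>I'. s < t) \<and>
      causal_curve l C K \<gamma>' \<and> (\<forall>s\<in>I'. \<gamma>' s = \<gamma> (\<psi> s)))"

definition past_extendible :: "('a \<Rightarrow> 'a \<Rightarrow> ereal) \<Rightarrow> 'a curve_class \<Rightarrow> 'a curve_class" where
  "past_extendible l C I \<gamma> \<longleftrightarrow>
    (\<exists>I' \<phi> \<psi> K \<gamma>'. is_interval I' \<and> homeomorphism I I' \<phi> \<psi> \<and> strict_mono_on I \<phi> \<and>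
      is_interval K \<and> I' \<subseteq> K \<and> (\<exists>t\<in>K. \<forall>s\<in>I'. t < s) \<and>
      causal_curve l C K \<gamma>' \<and> (\<forall>s\<in>I'. \<gamma>' s = \<gamma> (\<psi> s)))"

definition inextendible :: "('a \<Rightarrow> 'a \<Rightarrow> ereal) \<Rightarrow> 'a curve_class \<Rightarrow> 'a curve_class" where
  "inextendible l C I \<gamma> \<longleftrightarrow>
    causal_curve l C I \<gamma> \<and> \<not> future_extendible l C I \<gamma> \<and> \<not> past_extendible l C I \<gamma>"

text \<open>
  \<open>sup I \<in> I\<close> (with \<open>sup I\<close> in the extended reals) says that \<open>I\<close> has a greatest element.
\<close>

definition cauchy_complete_curve :: "('a \<Rightarrow> 'a \<Rightarrow> ereal) \<Rightarrow> 'a curve_class \<Rightarrow> 'a curve_class" where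
  "cauchy_complete_curve l C I \<gamma> \<longleftrightarrow>
    timelike_curve l C I \<gamma> \<and> inextendible l C I \<gamma> \<and>
    ((\<exists>t0\<in>I. \<exists>B::real. \<forall>t \<in> {t0..} \<inter> I. tdist l (\<gamma> t0) (\<gamma> t) \<le> ennreal B) \<longrightarrow>
      (\<exists>m\<in>I. \<forall>t\<in>I. t \<le> m)) \<and>
    ((\<exists>t0\<in>I. \<exists>B::real. \<forall>t \<in> {..t0} \<inter> I. tdist l (\<gamma> t) (\<gamma> t0) \<le> ennreal B) \<longrightarrow>
      (\<exists>m\<in>I. \<forall>t\<in>I. m \<le> t))"


section \<open>Cauchy sets\<close>

definition cauchy_sets ::
    "'a set \<Rightarrow> ('a \<Rightarrow> 'a \<Rightarrow> ereal) \<Rightarrow> 'a curve_class \<Rightarrow> 'a set set" where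
  "cauchy_sets X l C = {S. S \<subseteq> X \<and>
    (\<forall>I \<gamma>. timelike_curve l C I \<gamma> \<and> inextendible l C I \<gamma> \<longrightarrow> (\<exists>!t. t \<in> I \<and> \<gamma> t \<in> S))}"

definition strong_cauchy_sets ::
    "'a set \<Rightarrow> ('a \<Rightarrow> 'a \<Rightarrow> ereal) \<Rightarrow> 'a curve_class \<Rightarrow> 'a set set" where
  "strong_cauchy_sets X l C = {S. S \<subseteq> X \<and>
    (\<forall>I \<gamma>. causal_curve l C I \<gamma> \<and> inextendible l C I \<gamma> \<longrightarrow> (\<exists>!t. t \<in> I \<and> \<gamma> t \<in> S))}"

definition weak_cauchy_sets ::
    "'a set \<Rightarrow> ('a \<Rightarrow> 'a \<Rightarrow> ereal) \<Rightarrow> 'a curve_class \<Rightarrow> 'a set set" where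
  "weak_cauchy_sets X l C = {S. S \<subseteq> X \<and>
    (\<forall>I \<gamma>. cauchy_complete_curve l C I \<gamma> \<longrightarrow> (\<exists>!t. t \<in> I \<and> \<gamma> t \<in> S))}"

definition d_J :: "('a \<Rightarrow> 'a \<Rightarrow> ereal) \<Rightarrow> 'a set \<Rightarrow> 'a set \<Rightarrow> ennreal" where
  "d_J l A B = (SUP (x, y) \<in> A \<times> B. tdist l x y + tdist l y x)"


section \<open>Bykov--Minguzzi--Suhr (BMS) Lorentzian length spaces\<close>

definition I_between :: "'a set \<Rightarrow> ('a \<Rightarrow> 'a \<Rightarrow> real) \<Rightarrow> 'a \<Rightarrow> 'a \<Rightarrow> 'a set" where
  "I_between X d x y = {z \<in> X. d x z > 0 \<and> d z y > 0}"

definition lorentzian_metric_space :: "'a topology \<Rightarrow> ('a \<Rightarrow> 'a \<Rightarrow> real) \<Rightarrow> bool" where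
  "lorentzian_metric_space T d \<longleftrightarrow>
    (\<forall>x \<in> topspace T. \<forall>y \<in> topspace T. 0 \<le> d x y) \<and>
    (\<forall>x \<in> topspace T. \<forall>y \<in> topspace T. \<forall>z \<in> topspace T.
      d x y > 0 \<and> d y z > 0 \<longrightarrow> d x y + d y z \<le> d x z) \<and>
    continuous_map (prod_topology T T) euclideanreal (\<lambda>(x, y). d x y) \<and>
    (\<forall>x \<in> topspace T. \<forall>y \<in> topspace T. \<forall>\<epsilon>>0.
      compactin (prod_topology T T)
        ({(x', y'). x' \<in> topspace T \<and> y' \<in> topspace T \<and> d x' y' \<ge> \<epsilon>} \<inter>
         (T closure_of I_between (topspace T) d x y) \<times>
         (T closure_of I_between (topspace T) d x y))) \<and>
    (\<forall>x \<in> topspace T. \<forall>y \<in> topspace T. x \<noteq> y \<longrightarrow>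
      (\<exists>z \<in> topspace T. d x z \<noteq> d y z \<or> d z x \<noteq> d z y))"

definition bms_le :: "'a set \<Rightarrow> ('a \<Rightarrow> 'a \<Rightarrow> real) \<Rightarrow> 'a \<Rightarrow> 'a \<Rightarrow> bool" where
  "bms_le X d x y \<longleftrightarrow> (\<forall>z\<in>X. d z x \<le> d z y \<and> d y z \<le> d x z)"

definition bms_length_space :: "'a topology \<Rightarrow> ('a \<Rightarrow> 'a \<Rightarrow> ereal) \<Rightarrow> bool" where
  "bms_length_space T l \<longleftrightarrow>
    (\<exists>d. lorentzian_metric_space T d \<and>
      (\<forall>x \<in> topspace T. \<forall>y \<in> topspace T.
        l x y = (if bms_le (topspace T) d x y then ereal (d x y) else -\<infinity>))) \<and>
    geodesic_space (topspace T) l (curve T)"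


section \<open>BM-length metric spacetimes\<close>

definition bm_length_metric_spacetime :: "'a topology \<Rightarrow> ('a \<Rightarrow> 'a \<Rightarrow> ereal) \<Rightarrow> bool" where
  "bm_length_metric_spacetime T l \<longleftrightarrow>
    lorentzian_prelength_space T l \<and> first_countable T \<and> causal_space T l \<and>
    usc_map (prod_topology T T) (\<lambda>(x, y). l x y) \<and>
    lsc_map (prod_topology T T) (\<lambda>(x, y). tdist l x y) \<and>
    (\<forall>x \<in> topspace T. \<exists>\<gamma>. timelike_curve l (curve T) {0..1} \<gamma> \<and> \<gamma> (1/2) = x) \<and>
    (\<forall>x \<in> topspace T. \<forall>y \<in> topspace T. chron l x y \<longrightarrow>
      tdist l x y = Sup {lor_length l a b \<gamma> | a b \<gamma>.
        joins \<gamma> a b x y \<and> causal_curve l (curve T) {a..b} \<gamma> \<and> inj_on \<gamma> {a..b}})"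


section \<open>KS-Lorentzian length spaces\<close>

definition ks_prelength_space ::
    "'a topology \<Rightarrow> ('a \<Rightarrow> 'a \<Rightarrow> ereal) \<Rightarrow> ('a \<Rightarrow> 'a \<Rightarrow> real) \<Rightarrow> bool" where
  "ks_prelength_space T l \<rho> \<longleftrightarrow>
    lorentzian_prelength_space T l \<and>
    Metric_space (topspace T) \<rho> \<and> Metric_space.mtopology (topspace T) \<rho> = T \<and>
    lsc_map (prod_topology T T) (\<lambda>(x, y). tdist l x y)"

definition ks_locally_closed :: "'a topology \<Rightarrow> ('a \<Rightarrow> 'a \<Rightarrow> ereal) \<Rightarrow> bool" where
  "ks_locally_closed T l \<longleftrightarrow>
    (\<forall>x \<in> topspace T. \<exists>V U. openin T V \<and> x \<in> V \<and> V \<subseteq> U \<and> U \<subseteq> topspace T \<and>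
      (\<forall>(p::nat \<Rightarrow> 'a) q p' q'. (\<forall>n. p n \<in> U \<and> q n \<in> U \<and> causal_le l (p n) (q n)) \<and>
        p' \<in> T closure_of U \<and> q' \<in> T closure_of U \<and>
        limitin T p p' sequentially \<and> limitin T q q' sequentially \<longrightarrow> causal_le l p' q'))"

text \<open>
  That \<open>\<Omega>\<close> with the restricted relations and \<open>\<omega>\<close> is a KS-Lorentzian pre-length
  space means that the extended time separation equal to \<open>\<omega>\<close> on causally related pairs and \<open>-\<infinity>\<close>
  elsewhere makes it one, with \<open>\<omega>\<close> as its distance and the restricted chronological relation as its own; its causal
  relation is the restricted one by construction.
\<close>

definition ks_localizing_nbhd ::
    "'a topology \<Rightarrow> ('a \<Rightarrow> 'a \<Rightarrow> ereal) \<Rightarrow> ('a \<Rightarrow> 'a \<Rightarrow> real) \<Rightarrow> 'a set \<Rightarrow> bool" where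
  "ks_localizing_nbhd T l \<rho> \<Omega> \<longleftrightarrow>
    (\<exists>C>0::real. \<forall>I \<gamma>. causal_curve l (lipschitz_curve T \<rho>) I \<gamma> \<and> \<gamma> ` I \<subseteq> \<Omega> \<longrightarrow>
      arclength \<rho> I \<gamma> \<le> ennreal C) \<and>
    (\<forall>y\<in>\<Omega>. I_plus (topspace T) l y \<inter> \<Omega> \<noteq> {} \<and> I_minus (topspace T) l y \<inter> \<Omega> \<noteq> {}) \<and>
    (\<exists>\<omega> :: 'a \<Rightarrow> 'a \<Rightarrow> real.
      (\<forall>p\<in>\<Omega>. \<forall>q\<in>\<Omega>. 0 \<le> \<omega> p q) \<and>
      continuous_map (prod_topology (subtopology T \<Omega>) (subtopology T \<Omega>)) euclideanreal
        (\<lambda>(p, q). \<omega> p q) \<and>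
      (let l' = (\<lambda>p q. if causal_le l p q then ereal (\<omega> p q) else -\<infinity>) in
        ks_prelength_space (subtopology T \<Omega>) l' \<rho> \<and>
        (\<forall>p\<in>\<Omega>. \<forall>q\<in>\<Omega>. tdist l' p q = ennreal (\<omega> p q) \<and> (chron l' p q \<longleftrightarrow> chron l p q))) \<and>
      (\<forall>p\<in>\<Omega>. \<forall>q\<in>\<Omega>. causal_le l p q \<and> p \<noteq> q \<longrightarrow>
        (\<exists>a b \<gamma>. joins \<gamma> a b p q \<and> causal_curve l (lipschitz_curve T \<rho>) {a..b} \<gamma> \<and>
          \<gamma> ` {a..b} \<subseteq> \<Omega> \<and>
          (\<forall>a' b' \<gamma>'. joins \<gamma>' a' b' p q \<and> causal_curve l (lipschitz_curve T \<rho>) {a'..b'} \<gamma>' \<and>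
            \<gamma>' ` {a'..b'} \<subseteq> \<Omega> \<longrightarrow> lor_length l a' b' \<gamma>' \<le> lor_length l a b \<gamma>) \<and>
          lor_length l a b \<gamma> = ennreal (\<omega> p q) \<and> ennreal (\<omega> p q) \<le> tdist l p q)))"

definition ks_length_space ::
    "'a topology \<Rightarrow> ('a \<Rightarrow> 'a \<Rightarrow> ereal) \<Rightarrow> ('a \<Rightarrow> 'a \<Rightarrow> real) \<Rightarrow> bool" where
  "ks_length_space T l \<rho> \<longleftrightarrow>
    ks_prelength_space T l \<rho> \<and>
    ks_locally_closed T l \<and>
    causally_path_connected (topspace T) l (lipschitz_curve T \<rho>) \<and>
    timelike_path_connected (topspace T) l (lipschitz_curve T \<rho>) \<and>
    (\<forall>x \<in> topspace T. \<exists>\<Omega>. openin T \<Omega> \<and> x \<in> \<Omega> \<and> ks_localizing_nbhd T l \<rho> \<Omega>) \<and>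
    (\<forall>x \<in> topspace T. \<forall>y \<in> topspace T. chron l x y \<longrightarrow>
      tdist l x y = Sup {lor_length l a b \<gamma> | a b \<gamma>.
        joins \<gamma> a b x y \<and> causal_curve l (lipschitz_curve T \<rho>) {a..b} \<gamma>})"


end

theory Submission
  imports Defs
begin

text \<open>
  The three cases have in common that the causal relation is closed with compact diamonds, that a
  timelike curve starts at every point outside the future chronological boundary (and dually), and
  that causal curves extend to their limit points. In such a space a causal curve is future
  inextendible iff no point lies strictly above all of it.

  For a timelike curve \<open>c\<close> starting at \<open>q\<close> the height \<open>x \<mapsto> sup {s. c s \<lless> x}\<close> is continuous. Summing
  such heights with weights over a countable dense set of points \<open>q\<close> gives a function \<open>\<tau>\<close> that is
  continuous and strictly increasing along causal curves and tends to 0 along past inextendible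
  ones. With its time reversal \<open>\<sigma>\<close>, the set \<open>{\<tau> = \<sigma>}\<close> is a strong Cauchy set. Moreover \<open>\<tau>\<close> measures the
  progress in extending causal or timelike curves to inextendible ones.

  It follows that every Cauchy set \<open>B\<close> of each of the three kinds is achronal and that each point is
  in \<open>B\<close> or chronologically related to a point of \<open>B\<close>. On such sets \<open>d_J\<close> is an extended metric; for
  the triangle inequality, an almost maximal causal curve from the past to the future of \<open>B\<close> must
  cross \<open>B\<close>.
\<close>

section \<open>Curve classes\<close>

text \<open>Geroch's time functions are volumes of pasts and futures, but no measure is given here.
  Counting the points of a dense set in the past of \<open>x\<close> would give a function that
  jumps on entering the future of each of them; the height along a timelike curve issuing from such
  a point grows from 0 instead. In the first case points without chronological future or past may
  exist. An inextendible curve may end there and \<open>\<tau>\<close> or \<open>\<sigma>\<close>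
  may vanish, so the usual quotient is replaced by the sign of the difference; the empty spacelike
  boundary keeps both from vanishing at once. No limit curve theorem is used: rays are built by
  greedy choice, for causal and timelike curves alike. Beyond cutting, shifting and gluing, the
  regularity of curves matters only in the extension through a limit point: a continuous curve just
  needs a bounded parameter, a locally Lipschitz one is reparametrised by arclength. Extendibility
  refers to causal extensions even for timelike curves; that a limit point is still reached by a
  timelike curve follows from the push-up property.\<close>

definition rel_curve :: "('a \<Rightarrow> 'a \<Rightarrow> bool) \<Rightarrow> 'a curve_class \<Rightarrow> 'a curve_class" where
  "rel_curve R C I g \<longleftrightarrow> C I g \<and> (\<forall>t\<in>I. \<forall>s\<in>I. t < s \<longrightarrow> R (g t) (g s))"

definition strict_le :: "('a \<Rightarrow> 'a \<Rightarrow> ereal) \<Rightarrow> 'a \<Rightarrow> 'a \<Rightarrow> bool" where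
  "strict_le l x y \<longleftrightarrow> causal_le l x y \<and> x \<noteq> y"

lemma timelike_curve_rel_curve: "timelike_curve l C = rel_curve (chron l) C"
  by (intro ext) (simp add: timelike_curve_def rel_curve_def)

text \<open>If \<open>g t = g s\<close> with \<open>t < s\<close>, every value in between lies
  causally between these equal points and equals them by antisymmetry, so \<open>g\<close> would be
  constant on \<open>{t..s}\<close>. This turns the condition on subintervals into a pairwise one,
  and causal and timelike curves become one notion for two relations.\<close>

lemma causal_curve_rel_curve:
  assumes "antisymp_on (g ` I) (causal_le l)" and "is_interval I"
  shows "causal_curve l C I g \<longleftrightarrow> rel_curve (strict_le l) C I g"
proof
  assume c: "causal_curve l C I g"
  have "g t \<noteq> g s" if ts: "t \<in> I" "s \<in> I" "t < s" for t s
  proof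
    assume eq: "g t = g s"
    have sub: "{t..s} \<subseteq> I"
      using \<open>is_interval I\<close> ts unfolding is_interval_1 atLeastAtMost_iff subset_iff by blast
    have "g r = g t" if r: "r \<in> {t..s}" for r
    proof (cases "r = t \<or> r = s")
      case False
      then have "t < r" "r < s" "r \<in> I"
        using r sub by auto
      then have "causal_le l (g t) (g r)" "causal_le l (g r) (g t)"
        using c ts(1,2) eq unfolding causal_curve_def by (blast, metis)
      then show ?thesis
        using assms(1) r sub ts(1) by (metis antisymp_on_def image_eqI subsetD)
    qed (use eq in auto)
    then have "g constant_on {t..s}"
      unfolding constant_on_def by blast
    moreover have "t \<in> {t..s}" "s \<in> {t..s}"
      using ts by auto
    ultimately show False
      using c sub ts(3) is_interval_cc unfolding causal_curve_def by blast
  qed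
  with c show "rel_curve (strict_le l) C I g"
    unfolding causal_curve_def rel_curve_def strict_le_def by blast
next
  assume r: "rel_curve (strict_le l) C I g"
  have "\<not> g constant_on J" if "J \<subseteq> I" and "is_interval J \<and> (\<exists>a\<in>J. \<exists>b\<in>J. a < b)" for J
    using that r unfolding constant_on_def rel_curve_def strict_le_def by (metis subsetD)
  with r show "causal_curve l C I g"
    unfolding causal_curve_def rel_curve_def strict_le_def by blast
qed

text \<open>Together with \<open>limit_extendible\<close> these closure properties are what the
  general theory uses of a class of curves; continuous and locally Lipschitz curves have them.
  Negative factors in \<open>affine\<close> provide the reversal of curves, \<open>exhaust\<close>
  the concatenation of infinitely many pieces.\<close>

locale curve_class =
  fixes T :: "'a topology" and C :: "'a curve_class"
  assumes is_curve: "C I g \<Longrightarrow> curve T I g"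
    and cong_curve: "C I g \<Longrightarrow> (\<And>t. t \<in> I \<Longrightarrow> g t = g' t) \<Longrightarrow> C I g'"
    and subinterval: "C I g \<Longrightarrow> J \<subseteq> I \<Longrightarrow> is_interval J \<Longrightarrow> J \<noteq> {} \<Longrightarrow> C J g"
    and affine: "C I g \<Longrightarrow> a \<noteq> 0 \<Longrightarrow> C ((\<lambda>t. a * t + c) -` I) (\<lambda>t. g (a * t + c))"
    and glue: "C I g \<Longrightarrow> C J g \<Longrightarrow> b \<in> I \<Longrightarrow> b \<in> J \<Longrightarrow> I \<subseteq> {..b} \<Longrightarrow> J \<subseteq> {b..} \<Longrightarrow> C (I \<union> J) g"
    and exhaust: "(\<And>n::nat. C {0..real n} g) \<Longrightarrow> C {0..} g"
    and point: "x \<in> topspace T \<Longrightarrow> C {t} (\<lambda>_. x)"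
begin

lemma curve_interval: "C I g \<Longrightarrow> is_interval I"
  using is_curve by (simp add: curve_def)

lemma curve_nonempty: "C I g \<Longrightarrow> I \<noteq> {}"
  using is_curve by (simp add: curve_def)

lemma curve_in: "C I g \<Longrightarrow> t \<in> I \<Longrightarrow> g t \<in> topspace T"
  using is_curve unfolding curve_def by (metis Pi_iff continuous_map_funspace topspace_euclidean_subtopology)

lemma curve_between: "C I g \<Longrightarrow> a \<in> I \<Longrightarrow> b \<in> I \<Longrightarrow> a \<le> t \<Longrightarrow> t \<le> b \<Longrightarrow> t \<in> I"
  using curve_interval unfolding is_interval_1 by blast

lemma curve_nbhd:
  assumes "C I g" "t \<in> I" "openin T U" "g t \<in> U"
  obtains e where "e > 0" "\<And>s. s \<in> I \<Longrightarrow> \<bar>s - t\<bar> < e \<Longrightarrow> g s \<in> U"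
proof -
  have "openin (top_of_set I) {s \<in> I. g s \<in> U}"
    using is_curve[OF assms(1)] assms(3) unfolding curve_def continuous_map_def
    by simp
  then obtain e where "e > 0" "ball t e \<inter> I \<subseteq> {s \<in> I. g s \<in> U}"
    using assms(2,4) unfolding openin_contains_ball by blast
  then show ?thesis
    by (intro that[of e]) (auto simp: dist_real_def subset_iff abs_minus_commute)
qed

lemma rel_curve_subinterval:
  "rel_curve R C I g \<Longrightarrow> J \<subseteq> I \<Longrightarrow> is_interval J \<Longrightarrow> J \<noteq> {} \<Longrightarrow> rel_curve R C J g"
  using subinterval unfolding rel_curve_def by blast

lemma rel_curve_cong:
  "rel_curve R C I g \<Longrightarrow> (\<And>t. t \<in> I \<Longrightarrow> g t = g' t) \<Longrightarrow> rel_curve R C I g'"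
  using cong_curve unfolding rel_curve_def by (metis (no_types, lifting))

lemma rel_curve_affine:
  assumes "rel_curve R C I g" "a > 0"
  shows "rel_curve R C ((\<lambda>t. a * t + c) -` I) (\<lambda>t. g (a * t + c))"
  using assms affine[of I g a c] unfolding rel_curve_def by auto

lemma rel_curve_shift:
  assumes "rel_curve R C I g"
  shows "rel_curve R C ((\<lambda>t. t + c) -` I) (\<lambda>t. g (t + c))"
  using rel_curve_affine[OF assms, of 1 c] by simp

lemma rel_curve_reverse:
  assumes "rel_curve R C I g"
  shows "rel_curve (\<lambda>x y. R y x) C (uminus -` I) (\<lambda>t. g (- t))"
  using assms affine[of I g "-1" 0] unfolding rel_curve_def by (auto simp: fun_eq_iff)

lemma rel_curve_unit_interval:
  assumes "rel_curve R C {a..b} g" "a < b"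
  shows "rel_curve R C {0..1} (\<lambda>t. g ((b - a) * t + a))"
proof -
  have "(b - a) * t + a \<in> {a..b} \<longleftrightarrow> t \<in> {0..1}" for t
  proof -
    have "(b - a) * t \<le> b - a \<longleftrightarrow> t \<le> 1" "0 \<le> (b - a) * t \<longleftrightarrow> 0 \<le> t"
      using assms(2) mult_le_cancel_left_pos[of "b - a" t 1] by (simp_all add: zero_le_mult_iff)
    then show ?thesis
      unfolding atLeastAtMost_iff by linarith
  qed
  then have "(\<lambda>t. (b - a) * t + a) -` {a..b} = {0..1}"
    by blast
  then show ?thesis
    using rel_curve_affine[OF assms(1), of "b - a" a] assms(2) by (simp only: diff_gt_0_iff_gt)
qed

lemma rel_curve_point: "x \<in> topspace T \<Longrightarrow> rel_curve R C {t} (\<lambda>_. x)"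
  using point by (simp add: rel_curve_def)

end

section \<open>Time separation\<close>

lemma chron_iff: "chron l x y \<longleftrightarrow> 0 < l x y"
proof -
  have "(0 < e2ennreal (max 0 (l x y))) = (enn2ereal 0 < enn2ereal (e2ennreal (max 0 (l x y))))"
    by (simp add: less_ennreal.rep_eq)
  also have "\<dots> = (0 < max 0 (l x y))"
    by (simp add: enn2ereal_e2ennreal zero_ennreal.rep_eq)
  finally show ?thesis
    by (auto simp: chron_def tdist_def less_max_iff_disj)
qed

lemma chron_imp_causal_le: "chron l x y \<Longrightarrow> causal_le l x y"
  by (simp add: chron_iff causal_le_def)

lemma tdist_eq_0: "\<not> chron l x y \<Longrightarrow> tdist l x y = 0"
  by (simp add: chron_def)

lemma tdist_triangle:
  assumes "extended_time_separation X l" "x \<in> X" "y \<in> X" "z \<in> X"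
    and "causal_le l x y" "causal_le l y z"
  shows "tdist l x y + tdist l y z \<le> tdist l x z"
proof -
  have "l x y + l y z \<le> l x z"
    using assms unfolding extended_time_separation_def causal_le_def by auto
  moreover have "0 \<le> l x y" "0 \<le> l y z"
    using assms(5,6) by (auto simp: causal_le_def)
  moreover have "0 \<le> l x z"
    using calculation assms(5,6) order_trans[of 0 "l x y + l y z" "l x z"]
    by (simp add: causal_le_def)
  ultimately show ?thesis
    by (simp add: tdist_def less_eq_ennreal.rep_eq plus_ennreal.rep_eq enn2ereal_e2ennreal max_def)
qed

section \<open>Time reversal\<close>

definition time_reversal :: "('a \<Rightarrow> 'a \<Rightarrow> ereal) \<Rightarrow> 'a \<Rightarrow> 'a \<Rightarrow> ereal" where
  "time_reversal l = (\<lambda>x y. l y x)"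

lemma causal_le_rev: "causal_le (time_reversal l) = (\<lambda>x y. causal_le l y x)"
  by (intro ext) (simp add: causal_le_def time_reversal_def)

lemma chron_rev: "chron (time_reversal l) = (\<lambda>x y. chron l y x)"
  by (intro ext) (simp add: chron_iff time_reversal_def)

lemma strict_le_rev: "strict_le (time_reversal l) = (\<lambda>x y. strict_le l y x)"
  by (intro ext) (auto simp: strict_le_def causal_le_rev)

lemma J_rev:
  "J_plus X (time_reversal l) = J_minus X l" "J_minus X (time_reversal l) = J_plus X l"
  "I_plus X (time_reversal l) = I_minus X l" "I_minus X (time_reversal l) = I_plus X l"
  by (simp_all add: fun_eq_iff J_plus_def J_minus_def I_plus_def I_minus_def causal_le_rev chron_rev)

lemmas reversal = causal_le_rev chron_rev strict_le_rev J_rev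

text \<open>Without a Hausdorff assumption the closures may leave \<open>K\<close>, so the finite
  intersection property is not applied to them inside \<open>K\<close>. Instead their complements
  would cover \<open>K\<close>; the largest index of a finite subcover has a point of its set in
  \<open>K\<close>, and that point lies in all the finitely many closures.\<close>

lemma nested_closures_common_point:
  fixes J :: "'i::linorder set"
  assumes K: "compactin T K" and "J \<noteq> {}"
    and A: "\<And>t. t \<in> J \<Longrightarrow> A t \<subseteq> K \<and> A t \<noteq> {}"
    and mono: "\<And>s t. s \<in> J \<Longrightarrow> t \<in> J \<Longrightarrow> s \<le> t \<Longrightarrow> A t \<subseteq> A s"
  obtains p where "p \<in> topspace T" "\<And>t. t \<in> J \<Longrightarrow> p \<in> T closure_of A t"
proof (rule ccontr)
  assume none: "\<not> thesis"
  let ?U = "\<lambda>t. topspace T - T closure_of A t"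
  have "K \<subseteq> (\<Union>t\<in>J. ?U t)"
    using compactin_subset_topspace[OF K] none that by blast
  moreover have "\<forall>U\<in>?U ` J. openin T U"
    by auto
  ultimately have "\<exists>\<F>. finite \<F> \<and> \<F> \<subseteq> ?U ` J \<and> K \<subseteq> \<Union>\<F>"
    using K unfolding compactin_def by meson
  then obtain F where F: "finite F" "F \<subseteq> J" "K \<subseteq> (\<Union>t\<in>F. ?U t)"
    by (metis finite_subset_image)
  have "F \<noteq> {}"
    using F(3) A \<open>J \<noteq> {}\<close> by fastforce
  then have m: "Max F \<in> J" "Max F \<in> F"
    using F(1,2) Max_in by auto
  then obtain x where x: "x \<in> A (Max F)" "x \<in> K"
    using A by blast
  then obtain t where t: "t \<in> F" "x \<notin> T closure_of A t"
    using F(3) by blast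
  then have "A (Max F) \<subseteq> A t"
    using F(1,2) m by (intro mono) auto
  then have "x \<in> A t"
    using x by blast
  moreover have "A t \<subseteq> T closure_of A t"
    using A F(2) t(1) compactin_subset_topspace[OF K] by (intro closure_of_subset) blast
  ultimately show False
    using t by blast
qed

section \<open>Spacetimes\<close>

text \<open>Whether a curve can be prolonged by its limit depends on the class: a reparametrisation
  may be necessary to keep the regularity at the new end point. The property is therefore assumed in
  the general theory and proved for each class separately.\<close>

definition limit_extendible :: "'a topology \<Rightarrow> ('a \<Rightarrow> 'a \<Rightarrow> ereal) \<Rightarrow> 'a curve_class \<Rightarrow> bool" where
  "limit_extendible T l C \<longleftrightarrow> (\<forall>I g. \<forall>p\<in>topspace T.
    causal_curve l C I g \<and> (\<forall>t\<in>I. \<exists>s\<in>I. t < s) \<and> (\<forall>t\<in>I. causal_le l (g t) p) \<and>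
    (\<forall>U. openin T U \<and> p \<in> U \<longrightarrow> (\<exists>t\<in>I. \<forall>s\<in>I. t \<le> s \<longrightarrow> g s \<in> U)) \<longrightarrow>
    future_extendible l C I g)"

text \<open>Antisymmetry does not exclude \<open>chron l x x\<close>: the triangle inequality leaves
  0 and \<infinity> as values of \<open>l x x\<close>, whence \<open>chron_irrefl\<close>. Boundary
  points are allowed, so timelike curves are only asked for at points with a chronological future or
  past; by the bubbling axioms a point with something strictly above or below it is of this
  kind.\<close>

locale spacetime = curve_class T C for T :: "'a topology" and C :: "'a curve_class" +
  fixes l :: "'a \<Rightarrow> 'a \<Rightarrow> ereal"
  assumes time_separation: "extended_time_separation (topspace T) l"
    and open_I_plus: "x \<in> topspace T \<Longrightarrow> openin T (I_plus (topspace T) l x)"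
    and open_I_minus: "x \<in> topspace T \<Longrightarrow> openin T (I_minus (topspace T) l x)"
    and separable: "separable_space T"
    and causal: "causal_space T l"
    and chron_irrefl: "x \<in> topspace T \<Longrightarrow> \<not> chron l x x"
    and closed_J_plus: "x \<in> topspace T \<Longrightarrow> closedin T (J_plus (topspace T) l x)"
    and closed_J_minus: "x \<in> topspace T \<Longrightarrow> closedin T (J_minus (topspace T) l x)"
    and compact_diamonds: "compact_causal_diamonds T l"
    and future_curve: "chron l x y \<Longrightarrow> x \<in> topspace T \<Longrightarrow> y \<in> topspace T \<Longrightarrow>
      \<exists>g. rel_curve (chron l) C {0..1} g \<and> g 0 = x"
    and past_curve: "chron l x y \<Longrightarrow> x \<in> topspace T \<Longrightarrow> y \<in> topspace T \<Longrightarrow>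
      \<exists>g. rel_curve (chron l) C {0..1} g \<and> g 1 = y"
    and future_bubbling: "strict_le l x y \<Longrightarrow> x \<in> topspace T \<Longrightarrow> y \<in> topspace T \<Longrightarrow>
      I_plus (topspace T) l x \<noteq> {}"
    and past_bubbling: "strict_le l x y \<Longrightarrow> x \<in> topspace T \<Longrightarrow> y \<in> topspace T \<Longrightarrow>
      I_minus (topspace T) l y \<noteq> {}"
    and no_spacelike_boundary: "x \<in> topspace T \<Longrightarrow>
      I_plus (topspace T) l x \<noteq> {} \<or> I_minus (topspace T) l x \<noteq> {}"
    and future_limits: "limit_extendible T l C"
    and past_limits: "limit_extendible T (time_reversal l) C"
begin

abbreviation "X \<equiv> topspace T"
abbreviation weak_order (infix "\<sqsubseteq>" 50) where "x \<sqsubseteq> y \<equiv> causal_le l x y"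
abbreviation strict_order (infix "\<sqsubset>" 50) where "x \<sqsubset> y \<equiv> strict_le l x y"
abbreviation chron_order (infix "\<lless>" 50) where "x \<lless> y \<equiv> chron l x y"

lemma le_refl: "x \<in> X \<Longrightarrow> x \<sqsubseteq> x"
  using time_separation by (simp add: extended_time_separation_def causal_le_def)

lemma le_trans: "x \<sqsubseteq> y \<Longrightarrow> y \<sqsubseteq> z \<Longrightarrow> x \<in> X \<Longrightarrow> y \<in> X \<Longrightarrow> z \<in> X \<Longrightarrow> x \<sqsubseteq> z"
proof -
  assume a: "x \<sqsubseteq> y" "y \<sqsubseteq> z" "x \<in> X" "y \<in> X" "z \<in> X"
  then have "l x y + l y z \<le> l x z"
    using time_separation by (auto simp: extended_time_separation_def causal_le_def)
  moreover have "0 \<le> l x y + l y z"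
    using a by (simp add: causal_le_def)
  ultimately show ?thesis
    by (simp add: causal_le_def)
qed

lemma le_antisym: "x \<sqsubseteq> y \<Longrightarrow> y \<sqsubseteq> x \<Longrightarrow> x \<in> X \<Longrightarrow> y \<in> X \<Longrightarrow> x = y"
  using causal by (simp add: causal_space_def antisymp_on_def)

lemma tdist_triangle_le:
  "x \<sqsubseteq> y \<Longrightarrow> y \<sqsubseteq> z \<Longrightarrow> x \<in> X \<Longrightarrow> y \<in> X \<Longrightarrow> z \<in> X \<Longrightarrow> tdist l x y + tdist l y z \<le> tdist l x z"
  using tdist_triangle[OF time_separation] by blast

lemma chron_le_trans: "x \<lless> y \<Longrightarrow> y \<sqsubseteq> z \<Longrightarrow> x \<in> X \<Longrightarrow> y \<in> X \<Longrightarrow> z \<in> X \<Longrightarrow> x \<lless> z"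
  using tdist_triangle_le[of x y z] chron_imp_causal_le[of l x y]
  unfolding chron_def by (meson add_pos_nonneg less_le_trans zero_le)

lemma le_chron_trans: "x \<sqsubseteq> y \<Longrightarrow> y \<lless> z \<Longrightarrow> x \<in> X \<Longrightarrow> y \<in> X \<Longrightarrow> z \<in> X \<Longrightarrow> x \<lless> z"
  using tdist_triangle_le[of x y z] chron_imp_causal_le[of l y z]
  unfolding chron_def by (meson add_nonneg_pos less_le_trans zero_le)

lemma chron_strict: "x \<lless> y \<Longrightarrow> x \<in> X \<Longrightarrow> x \<sqsubset> y"
  using chron_irrefl chron_imp_causal_le by (auto simp: strict_le_def)

lemma strict_imp_le: "x \<sqsubset> y \<Longrightarrow> x \<sqsubseteq> y"
  by (simp add: strict_le_def)

lemma strict_le_trans: "x \<sqsubset> y \<Longrightarrow> y \<sqsubseteq> z \<Longrightarrow> x \<in> X \<Longrightarrow> y \<in> X \<Longrightarrow> z \<in> X \<Longrightarrow> x \<sqsubset> z"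
  using le_trans[of x y z] le_antisym[of x y] by (auto simp: strict_le_def)

lemma le_strict_trans: "x \<sqsubseteq> y \<Longrightarrow> y \<sqsubset> z \<Longrightarrow> x \<in> X \<Longrightarrow> y \<in> X \<Longrightarrow> z \<in> X \<Longrightarrow> x \<sqsubset> z"
  using le_trans[of x y z] le_antisym[of y z] by (auto simp: strict_le_def)

lemma causal_curve_iff: "causal_curve l C I g \<longleftrightarrow> rel_curve (\<sqsubset>) C I g"
proof (cases "C I g")
  case True
  then have "g ` I \<subseteq> X"
    using curve_in by blast
  then have "antisymp_on (g ` I) (causal_le l)"
    using causal unfolding causal_space_def by (rule antisymp_on_subset[rotated])
  then show ?thesis
    using True curve_interval by (intro causal_curve_rel_curve) auto
qed (auto simp: causal_curve_def rel_curve_def)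

text \<open>The axioms are self-dual up to reflecting the parameter interval. Past extendibility,
  past rays and the second time function are obtained from their future counterparts for
  \<open>time_reversal l\<close>.\<close>

lemma rev: "spacetime T C (time_reversal l)"
proof unfold_locales
  show "extended_time_separation X (time_reversal l)"
    using time_separation unfolding extended_time_separation_def time_reversal_def
    by (metis add.commute)
  show "causal_space T (time_reversal l)"
    using causal unfolding causal_space_def antisymp_on_def causal_le_rev by blast
  show "compact_causal_diamonds T (time_reversal l)"
    using compact_diamonds unfolding compact_causal_diamonds_def J_rev by (metis Int_commute)
  show "limit_extendible T (time_reversal (time_reversal l)) C"
    using future_limits by (simp add: time_reversal_def)
  fix x assume x: "x \<in> X"
  show "openin T (I_plus X (time_reversal l) x)" "openin T (I_minus X (time_reversal l) x)"
    using x open_I_plus open_I_minus by (simp_all add: J_rev)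
  show "closedin T (J_plus X (time_reversal l) x)" "closedin T (J_minus X (time_reversal l) x)"
    using x closed_J_plus closed_J_minus by (simp_all add: J_rev)
  show "\<not> chron (time_reversal l) x x"
    using chron_irrefl x by (simp add: chron_rev)
  show "I_plus X (time_reversal l) x \<noteq> {} \<or> I_minus X (time_reversal l) x \<noteq> {}"
    using no_spacelike_boundary[OF x] by (auto simp: J_rev)
  fix y assume y: "y \<in> X"
  { assume "strict_le (time_reversal l) x y"
    then show "I_plus X (time_reversal l) x \<noteq> {}" "I_minus X (time_reversal l) y \<noteq> {}"
      using x y future_bubbling past_bubbling by (simp_all add: J_rev strict_le_rev) }
  have reverse: "rel_curve (chron (time_reversal l)) C {0..1} (\<lambda>t. g (1 - t))"
    if "rel_curve (\<lless>) C {0..1} g" for g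
  proof -
    have "rel_curve (chron (time_reversal l)) C ((\<lambda>t. t + - 1) -` uminus -` {0..1}) (\<lambda>t. g (- (t + - 1)))"
      using rel_curve_shift[OF rel_curve_reverse[OF that]] unfolding chron_rev .
    moreover have "(\<lambda>t. t + - 1) -` uminus -` {0..1} = {0..1::real}"
      by auto
    ultimately show ?thesis
      by (simp add: algebra_simps)
  qed
  assume "chron (time_reversal l) x y"
  then have yx: "y \<lless> x"
    by (simp add: chron_rev)
  obtain g where "rel_curve (\<lless>) C {0..1} g" "g 1 = x"
    using past_curve[OF yx y x] by blast
  then show "\<exists>g. rel_curve (chron (time_reversal l)) C {0..1} g \<and> g 0 = x"
    by (intro exI[of _ "\<lambda>t. g (1 - t)"]) (simp add: reverse)
  obtain g where "rel_curve (\<lless>) C {0..1} g" "g 0 = y"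
    using future_curve[OF yx y x] by blast
  then show "\<exists>g. rel_curve (chron (time_reversal l)) C {0..1} g \<and> g 1 = y"
    by (intro exI[of _ "\<lambda>t. g (1 - t)"]) (simp add: reverse)
qed (auto simp: separable future_limits past_limits)

end

section \<open>Extendibility as an order condition\<close>

lemma limit_extendibleD:
  assumes "limit_extendible T l C" "p \<in> topspace T" "causal_curve l C I g"
    and "\<forall>t\<in>I. \<exists>s\<in>I. t < s" "\<And>t. t \<in> I \<Longrightarrow> causal_le l (g t) p"
    and "\<And>U. openin T U \<Longrightarrow> p \<in> U \<Longrightarrow> \<exists>t\<in>I. \<forall>s\<in>I. t \<le> s \<longrightarrow> g s \<in> U"
  shows "future_extendible l C I g"
  using assms(1)[unfolded limit_extendible_def, rule_format, of p I g] assms(2-) by blast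

lemma homeomorphism_reflect:
  fixes I I' :: "real set"
  assumes "homeomorphism I I' \<phi> \<psi>"
  shows "homeomorphism (uminus -` I) (uminus -` I') (\<lambda>t. - \<phi> (- t)) (\<lambda>t. - \<psi> (- t))"
proof -
  have "continuous_on (uminus -` A) (\<lambda>t. - f (- t))" if "continuous_on A f" for A and f :: "real \<Rightarrow> real"
    using that by (intro continuous_on_minus continuous_on_compose2[OF that]) (auto intro: continuous_intros)
  moreover have "(\<lambda>t. - f (- t)) ` (uminus -` A) = uminus -` B" if "f ` A = B" for A B and f :: "real \<Rightarrow> real"
  proof -
    have "uminus -` A = uminus ` A" for A :: "real set"
      by force
    then show ?thesis
      using that by (auto simp: image_image)
  qed
  ultimately show ?thesis
    using assms unfolding homeomorphism_def by auto
qed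

lemma is_interval_reflect: "is_interval I \<Longrightarrow> is_interval (uminus -` I)" for I :: "real set"
proof -
  assume I: "is_interval I"
  show ?thesis
    unfolding is_interval_1
  proof (intro ballI allI impI)
    fix a b x assume "a \<in> uminus -` I" "b \<in> uminus -` I" "a \<le> x \<and> x \<le> b"
    then show "x \<in> uminus -` I"
      using I[unfolded is_interval_1, rule_format, of "- b" "- a" "- x"] by simp
  qed
qed

context spacetime
begin

text \<open>Both relations are implied by the chronological order, imply the strict causal one and
  compose with the causal order. The constructions of rays and extensions use only this, so they run
  once for causal and timelike curves.\<close>

definition curve_order :: "('a \<Rightarrow> 'a \<Rightarrow> bool) \<Rightarrow> bool" where
  "curve_order R \<longleftrightarrow> R = (\<sqsubset>) \<or> R = (\<lless>)"

lemma curve_order_strict: "curve_order R \<Longrightarrow> R x y \<Longrightarrow> x \<in> X \<Longrightarrow> x \<sqsubset> y"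
  using chron_strict by (auto simp: curve_order_def)

lemma curve_order_chron: "curve_order R \<Longrightarrow> x \<lless> y \<Longrightarrow> x \<in> X \<Longrightarrow> R x y"
  using chron_strict by (auto simp: curve_order_def)

lemma curve_order_trans1:
  "curve_order R \<Longrightarrow> R x y \<Longrightarrow> y \<sqsubseteq> z \<Longrightarrow> x \<in> X \<Longrightarrow> y \<in> X \<Longrightarrow> z \<in> X \<Longrightarrow> R x z"
  using strict_le_trans chron_le_trans by (auto simp: curve_order_def)

lemma rel_curve_strict:
  assumes "curve_order R" "rel_curve R C I g"
  shows "rel_curve (\<sqsubset>) C I g"
  using assms curve_order_strict curve_in unfolding rel_curve_def by blast

lemma rel_curve_chron:
  assumes "curve_order R" "rel_curve (\<lless>) C I g"
  shows "rel_curve R C I g"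
  using assms curve_order_chron curve_in unfolding rel_curve_def by blast

lemma strict_curve_le:
  assumes "rel_curve (\<sqsubset>) C I g" "s \<in> I" "t \<in> I" "s \<le> t"
  shows "g s \<sqsubseteq> g t"
proof (cases "s = t")
  case True
  then show ?thesis
    using assms curve_in le_refl unfolding rel_curve_def by blast
next
  case False
  then show ?thesis
    using assms strict_imp_le unfolding rel_curve_def by force
qed

lemma rel_curve_glue:
  assumes R: "curve_order R" and I: "rel_curve R C I g" and J: "rel_curve R C J g"
    and b: "b \<in> I" "b \<in> J" "I \<subseteq> {..b}" "J \<subseteq> {b..}"
  shows "rel_curve R C (I \<union> J) g"
  unfolding rel_curve_def
proof (intro conjI ballI impI)
  show "C (I \<union> J) g"
    using I J b glue unfolding rel_curve_def by blast
  have X: "g t \<in> X" if "t \<in> I \<union> J" for t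
    using that I J curve_in unfolding rel_curve_def by blast
  fix t s assume ts: "t \<in> I \<union> J" "s \<in> I \<union> J" "t < s"
  consider "t \<in> I" "s \<in> I" | "t \<in> J" "s \<in> J" | "t \<in> I" "t < b" "s \<in> J" "b \<le> s"
  proof -
    have "t \<in> J" if "t \<in> I" "\<not> t < b"
    proof -
      have "t = b"
        using that b(3) by fastforce
      then show ?thesis
        using b(2) by simp
    qed
    moreover have "s = b" if "s \<in> I" "t \<in> J"
    proof -
      have "s \<le> b" "b \<le> t"
        using that b(3,4) by auto
      then show ?thesis
        using ts(3) by simp
    qed
    ultimately show ?thesis
      using that ts b by blast
  qed
  then show "R (g t) (g s)"
  proof cases
    case 3
    then have "R (g t) (g b)"
      using I b(1) unfolding rel_curve_def by blast
    moreover have "g b \<sqsubseteq> g s"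
      using strict_curve_le[OF rel_curve_strict[OF R J]] b(2) 3 by blast
    ultimately show ?thesis
      using curve_order_trans1[OF R] X b(1) 3 by blast
  qed (use I J ts in \<open>auto simp: rel_curve_def\<close>)
qed

lemma rel_curve_join:
  assumes R: "curve_order R" and I: "rel_curve R C I g" and J: "rel_curve R C J \<delta>"
    and b: "b \<in> I" "0 \<in> J" "I \<subseteq> {..b}" "J \<subseteq> {0..}" "g b = \<delta> 0"
  shows "rel_curve R C (I \<union> (\<lambda>t. t - b) -` J) (\<lambda>t. if t \<le> b then g t else \<delta> (t - b))"
proof (rule rel_curve_glue[OF R _ _ b(1)])
  show "rel_curve R C I (\<lambda>t. if t \<le> b then g t else \<delta> (t - b))"
    using b(3) by (intro rel_curve_cong[OF I]) auto
  show "rel_curve R C ((\<lambda>t. t - b) -` J) (\<lambda>t. if t \<le> b then g t else \<delta> (t - b))"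
  proof (rule rel_curve_cong)
    show "rel_curve R C ((\<lambda>t. t - b) -` J) (\<lambda>t. \<delta> (t - b))"
      using rel_curve_shift[OF J, of "- b"] by simp
    fix t assume "t \<in> (\<lambda>t. t - b) -` J"
    then have "b \<le> t"
      using b(4) by auto
    then show "\<delta> (t - b) = (if t \<le> b then g t else \<delta> (t - b))"
      using b(5) by (cases "t = b") auto
  qed
qed (use b in auto)

text \<open>Limits are least upper bounds: any two cluster points of the end of a curve are comparable
  both ways because the sets \<open>J_plus\<close> and \<open>J_minus\<close> are closed.\<close>

lemma bounded_curve_converges:
  assumes g: "rel_curve (\<sqsubset>) C I g" and no_max: "\<forall>t\<in>I. \<exists>s\<in>I. t < s"
    and q: "q \<in> X" "\<forall>t\<in>I. g t \<sqsubseteq> q"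
  obtains p where "p \<in> X" "\<And>t. t \<in> I \<Longrightarrow> g t \<sqsubseteq> p"
    "\<And>U. openin T U \<Longrightarrow> p \<in> U \<Longrightarrow> \<exists>t\<in>I. \<forall>s\<in>I. t \<le> s \<longrightarrow> g s \<in> U"
proof -
  have CI: "C I g"
    using g by (simp add: rel_curve_def)
  have X: "g t \<in> X" if "t \<in> I" for t
    using CI curve_in that by blast
  have mono: "g s \<sqsubseteq> g t" if "s \<in> I" "t \<in> I" "s \<le> t" for s t
    using strict_curve_le[OF g] that .
  obtain t0 where t0: "t0 \<in> I"
    using curve_nonempty[OF CI] by blast
  define K where "K = J_plus X l (g t0) \<inter> J_minus X l q"
  have K: "compactin T K"
    using compact_diamonds X[OF t0] q(1) unfolding compact_causal_diamonds_def K_def by blast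
  \<comment> \<open>Stated for every cofinal set \<open>J\<close> of parameters: applied to
    \<open>I\<close> it gives the limit, applied to the parameters that stay outside a neighbourhood
    it gives a second cluster point. Both are least upper bounds of the curve, hence equal, although
    the second cannot lie in the neighbourhood.\<close>
  have lub: "\<exists>p\<in>X. (\<forall>t\<in>I. g t \<sqsubseteq> p \<and> p \<in> T closure_of g ` (J \<inter> {t..})) \<and>
    (\<forall>u\<in>X. (\<forall>t\<in>I. g t \<sqsubseteq> u) \<longrightarrow> p \<sqsubseteq> u)"
    if J: "J \<subseteq> I" "\<forall>t\<in>I. \<exists>s\<in>J. t \<le> s" for J
  proof -
    have "g ` (J \<inter> {t..}) \<subseteq> K \<and> g ` (J \<inter> {t..}) \<noteq> {}" if t: "t \<in> I \<inter> {t0..}" for t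
    proof
      show "g ` (J \<inter> {t..}) \<subseteq> K"
        using J(1) t q(2) X mono[OF t0] unfolding K_def J_plus_def J_minus_def by auto
      show "g ` (J \<inter> {t..}) \<noteq> {}"
        using J(2) t by force
    qed
    moreover have "g ` (J \<inter> {t..}) \<subseteq> g ` (J \<inter> {s..})" if "s \<le> t" for s t
      using that by auto
    ultimately obtain p where p: "p \<in> X"
      "\<And>t. t \<in> I \<inter> {t0..} \<Longrightarrow> p \<in> T closure_of g ` (J \<inter> {t..})"
      using nested_closures_common_point[OF K, of "I \<inter> {t0..}" "\<lambda>t. g ` (J \<inter> {t..})"] t0
      by (metis IntI atLeast_iff empty_iff order_refl)
    have p_closure: "p \<in> T closure_of g ` (J \<inter> {t..})" if "t \<in> I" for t
    proof -
      have "max t t0 \<in> I \<inter> {t0..}"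
        using that t0 by (auto simp: max_def)
      moreover have "g ` (J \<inter> {max t t0..}) \<subseteq> g ` (J \<inter> {t..})"
        by auto
      ultimately show ?thesis
        using p(2) closure_of_mono by blast
    qed
    have "g t \<sqsubseteq> p" if t: "t \<in> I" for t
    proof -
      have "g ` (J \<inter> {t..}) \<subseteq> J_plus X l (g t)"
        using J(1) mono[OF t] X unfolding J_plus_def by auto
      then have "p \<in> J_plus X l (g t)"
        using p_closure[OF t] closure_of_minimal[OF _ closed_J_plus[OF X[OF t]]] by blast
      then show ?thesis
        by (simp add: J_plus_def)
    qed
    moreover have "p \<sqsubseteq> u" if u: "u \<in> X" "\<forall>t\<in>I. g t \<sqsubseteq> u" for u
    proof -
      have "g ` (J \<inter> {t0..}) \<subseteq> J_minus X l u"
        using J(1) u X unfolding J_minus_def by auto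
      then have "p \<in> J_minus X l u"
        using p_closure[OF t0] closure_of_minimal[OF _ closed_J_minus[OF u(1)]] by blast
      then show ?thesis
        by (simp add: J_minus_def)
    qed
    ultimately show ?thesis
      using p(1) p_closure by blast
  qed
  have "\<forall>t\<in>I. \<exists>s\<in>I. t \<le> s"
    by blast
  then obtain p where p: "p \<in> X" "\<forall>t\<in>I. g t \<sqsubseteq> p" "\<forall>u\<in>X. (\<forall>t\<in>I. g t \<sqsubseteq> u) \<longrightarrow> p \<sqsubseteq> u"
    using lub[of I] by blast
  have "\<exists>t\<in>I. \<forall>s\<in>I. t \<le> s \<longrightarrow> g s \<in> U" if U: "openin T U" "p \<in> U" for U
  proof (rule ccontr)
    assume "\<not> ?thesis"
    then have cof: "\<forall>t\<in>I. \<exists>s\<in>{s \<in> I. g s \<notin> U}. t \<le> s"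
      by blast
    obtain p' where p': "p' \<in> X" "\<forall>t\<in>I. g t \<sqsubseteq> p'" "\<forall>u\<in>X. (\<forall>t\<in>I. g t \<sqsubseteq> u) \<longrightarrow> p' \<sqsubseteq> u"
      "p' \<in> T closure_of g ` ({s \<in> I. g s \<notin> U} \<inter> {t0..})"
      using lub[OF _ cof] t0 by blast
    have "p' = p"
      using p p' le_antisym by blast
    moreover have "T closure_of g ` ({s \<in> I. g s \<notin> U} \<inter> {t0..}) \<subseteq> X - U"
      using U X by (intro closure_of_minimal) auto
    ultimately show False
      using p'(4) U(2) by blast
  qed
  with p(1,2) show ?thesis
    using that by blast
qed

text \<open>A strict upper bound may lie far beyond the curve. If there is no last point, the bound
  traps the end of the curve in a compact diamond, so that it converges and extends through its
  limit. If there is a last point \<open>g m\<close>, the bound is strictly above it, hence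
  \<open>I_plus X l (g m)\<close> is nonempty and a timelike curve can be attached.\<close>

lemma future_extendible_iff:
  assumes g: "rel_curve (\<sqsubset>) C I g"
  shows "future_extendible l C I g \<longleftrightarrow> (\<exists>q\<in>X. \<forall>t\<in>I. g t \<sqsubset> q)"
proof
  assume "future_extendible l C I g"
  then obtain I' \<phi> \<psi> K g' t where h: "homeomorphism I I' \<phi> \<psi>" "I' \<subseteq> K" "t \<in> K" "\<forall>s\<in>I'. s < t"
    "causal_curve l C K g'" "\<forall>s\<in>I'. g' s = g (\<psi> s)"
    unfolding future_extendible_def by blast
  have K: "rel_curve (\<sqsubset>) C K g'"
    using h(5) causal_curve_iff by blast
  have "g s \<sqsubset> g' t" if "s \<in> I" for s
  proof -
    have "\<phi> s \<in> I'" "\<psi> (\<phi> s) = s"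
      using h(1) that unfolding homeomorphism_def by auto
    then show ?thesis
      using K h unfolding rel_curve_def by (metis subsetD)
  qed
  moreover have "g' t \<in> X"
    using K h(3) curve_in unfolding rel_curve_def by blast
  ultimately show "\<exists>q\<in>X. \<forall>t\<in>I. g t \<sqsubset> q"
    by blast
next
  assume "\<exists>q\<in>X. \<forall>t\<in>I. g t \<sqsubset> q"
  then obtain q where q: "q \<in> X" "\<forall>t\<in>I. g t \<sqsubset> q"
    by blast
  have CI: "C I g"
    using g by (simp add: rel_curve_def)
  show "future_extendible l C I g"
  proof (cases "\<forall>t\<in>I. \<exists>s\<in>I. t < s")
    case True
    then obtain p where p: "p \<in> X" "\<And>t. t \<in> I \<Longrightarrow> g t \<sqsubseteq> p"
      "\<And>U. openin T U \<Longrightarrow> p \<in> U \<Longrightarrow> \<exists>t\<in>I. \<forall>s\<in>I. t \<le> s \<longrightarrow> g s \<in> U"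
      using bounded_curve_converges[OF g True q(1)] q(2) strict_imp_le by blast
    show ?thesis
      using limit_extendibleD[OF future_limits p(1) _ True p(2,3)] g causal_curve_iff by blast
  next
    case False
    then obtain m where m: "m \<in> I" "I \<subseteq> {..m}"
      by force
    then have "I_plus X l (g m) \<noteq> {}"
      using q future_bubbling curve_in[OF CI] by blast
    then obtain c where c: "rel_curve (\<lless>) C {0..1} c" "c 0 = g m"
      using future_curve curve_in[OF CI m(1)] unfolding I_plus_def by blast
    have order: "curve_order (\<sqsubset>)"
      by (simp add: curve_order_def)
    let ?K = "I \<union> (\<lambda>t. t - m) -` {0..1}" and ?g = "\<lambda>t. if t \<le> m then g t else c (t - m)"
    have "rel_curve (\<sqsubset>) C ?K ?g"
      using m c(2) rel_curve_strict[OF _ c(1)]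
      by (intro rel_curve_join[OF order g]) (auto simp: curve_order_def)
    moreover from this have "is_interval ?K"
      using curve_interval unfolding rel_curve_def by blast
    moreover have "homeomorphism I I (\<lambda>t. t) (\<lambda>t. t)" "strict_mono_on I (\<lambda>t. t)"
      by (simp_all add: homeomorphism_def strict_mono_on_def)
    moreover have "\<exists>t\<in>?K. \<forall>s\<in>I. s < t"
      using m(2) by (intro bexI[of _ "m + 1"]) auto
    moreover have "\<forall>s\<in>I. ?g s = g s"
      using m(2) by auto
    moreover have "is_interval I"
      using curve_interval[OF CI] .
    ultimately show ?thesis
      unfolding future_extendible_def causal_curve_iff
      by (intro exI[of _ I] exI[of _ "\<lambda>t. t"] exI[of _ ?K] exI[of _ ?g] conjI) auto
  qed
qed

lemma past_extendible_reversal: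
  assumes "past_extendible l C I g"
  shows "future_extendible (time_reversal l) C (uminus -` I) (\<lambda>t. g (- t))"
proof -
  interpret rev: spacetime T C "time_reversal l"
    by (rule rev)
  obtain I' \<phi> \<psi> K g' t where h: "is_interval I'" "homeomorphism I I' \<phi> \<psi>" "strict_mono_on I \<phi>"
    "is_interval K" "I' \<subseteq> K" "t \<in> K" "\<forall>s\<in>I'. t < s" "causal_curve l C K g'"
    "\<forall>s\<in>I'. g' s = g (\<psi> s)"
    using assms unfolding past_extendible_def by blast
  have "causal_curve (time_reversal l) C (uminus -` K) (\<lambda>t. g' (- t))"
    using rel_curve_reverse h(8) unfolding causal_curve_iff rev.causal_curve_iff strict_le_rev by blast
  moreover have "strict_mono_on (uminus -` I) (\<lambda>t. - \<phi> (- t))"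
    using h(3) by (auto simp: strict_mono_on_def)
  moreover have "\<exists>t\<in>uminus -` K. \<forall>s\<in>uminus -` I'. s < t"
    using h(6,7) by (intro bexI[of _ "- t"]) (auto simp: less_minus_iff)
  moreover have "\<forall>s\<in>uminus -` I'. g' (- s) = g (- (- \<psi> (- s)))"
    using h(9) by simp
  moreover have "uminus -` I' \<subseteq> uminus -` K"
    using h(5) by auto
  ultimately show ?thesis
    using homeomorphism_reflect[OF h(2)] is_interval_reflect[OF h(1)] is_interval_reflect[OF h(4)]
    unfolding future_extendible_def
    by (intro exI[of _ "uminus -` I'"] exI[of _ "\<lambda>t. - \<phi> (- t)"] exI[of _ "\<lambda>t. - \<psi> (- t)"]
        exI[of _ "uminus -` K"] exI[of _ "\<lambda>t. g' (- t)"] conjI)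
qed

lemma future_extendible_reversal:
  assumes "future_extendible l C I g"
  shows "past_extendible (time_reversal l) C (uminus -` I) (\<lambda>t. g (- t))"
proof -
  interpret rev: spacetime T C "time_reversal l"
    by (rule rev)
  obtain I' \<phi> \<psi> K g' t where h: "is_interval I'" "homeomorphism I I' \<phi> \<psi>" "strict_mono_on I \<phi>"
    "is_interval K" "I' \<subseteq> K" "t \<in> K" "\<forall>s\<in>I'. s < t" "causal_curve l C K g'"
    "\<forall>s\<in>I'. g' s = g (\<psi> s)"
    using assms unfolding future_extendible_def by blast
  have "causal_curve (time_reversal l) C (uminus -` K) (\<lambda>t. g' (- t))"
    using rel_curve_reverse h(8) unfolding causal_curve_iff rev.causal_curve_iff strict_le_rev by blast
  moreover have "strict_mono_on (uminus -` I) (\<lambda>t. - \<phi> (- t))"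
    using h(3) by (auto simp: strict_mono_on_def)
  moreover have "\<exists>t\<in>uminus -` K. \<forall>s\<in>uminus -` I'. t < s"
    using h(6,7) by (intro bexI[of _ "- t"]) (auto simp: minus_less_iff)
  moreover have "\<forall>s\<in>uminus -` I'. g' (- s) = g (- (- \<psi> (- s)))"
    using h(9) by simp
  moreover have "uminus -` I' \<subseteq> uminus -` K"
    using h(5) by auto
  ultimately show ?thesis
    using homeomorphism_reflect[OF h(2)] is_interval_reflect[OF h(1)] is_interval_reflect[OF h(4)]
    unfolding past_extendible_def
    by (intro exI[of _ "uminus -` I'"] exI[of _ "\<lambda>t. - \<phi> (- t)"] exI[of _ "\<lambda>t. - \<psi> (- t)"]
        exI[of _ "uminus -` K"] exI[of _ "\<lambda>t. g' (- t)"] conjI)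
qed

lemma past_extendible_iff:
  assumes g: "rel_curve (\<sqsubset>) C I g"
  shows "past_extendible l C I g \<longleftrightarrow> (\<exists>q\<in>X. \<forall>t\<in>I. q \<sqsubset> g t)"
proof -
  interpret rev: spacetime T C "time_reversal l"
    by (rule rev)
  have "past_extendible l C I g \<longleftrightarrow> future_extendible (time_reversal l) C (uminus -` I) (\<lambda>t. g (- t))"
    using past_extendible_reversal
      rev.future_extendible_reversal[of "uminus -` I" "\<lambda>t. g (- t)"]
    by (auto simp: vimage_def time_reversal_def)
  also have "\<dots> \<longleftrightarrow> (\<exists>q\<in>X. \<forall>t\<in>uminus -` I. q \<sqsubset> g (- t))"
    using rev.future_extendible_iff rel_curve_reverse[OF g] by (simp add: strict_le_rev)
  also have "\<dots> \<longleftrightarrow> (\<exists>q\<in>X. \<forall>t\<in>I. q \<sqsubset> g t)"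
    by (metis minus_minus vimage_eq)
  finally show ?thesis .
qed

lemma inextendible_iff:
  assumes "rel_curve (\<sqsubset>) C I g"
  shows "inextendible l C I g \<longleftrightarrow>
    (\<nexists>q. q \<in> X \<and> (\<forall>t\<in>I. g t \<sqsubset> q)) \<and> (\<nexists>q. q \<in> X \<and> (\<forall>t\<in>I. q \<sqsubset> g t))"
  using assms future_extendible_iff past_extendible_iff causal_curve_iff
  unfolding inextendible_def by blast

section \<open>Time functions\<close>

lemma chron_trans: "x \<lless> y \<Longrightarrow> y \<lless> z \<Longrightarrow> x \<in> X \<Longrightarrow> y \<in> X \<Longrightarrow> z \<in> X \<Longrightarrow> x \<lless> z"
  by (rule chron_le_trans[OF _ chron_imp_causal_le])

text \<open>Along a timelike chain \<open>c\<close> the two descriptions \<open>{x. h x > r} = \<Union>s>r. I_plus (c s)\<close> and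
  \<open>{x. h x \<ge> r} = \<Inter>s<r. J_plus (c s)\<close> make the height \<open>h\<close> continuous.\<close>

lemma height_function:
  fixes c :: "real \<Rightarrow> 'a"
  assumes c: "\<And>s. s \<in> {0..1} \<Longrightarrow> c s \<in> X" "\<And>s t. 0 \<le> s \<Longrightarrow> s < t \<Longrightarrow> t \<le> 1 \<Longrightarrow> c s \<lless> c t"
    and start: "\<And>U. openin T U \<Longrightarrow> c 0 \<in> U \<Longrightarrow> \<exists>s. 0 < s \<and> s \<le> 1 \<and> c s \<in> U"
  obtains h :: "'a \<Rightarrow> real" where "\<And>x. 0 \<le> h x" "\<And>x. h x \<le> 1"
    "\<And>x y. x \<sqsubseteq> y \<Longrightarrow> x \<in> X \<Longrightarrow> y \<in> X \<Longrightarrow> h x \<le> h y"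
    "\<And>x. x \<in> X \<Longrightarrow> 0 < h x \<longleftrightarrow> c 0 \<lless> x" "continuous_map T euclideanreal h"
proof -
  \<comment> \<open>Inserting 0 gives height 0 to the points that have no \<open>c s\<close> in
    their chronological past.\<close>
  define S where "S = (\<lambda>x. insert 0 {s \<in> {0..1::real}. c s \<lless> x})"
  define h where "h = (\<lambda>x. Sup (S x))"
  have bdd: "bdd_above (S x)" for x
    unfolding S_def by (intro bdd_aboveI[of _ 1]) auto
  have upper: "s \<le> h x" if "s \<in> S x" for s x
    unfolding h_def using bdd that by (rule cSup_upper[rotated])
  have least: "h x \<le> r" if "\<And>s. s \<in> S x \<Longrightarrow> s \<le> r" for x r
    unfolding h_def using that by (intro cSup_least) (auto simp: S_def)
  have h0: "0 \<le> h x" for x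
    by (rule upper) (simp add: S_def)
  have h1: "h x \<le> 1" for x
    by (rule least) (auto simp: S_def)
  have less: "\<exists>s\<in>{0..1}. r < s \<and> c s \<lless> x" if "r < h x" "0 \<le> r" for r x
  proof (rule ccontr)
    assume "\<not> ?thesis"
    then have "s \<le> r" if "s \<in> S x" for s
      using that \<open>0 \<le> r\<close> unfolding S_def by (metis (mono_tags, lifting) insertE mem_Collect_eq not_le)
    then show False
      using least[of x r] \<open>r < h x\<close> by simp
  qed
  have le_chron: "c s \<sqsubseteq> c t" if "0 \<le> s" "s \<le> t" "t \<le> 1" for s t
    using that c chron_imp_causal_le[of l "c s" "c t"] le_refl by (cases "s = t") auto
  have mono: "h x \<le> h y" if "x \<sqsubseteq> y" "x \<in> X" "y \<in> X" for x y
  proof (rule least)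
    fix s assume "s \<in> S x"
    then have "s \<in> S y"
      using that c(1) chron_le_trans[of "c s" x y] by (auto simp: S_def)
    then show "s \<le> h y"
      by (rule upper)
  qed
  have pos: "0 < h x \<longleftrightarrow> c 0 \<lless> x" if x: "x \<in> X" for x
  proof
    assume "0 < h x"
    then obtain s where "s \<in> {0..1}" "0 < s" "c s \<lless> x"
      using less[of 0 x] by auto
    then show "c 0 \<lless> x"
      using le_chron_trans[OF le_chron[of 0 s]] c(1) x by auto
  next
    assume "c 0 \<lless> x"
    then have "c 0 \<in> I_minus X l x"
      using c(1) by (simp add: I_minus_def)
    then obtain s where "0 < s" "s \<le> 1" "c s \<lless> x"
      using start[OF open_I_minus[OF x]] by (auto simp: I_minus_def)
    then show "0 < h x"
      using upper[of s x] by (simp add: S_def)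
  qed
  have "openin T {x \<in> X. a < h x}" for a
  proof (cases "a < 0")
    case True
    then have "{x \<in> X. a < h x} = X"
      using h0 order.strict_trans2 by blast
    then show ?thesis
      by simp
  next
    case False
    have "{x \<in> X. a < h x} = (\<Union>s\<in>{s \<in> {0..1}. a < s}. I_plus X l (c s))"
    proof (intro equalityI subsetI)
      fix x assume x: "x \<in> {x \<in> X. a < h x}"
      then obtain s where "s \<in> {0..1}" "a < s" "c s \<lless> x"
        using False less[of a x] by auto
      with x show "x \<in> (\<Union>s\<in>{s \<in> {0..1}. a < s}. I_plus X l (c s))"
        by (intro UN_I[of s]) (simp_all add: I_plus_def)
    next
      fix x assume "x \<in> (\<Union>s\<in>{s \<in> {0..1}. a < s}. I_plus X l (c s))"
      then obtain s where s: "s \<in> {0..1}" "a < s" "x \<in> X" "c s \<lless> x"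
        by (auto simp: I_plus_def)
      then show "x \<in> {x \<in> X. a < h x}"
        using upper[of s x] by (simp add: S_def)
    qed
    then show ?thesis
      using c(1) open_I_plus by auto
  qed
  moreover have closed: "closedin T {x \<in> X. a \<le> h x}" for a
  proof (cases "0 < a \<and> a \<le> 1")
    case True
    have "{x \<in> X. a \<le> h x} = (\<Inter>s\<in>{0..<a}. J_plus X l (c s))"
    proof (intro equalityI subsetI)
      fix x assume x: "x \<in> {x \<in> X. a \<le> h x}"
      have "c s \<sqsubseteq> x" if s: "s \<in> {0..<a}" for s
      proof -
        obtain t where "t \<in> {0..1}" "s < t" "c t \<lless> x"
          using less[of s x] s x by auto
        moreover from this have "c s \<sqsubseteq> c t" "c s \<in> X" "c t \<in> X" "x \<in> X"
          using le_chron[of s t] s c(1) x by auto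
        ultimately show ?thesis
          using chron_imp_causal_le[OF le_chron_trans[of "c s" "c t" x]] by simp
      qed
      then show "x \<in> (\<Inter>s\<in>{0..<a}. J_plus X l (c s))"
        using x by (simp add: J_plus_def)
    next
      fix x assume x: "x \<in> (\<Inter>s\<in>{0..<a}. J_plus X l (c s))"
      then have "x \<in> X"
        using True by (auto simp: J_plus_def)
      moreover have "s \<le> h x" if s: "0 < s" "s < a" for s
      proof -
        \<comment> \<open>Only the causal relation of \<open>c t\<close> to \<open>x\<close> is
          known; starting at the earlier point \<open>c s\<close> makes it chronological.\<close>
        obtain t where t: "s < t" "t < a"
          using s(2) dense by blast
        then have "c s \<lless> c t" "c t \<sqsubseteq> x"
          using s t x True c(2) by (auto simp: J_plus_def)
        then have "c s \<lless> x"
          using chron_le_trans s t True c(1) \<open>x \<in> X\<close> by auto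
        then show ?thesis
          using upper[of s x] s True by (simp add: S_def)
      qed
      ultimately show "x \<in> {x \<in> X. a \<le> h x}"
        using dense_le_bounded[of 0 a "h x"] True by auto
    qed
    moreover have "closedin T (\<Inter>s\<in>{0..<a}. J_plus X l (c s))"
      using True c(1) closed_J_plus by (intro closedin_INT) auto
    ultimately show ?thesis
      by simp
  next
    case False
    have "{x \<in> X. a \<le> h x} = (if a \<le> 0 then X else {})"
      using False h0 h1 by (auto intro: order_trans)
    then show ?thesis
      by auto
  qed
  moreover have "openin T {x \<in> X. h x < a}" for a
  proof -
    have "{x \<in> X. h x < a} = X - {x \<in> X. a \<le> h x}"
      by auto
    then show ?thesis
      using openin_diff[OF openin_topspace closed] by metis
  qed
  ultimately have "continuous_map T euclideanreal h"
    by (simp add: continuous_map_upper_lower_semicontinuous_lt)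
  with h0 h1 mono pos show ?thesis
    using that by blast
qed

text \<open>A timelike curve ending at \<open>y\<close> has two parameters close to its end. The
  first gives \<open>z\<close>, the second shows that the open set between \<open>z\<close> and
  \<open>y\<close> is nonempty, so that a dense sequence meets it.\<close>

lemma past_approximation:
  assumes y: "y \<in> X" "I_minus X l y \<noteq> {}" and V: "openin T V" "y \<in> V"
  obtains z where "z \<in> V" "z \<in> X" "z \<lless> y" "I_plus X l z \<inter> I_minus X l y \<noteq> {}"
proof -
  obtain c where c: "rel_curve (\<lless>) C {0..1} c" "c 1 = y"
    using past_curve y unfolding I_minus_def by blast
  then have C: "C {0..1} c"
    by (simp add: rel_curve_def)
  obtain e where e: "e > 0" "\<And>s. s \<in> {0..1} \<Longrightarrow> \<bar>s - 1\<bar> < e \<Longrightarrow> c s \<in> V"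
    using curve_nbhd[OF C _ V(1), of 1] c(2) V(2) by auto
  define s where "s = max 0 (1 - e / 2)"
  have s: "0 \<le> s" "s < 1" "\<bar>s - 1\<bar> < e"
    using e(1) by (auto simp: s_def)
  obtain r where r: "s < r" "r < 1"
    using s dense by blast
  have "c s \<lless> c 1" "c s \<lless> c r" "c r \<lless> c 1"
    using c(1) s r by (auto simp: rel_curve_def)
  then have "c r \<in> I_plus X l (c s) \<inter> I_minus X l y"
    using curve_in[OF C, of r] s r c(2) by (simp add: I_plus_def I_minus_def)
  then show ?thesis
    using that[of "c s"] e(2)[of s] s curve_in[OF C, of s] \<open>c s \<lless> c 1\<close> c(2) by auto
qed

text \<open>Strictness: if \<open>x \<sqsubset> y\<close>, then \<open>y\<close> lies outside the
  closed set \<open>J_minus X l x\<close>, hence so does some \<open>z \<lless> y\<close>. A dense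
  point \<open>q n\<close> between \<open>z\<close> and \<open>y\<close> contributes a positive
  height at \<open>y\<close> and none at \<open>x\<close>. The clause with finite sets
  \<open>F\<close> expresses smallness near past ends without mentioning curves: towards the past an
  inextendible curve without a first point leaves the future of each point of \<open>F\<close>. The
  bound 2 is the sum of the weights.\<close>

lemma exists_time_function:
  obtains \<tau> :: "'a \<Rightarrow> real" where "\<And>x. 0 \<le> \<tau> x" "\<And>x. \<tau> x \<le> 2"
    "\<And>x y. x \<sqsubseteq> y \<Longrightarrow> x \<in> X \<Longrightarrow> y \<in> X \<Longrightarrow> \<tau> x \<le> \<tau> y"
    "\<And>x y. x \<sqsubset> y \<Longrightarrow> x \<in> X \<Longrightarrow> y \<in> X \<Longrightarrow> \<tau> x < \<tau> y"
    "\<And>x. x \<in> X \<Longrightarrow> 0 < \<tau> x \<longleftrightarrow> I_minus X l x \<noteq> {}"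
    "\<And>e. 0 < e \<Longrightarrow> \<exists>F. finite F \<and> F \<subseteq> X \<and> (\<forall>x\<in>X. (\<forall>q\<in>F. \<not> q \<sqsubseteq> x) \<longrightarrow> \<tau> x < e)"
    "\<And>I g. C I g \<Longrightarrow> continuous_on I (\<lambda>t. \<tau> (g t))"
proof (cases "X = {}")
  case True
  then have "\<not> C I g" for I g
    using curve_in curve_nonempty by blast
  with True show ?thesis
    using that[of "\<lambda>_. 0"] by force
next
  case False
  obtain D where D: "countable D" "D \<subseteq> X" "T closure_of D = X"
    using separable by (auto simp: separable_space_def)
  then have "D \<noteq> {}"
    using False closure_of_empty by metis
  define q where "q = from_nat_into D"
  have range_q: "range q = D"
    using D(1) \<open>D \<noteq> {}\<close> by (simp add: q_def range_from_nat_into)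
  then have qX: "q n \<in> X" for n
    using D(2) by auto
  have dense: "\<exists>n. q n \<in> U" if "openin T U" "U \<noteq> {}" for U
    using that D(3) range_q openin_subset by (metis dense_intersects_open imageE inf_commute disjoint_iff)
  have "\<exists>h. (\<forall>x. 0 \<le> h x \<and> h x \<le> (1::real)) \<and> (\<forall>x\<in>X. \<forall>y\<in>X. x \<sqsubseteq> y \<longrightarrow> h x \<le> h y) \<and>
    (\<forall>x\<in>X. 0 < h x \<longleftrightarrow> q n \<lless> x) \<and> continuous_map T euclideanreal h" for n
  proof (cases "I_plus X l (q n) = {}")
    \<comment> \<open>No timelike curve need start at \<open>q n\<close>, and no point lies in its
      chronological future, so the zero function has the required properties.\<close>
    case True
    then show ?thesis
      by (intro exI[of _ "\<lambda>_. 0"]) (auto simp: I_plus_def)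
  next
    case False
    then obtain c where c: "rel_curve (\<lless>) C {0..1} c" "c 0 = q n"
      using future_curve qX unfolding I_plus_def by blast
    then have C: "C {0..1} c"
      by (simp add: rel_curve_def)
    have "\<exists>s. 0 < s \<and> s \<le> 1 \<and> c s \<in> U" if U: "openin T U" "c 0 \<in> U" for U
    proof -
      obtain e where e: "e > 0" "\<And>s. s \<in> {0..1} \<Longrightarrow> \<bar>s - 0\<bar> < e \<Longrightarrow> c s \<in> U"
        using curve_nbhd[OF C _ U(1), of 0] U(2) by auto
      then show ?thesis
        by (intro exI[of _ "min 1 (e / 2)"]) auto
    qed
    moreover have "c s \<lless> c t" if "0 \<le> s" "s < t" "t \<le> 1" for s t
      using c(1) that by (simp add: rel_curve_def)
    ultimately obtain h where h: "\<And>x. 0 \<le> h x" "\<And>x. h x \<le> (1::real)"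
      "\<And>x y. x \<sqsubseteq> y \<Longrightarrow> x \<in> X \<Longrightarrow> y \<in> X \<Longrightarrow> h x \<le> h y"
      "\<And>x. x \<in> X \<Longrightarrow> 0 < h x \<longleftrightarrow> c 0 \<lless> x" "continuous_map T euclideanreal h"
      using height_function[of c thesis] curve_in[OF C] by blast
    then show ?thesis
      unfolding c(2) by (intro exI[of _ h]) simp
  qed
  then obtain h :: "nat \<Rightarrow> 'a \<Rightarrow> real" where h: "\<And>n x. 0 \<le> h n x" "\<And>n x. h n x \<le> 1"
    "\<And>n x y. x \<in> X \<Longrightarrow> y \<in> X \<Longrightarrow> x \<sqsubseteq> y \<Longrightarrow> h n x \<le> h n y"
    "\<And>n x. x \<in> X \<Longrightarrow> 0 < h n x \<longleftrightarrow> q n \<lless> x" "\<And>n. continuous_map T euclideanreal (h n)"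
    by metis
  define f where "f = (\<lambda>n x. (1 / 2) ^ n * h n x)"
  define \<tau> where "\<tau> = (\<lambda>x. \<Sum>n. f n x)"
  have geometric: "summable (\<lambda>n. (1 / 2 :: real) ^ n)" "(\<Sum>n. (1 / 2 :: real) ^ n) = 2"
    using suminf_geometric[of "1 / 2 :: real"] by (auto intro: summable_geometric)
  have f0: "0 \<le> f n x" and f1: "f n x \<le> (1 / 2) ^ n" for n x
    using h(1,2)[of n x] by (auto simp: f_def mult_left_le)
  have sf: "summable (\<lambda>n. f n x)" for x
    using f0 f1 by (intro summable_comparison_test[OF _ geometric(1)]) auto
  have f_mono: "f n x \<le> f n y" if "x \<sqsubseteq> y" "x \<in> X" "y \<in> X" for n x y
    using h(3)[of x y n] that by (simp add: f_def)
  have f_less: "f n x < f n y" if "x \<in> X" "y \<in> X" "q n \<lless> y" "\<not> q n \<lless> x" for n x y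
    using h(4)[of x n] h(4)[of y n] that by (simp add: f_def)
  have less: "\<tau> x < \<tau> y" if "\<And>n. f n x \<le> f n y" "f n x < f n y" for x y n
  proof -
    have "0 < (\<Sum>n. f n y - f n x)"
      using that sf by (intro suminf_pos2[of _ n] summable_diff) auto
    then show ?thesis
      using suminf_diff[OF sf sf, of y x] by (simp add: \<tau>_def)
  qed
  show ?thesis
  proof (rule that)
    show "0 \<le> \<tau> x" for x
      unfolding \<tau>_def using f0 sf by (intro suminf_nonneg) auto
    show "\<tau> x \<le> 2" for x
      using suminf_le[OF f1 sf geometric(1)] geometric(2) by (simp add: \<tau>_def)
    show "\<tau> x \<le> \<tau> y" if "x \<sqsubseteq> y" "x \<in> X" "y \<in> X" for x y
      unfolding \<tau>_def using f_mono[OF that] sf by (intro suminf_le) auto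
    show "\<tau> x < \<tau> y" if xy: "x \<sqsubset> y" "x \<in> X" "y \<in> X" for x y
    proof -
      have y: "y \<in> X - J_minus X l x"
        using xy le_antisym by (auto simp: J_minus_def strict_le_def)
      have "openin T (X - J_minus X l x)"
        using closed_J_minus[OF xy(2)] by (simp add: openin_diff)
      then obtain z where z: "z \<in> X - J_minus X l x" "z \<in> X" "z \<lless> y"
        "I_plus X l z \<inter> I_minus X l y \<noteq> {}"
        using past_approximation[OF xy(3) past_bubbling[OF xy] _ y] by metis
      have "openin T (I_plus X l z \<inter> I_minus X l y)"
        using open_I_plus open_I_minus xy(3) z(2) by (intro openin_Int) auto
      then obtain n where n: "q n \<in> I_plus X l z \<inter> I_minus X l y"
        using dense z(4) by meson
      have "\<not> q n \<lless> x"
        using n z(1) chron_trans[of z "q n" x] chron_imp_causal_le[of l z x] xy(2)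
        by (auto simp: I_plus_def J_minus_def)
      then show ?thesis
        using less[of x y n] f_mono[OF strict_imp_le] f_less[of x y n] xy n by (simp add: I_minus_def)
    qed
    show "0 < \<tau> x \<longleftrightarrow> I_minus X l x \<noteq> {}" if x: "x \<in> X" for x
    proof
      assume "0 < \<tau> x"
      then have "\<exists>n. f n x \<noteq> 0"
        by (rule contrapos_pp) (simp add: \<tau>_def)
      then obtain n where "h n x \<noteq> 0"
        by (auto simp: f_def)
      then have "0 < h n x"
        using h(1)[of n x] by simp
      then show "I_minus X l x \<noteq> {}"
        using h(4)[OF x] qX by (auto simp: I_minus_def)
    next
      assume "I_minus X l x \<noteq> {}"
      then obtain n where "q n \<lless> x"
        using dense[OF open_I_minus[OF x]] by (auto simp: I_minus_def)
      then have "0 < f n x"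
        using h(4)[OF x] by (simp add: f_def)
      then show "0 < \<tau> x"
        unfolding \<tau>_def using f0 sf by (intro suminf_pos2[of _ n]) auto
    qed
    show "\<exists>F. finite F \<and> F \<subseteq> X \<and> (\<forall>x\<in>X. (\<forall>q\<in>F. \<not> q \<sqsubseteq> x) \<longrightarrow> \<tau> x < e)" if e: "0 < e" for e
    proof -
      \<comment> \<open>\<open>F\<close> consists of the first \<open>N\<close> dense points. Away
        from their futures the first \<open>N\<close> terms vanish, and the tail is at most
        \<open>2 * (1 / 2) ^ N\<close>.\<close>
      obtain N where N: "(1 / 2) ^ N < e / 2"
        using real_arch_pow_inv[of "e / 2" "1 / 2"] e by auto
      have "\<tau> x < e" if x: "x \<in> X" "\<forall>p\<in>q ` {..<N}. \<not> p \<sqsubseteq> x" for x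
      proof -
        have "f n x = 0" if "n < N" for n
          using that x h(4)[OF x(1), of n] h(1)[of n x] chron_imp_causal_le[of l "q n" x]
          by (force simp: f_def)
        then have "\<tau> x = (\<Sum>n. f (n + N) x)"
          unfolding \<tau>_def using suminf_split_initial_segment[OF sf, of x N] by simp
        also have "\<dots> \<le> (\<Sum>n. (1 / 2) ^ N * (1 / 2) ^ n)"
          using f1[of "_ + N" x] sf geometric(1)
          by (intro suminf_le summable_mult) (auto simp: power_add mult.commute intro: summable_ignore_initial_segment)
        also have "\<dots> = (1 / 2) ^ N * 2"
          using geometric by (simp add: suminf_mult)
        finally show ?thesis
          using N by simp
      qed
      then show ?thesis
        using qX by (intro exI[of _ "q ` {..<N}"]) auto
    qed
    show "continuous_on I (\<lambda>t. \<tau> (g t))" if I: "C I g" for I g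
    proof (rule uniform_limit_theorem)
      show "uniform_limit I (\<lambda>n t. \<Sum>i<n. f i (g t)) (\<lambda>t. \<tau> (g t)) sequentially"
        unfolding \<tau>_def using f0 f1 geometric(1) by (intro Weierstrass_m_test) auto
      have "continuous_on I (\<lambda>t. h n (g t))" for n
        using continuous_map_compose[OF _ h(5)] is_curve[OF I] unfolding curve_def comp_def
        by (metis continuous_map_iff_continuous)
      then show "\<forall>\<^sub>F n in sequentially. continuous_on I (\<lambda>t. \<Sum>i<n. f i (g t))"
        unfolding f_def by (intro always_eventually allI continuous_intros)
    qed simp
  qed
qed

section \<open>Inextendible curves\<close>

text \<open>Possibly smaller than the set of points that are \<open>R\<close>-later than
  \<open>p\<close>, since such points need not be joined to \<open>p\<close> by an
  \<open>R\<close>-curve. Admitting \<open>b = 0\<close> makes \<open>p\<close> itself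
  reachable.\<close>

definition reach :: "('a \<Rightarrow> 'a \<Rightarrow> bool) \<Rightarrow> 'a \<Rightarrow> 'a set" where
  "reach R p = {q. \<exists>b\<ge>0. \<exists>g. rel_curve R C {0..b} g \<and> g 0 = p \<and> g b = q}"

lemma reach_refl: "p \<in> X \<Longrightarrow> p \<in> reach R p"
  unfolding reach_def using rel_curve_point[of p R 0] by force

lemma reach_in: "q \<in> reach R p \<Longrightarrow> q \<in> X"
  unfolding reach_def rel_curve_def using curve_in by force

lemma reach_trans:
  assumes R: "curve_order R" and "q \<in> reach R p" "r \<in> reach R q"
  shows "r \<in> reach R p"
proof -
  obtain b g where g: "b \<ge> 0" "rel_curve R C {0..b} g" "g 0 = p" "g b = q"
    using assms(2) by (auto simp: reach_def)
  obtain c \<delta> where \<delta>: "c \<ge> 0" "rel_curve R C {0..c} \<delta>" "\<delta> 0 = q" "\<delta> c = r"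
    using assms(3) by (auto simp: reach_def)
  have "{0..b} \<union> (\<lambda>t. t - b) -` {0..c} = {0..b + c}"
    using g(1) \<delta>(1) by auto
  then have "rel_curve R C {0..b + c} (\<lambda>t. if t \<le> b then g t else \<delta> (t - b))"
    using rel_curve_join[OF R g(2) \<delta>(2)] g \<delta> by auto
  then show ?thesis
    unfolding reach_def using g \<delta>
    by (intro CollectI exI[of _ "b + c"] conjI exI[of _ "\<lambda>t. if t \<le> b then g t else \<delta> (t - b)"]) auto
qed

lemma reach_unit_curve:
  assumes "q \<in> reach R p" "q \<noteq> p"
  obtains g where "rel_curve R C {0..1} g" "g 0 = p" "g 1 = q"
proof -
  obtain b g where g: "b \<ge> 0" "rel_curve R C {0..b} g" "g 0 = p" "g b = q"
    using assms(1) by (auto simp: reach_def)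
  then have "0 < b"
    using assms(2) by (cases "b = 0") auto
  then show ?thesis
    using that[of "\<lambda>t. g (b * t)"] rel_curve_unit_interval[OF g(2)] g by simp
qed

lemma curve_reach:
  assumes "rel_curve R C {s..t} g" "s \<le> t"
  shows "g t \<in> reach R (g s)"
proof -
  have "(\<lambda>u. u + s) -` {s..t} = {0..t - s}"
    by auto
  then show ?thesis
    unfolding reach_def using rel_curve_shift[OF assms(1), of s] assms(2)
    by (intro CollectI exI[of _ "t - s"] conjI exI[of _ "\<lambda>u. g (u + s)"]) auto
qed

lemma reach_le:
  assumes R: "curve_order R" and "q \<in> reach R p"
  shows "p \<sqsubseteq> q"
proof -
  obtain b g where g: "b \<ge> 0" "rel_curve R C {0..b} g" "g 0 = p" "g b = q"
    using assms(2) by (auto simp: reach_def)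
  then show ?thesis
    using strict_curve_le[OF rel_curve_strict[OF R g(2)], of 0 b] by simp
qed

text \<open>Timelike curves are \<open>R\<close>-curves, so a point at which the construction of a
  ray gets stuck can only lie in the future chronological boundary.\<close>

lemma terminal_reach:
  assumes R: "curve_order R" and p: "p \<in> X" and terminal: "reach R p \<subseteq> {p}"
  shows "I_plus X l p = {}"
proof (rule ccontr)
  assume "I_plus X l p \<noteq> {}"
  then obtain c where c: "rel_curve (\<lless>) C {0..1} c" "c 0 = p"
    using future_curve p unfolding I_plus_def by blast
  then have "c 1 \<in> reach R p"
    using curve_reach[OF rel_curve_chron[OF R c(1)]] by simp
  moreover have "p \<lless> c 1"
    using c by (auto simp: rel_curve_def)
  ultimately show False
    using terminal chron_irrefl[OF p] by auto
qed

text \<open>Every step covers more than half of the time still available. If the resulting curve ended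
  at \<open>q\<close>, no time would be left at \<open>q\<close>.\<close>

lemma future_ray:
  assumes R: "curve_order R" and x: "x \<in> X"
  obtains I g where "0 \<in> I" "I \<subseteq> {0..}" "rel_curve R C I g" "g 0 = x"
    "\<nexists>q. q \<in> X \<and> (\<forall>t\<in>I. g t \<sqsubset> q)"
proof (cases "\<exists>p\<in>reach R x. reach R p \<subseteq> {p}")
  case True
  then obtain p b g where p: "reach R p \<subseteq> {p}" and g: "b \<ge> 0" "rel_curve R C {0..b} g" "g 0 = x" "g b = p"
    by (auto simp: reach_def)
  have pX: "p \<in> X"
    using g curve_in[of "{0..b}" g b] by (simp add: rel_curve_def)
  \<comment> \<open>The finite curve ending at the terminal point \<open>p\<close> is already a ray:
    a strict upper bound would be strictly above \<open>p\<close> and, without bubbling, give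
    \<open>p\<close> a chronological future.\<close>
  have "\<not> (q \<in> X \<and> (\<forall>t\<in>{0..b}. g t \<sqsubset> q))" for q
    using future_bubbling[of p q] pX terminal_reach[OF R pX p] g(1,4)
    by (metis atLeastAtMost_iff order_refl)
  then show ?thesis
    using that[of "{0..b}" g] g by auto
next
  case False
  obtain \<tau> :: "'a \<Rightarrow> real" where \<tau>: "\<And>x. \<tau> x \<le> 2"
    "\<And>x y. x \<sqsubseteq> y \<Longrightarrow> x \<in> X \<Longrightarrow> y \<in> X \<Longrightarrow> \<tau> x \<le> \<tau> y"
    "\<And>x y. x \<sqsubset> y \<Longrightarrow> x \<in> X \<Longrightarrow> y \<in> X \<Longrightarrow> \<tau> x < \<tau> y"
    using exists_time_function by metis
  \<comment> \<open>The supremum is taken over \<open>reach R p\<close> and not over all later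
    points, because the next step has to be an \<open>R\<close>-curve.\<close>
  define s where "s = (\<lambda>p. Sup (\<tau> ` reach R p))"
  have bdd: "bdd_above (\<tau> ` reach R p)" for p
    using \<tau>(1) by (intro bdd_aboveI[of _ 2]) auto
  have s_upper: "\<tau> q \<le> s p" if "q \<in> reach R p" for p q
    unfolding s_def using that bdd by (intro cSup_upper) auto
  have "\<exists>q\<in>reach R p. q \<noteq> p \<and> (\<tau> p + s p) / 2 < \<tau> q" if p: "p \<in> reach R x" for p
  proof -
    obtain q where q: "q \<in> reach R p" "q \<noteq> p"
      using False p by blast
    have "\<tau> p < \<tau> q"
      using \<tau>(3) reach_le[OF R q(1)] q p reach_in by (auto simp: strict_le_def)
    then have "(\<tau> p + s p) / 2 < s p"
      using s_upper[OF q(1)] by simp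
    then obtain r where r: "r \<in> reach R p" "(\<tau> p + s p) / 2 < \<tau> r"
      unfolding s_def using less_cSup_iff[OF _ bdd] q(1) by blast
    moreover have "\<tau> p \<le> s p"
      using s_upper reach_refl reach_in[OF p] by blast
    ultimately have "r \<noteq> p"
      by auto
    with r show ?thesis
      by blast
  qed
  then obtain nxt where nxt: "\<And>p. p \<in> reach R x \<Longrightarrow>
      nxt p \<in> reach R p \<and> nxt p \<noteq> p \<and> (\<tau> p + s p) / 2 < \<tau> (nxt p)"
    by metis
  define P where "P = (\<lambda>n. (nxt ^^ n) x)"
  have P0: "P 0 = x" and PSuc: "P (Suc n) = nxt (P n)" for n
    by (simp_all add: P_def)
  have P_reach: "P n \<in> reach R x" for n
  proof (induction n)
    case (Suc n)
    then show ?case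
      using nxt reach_trans[OF R] unfolding PSuc by blast
  qed (use P0 reach_refl x in auto)
  have "\<exists>c. rel_curve R C {0..1} c \<and> c 0 = P n \<and> c 1 = P (Suc n)" for n
    using nxt[OF P_reach[of n]] reach_unit_curve unfolding PSuc by metis
  then obtain c where c: "\<And>n. rel_curve R C {0..1} (c n)" "\<And>n. c n 0 = P n" "\<And>n. c n 1 = P (Suc n)"
    by metis
  define g where "g = (\<lambda>t. c (nat \<lfloor>t\<rfloor>) (t - real_of_int \<lfloor>t\<rfloor>))"
  have g_nat: "g (real n) = P n" for n
    by (simp add: g_def c)
  have step: "rel_curve R C {real n..real n + 1} g" for n
  proof (rule rel_curve_cong)
    have "(\<lambda>t. t + - real n) -` {0..1} = {real n..real n + 1}"
      by auto
    then show "rel_curve R C {real n..real n + 1} (\<lambda>t. c n (t - real n))"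
      using rel_curve_shift[OF c(1)[of n], of "- real n"] by simp
    fix t assume t: "t \<in> {real n..real n + 1}"
    show "c n (t - real n) = g t"
    proof (cases "t = real n + 1")
      case True
      then have "g t = P (Suc n)"
        using g_nat[of "Suc n"] by (simp add: add.commute)
      then show ?thesis
        using True c(3) by simp
    next
      case False
      then have "\<lfloor>t\<rfloor> = int n"
        using t by (intro floor_unique) auto
      then show ?thesis
        by (simp add: g_def)
    qed
  qed
  have initial: "rel_curve R C {0..real n} g" for n
  proof (induction n)
    case 0
    have "{0..real 0} = {0}" "{0::real} \<subseteq> {real 0..real 0 + 1}"
      by auto
    then show ?case
      using rel_curve_subinterval[OF step[of 0], of "{0}"] by (simp add: is_interval_1)
  next
    case (Suc n)
    have "{0..real n} \<union> {real n..real n + 1} = {0..real (Suc n)}"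
      by auto
    then show ?case
      using rel_curve_glue[OF R Suc step[of n], of "real n"] by auto
  qed
  have g: "rel_curve R C {0..} g"
    unfolding rel_curve_def
  proof (intro conjI ballI impI)
    show "C {0..} g"
      using initial exhaust unfolding rel_curve_def by blast
    fix t u :: real assume tu: "t \<in> {0..}" "u \<in> {0..}" "t < u"
    obtain n where "u \<le> real n"
      using real_arch_simple by blast
    then show "R (g t) (g u)"
      using initial[of n] tu unfolding rel_curve_def by auto
  qed
  have "\<nexists>q. q \<in> X \<and> (\<forall>t\<in>{0..}. g t \<sqsubset> q)"
  proof
    assume "\<exists>q. q \<in> X \<and> (\<forall>t\<in>{0..}. g t \<sqsubset> q)"
    \<comment> \<open>The upper bound alone is too weak: time is measured along
      \<open>R\<close>-curves, and nothing joins the points \<open>P n\<close> to the bound. The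
      extension gives a limit point \<open>q\<close> that is reached from every
      \<open>P n\<close>.\<close>
    then have "future_extendible l C {0..} g"
      using future_extendible_iff[OF rel_curve_strict[OF R g]] by blast
    then obtain I' \<phi> \<psi> K g' t where h: "is_interval I'" "homeomorphism {0..} I' \<phi> \<psi>"
      "strict_mono_on {0..} \<phi>" "is_interval K" "I' \<subseteq> K" "t \<in> K" "\<forall>s\<in>I'. s < t"
      "causal_curve l C K g'" "\<forall>s\<in>I'. g' s = g (\<psi> s)"
      unfolding future_extendible_def by blast
    have K: "rel_curve (\<sqsubset>) C K g'"
      using h(8) causal_curve_iff by blast
    have \<psi>: "\<psi> u \<ge> 0" "\<phi> (\<psi> u) = u" if "u \<in> I'" for u
      using h(2) that unfolding homeomorphism_def by auto
    have \<phi>: "\<phi> u \<in> I'" "\<psi> (\<phi> u) = u" if "u \<ge> 0" for u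
      using h(2) that unfolding homeomorphism_def by auto
    have \<psi>_less: "\<psi> u < \<psi> v" if "u \<in> I'" "v \<in> I'" "u < v" for u v
    proof (rule ccontr)
      assume "\<not> \<psi> u < \<psi> v"
      then have "\<phi> (\<psi> v) \<le> \<phi> (\<psi> u)"
        using strict_mono_on_leD[OF h(3), of "\<psi> v" "\<psi> u"] \<psi>(1) that by auto
      then show False
        using \<psi>(2) that by auto
    qed
    have no_max: "\<exists>v\<in>I'. u < v" if "u \<in> I'" for u
    proof -
      have "\<phi> (\<psi> u) < \<phi> (\<psi> u + 1)"
        using strict_mono_onD[OF h(3), of "\<psi> u" "\<psi> u + 1"] \<psi>(1)[OF that] by auto
      then show ?thesis
        using \<psi>[OF that] \<phi>(1)[of "\<psi> u + 1"] by auto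
    qed
    define w where "w = Sup I'"
    have bddI: "bdd_above I'"
      using h(7) by (intro bdd_aboveI[of _ t]) auto
    have ne: "I' \<noteq> {}"
      using \<phi>(1)[of 0] by auto
    have below: "u < w" if u: "u \<in> I'" for u
      using no_max[OF u] cSup_upper[OF _ bddI] unfolding w_def by fastforce
    have in_I': "u \<in> I'" if "v \<in> I'" "v \<le> u" "u < w" for u v
    proof -
      obtain v' where "v' \<in> I'" "u < v'"
        using \<open>u < w\<close> less_cSup_iff[OF ne bddI] unfolding w_def by blast
      then show ?thesis
        using h(1) that unfolding is_interval_1 by (meson less_imp_le)
    qed
    have "w \<le> t"
      unfolding w_def using h(7) ne by (intro cSup_least) (auto intro: less_imp_le)
    moreover have "\<phi> 0 \<in> K" "\<phi> 0 \<le> w"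
      using \<phi>(1)[of 0] h(5) below[of "\<phi> 0"] by auto
    ultimately have wK: "w \<in> K"
      using h(4,6) unfolding is_interval_1 by blast
    define q where "q = g' w"
    have K_in: "g' u \<in> X" if "u \<in> K" for u
      using that K curve_in unfolding rel_curve_def by blast
    have q_reach: "q \<in> reach R (P n)" for n
    proof -
      have n: "\<phi> (real n) \<in> I'"
        using \<phi>(1) by simp
      have sub: "{\<phi> (real n)..w} \<subseteq> K"
        using n wK h(4,5) unfolding is_interval_1 by (meson atLeastAtMost_iff subset_iff)
      have inner: "R (g' u) (g' v)" if "u \<in> I'" "v \<in> I'" "u < v" for u v
        using g \<psi>_less[OF that] \<psi>(1) that h(9) unfolding rel_curve_def by auto
      have "rel_curve R C {\<phi> (real n)..w} g'"
        unfolding rel_curve_def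
      proof (intro conjI ballI impI)
        show "C {\<phi> (real n)..w} g'"
          using K sub subinterval is_interval_cc below[OF n] unfolding rel_curve_def
          by (metis atLeastatMost_empty_iff less_imp_le)
        fix u v assume uv: "u \<in> {\<phi> (real n)..w}" "v \<in> {\<phi> (real n)..w}" "u < v"
        then have u: "u \<in> I'"
          using in_I'[OF n] by auto
        show "R (g' u) (g' v)"
        proof (cases "v < w")
          case True
          then show ?thesis
            using inner u in_I'[OF n] uv by auto
        next
          case False
          \<comment> \<open>The extension is merely causal, so for \<open>R\<close> the end point
            \<open>w\<close> is approached through a parameter \<open>m\<close> of the original
            curve: \<open>R\<close> up to \<open>m\<close>, the causal order from there on.\<close>
          obtain m where m: "m \<in> I'" "u < m"
            using no_max[OF u] by blast
          have "m < v"
            using False below[OF m(1)] uv by auto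
          moreover have inK: "u \<in> K" "m \<in> K" "v \<in> K"
            using u m(1) h(5) sub uv(2) by blast+
          ultimately have "g' m \<sqsubseteq> g' v"
            using strict_curve_le[OF K, of m v] by simp
          then show ?thesis
            using curve_order_trans1[OF R inner[OF u m]] K_in inK by blast
        qed
      qed
      then have "g' w \<in> reach R (g' (\<phi> (real n)))"
        using below[OF n] by (intro curve_reach) auto
      moreover have "g' (\<phi> (real n)) = P n"
        using h(9) n \<phi>(2)[of "real n"] g_nat by simp
      ultimately show ?thesis
        by (simp add: q_def)
    qed
    have qx: "q \<in> reach R x"
      using q_reach[of 0] P0 by simp
    define r where "r = nxt q"
    have r: "r \<in> reach R q" "r \<noteq> q"
      using nxt[OF qx] by (simp_all add: r_def)
    have "\<tau> q < \<tau> r"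
      using \<tau>(3) reach_le[OF R r(1)] r reach_in[OF qx] reach_in[OF r(1)] by (auto simp: strict_le_def)
    have gap: "s (P n) - \<tau> (P n) \<le> (s x - \<tau> x) / 2 ^ n" for n
    proof (induction n)
      case (Suc n)
      have "s (P (Suc n)) \<le> s (P n)"
        unfolding s_def
      proof (rule cSup_subset_mono[OF _ bdd])
        show "\<tau> ` reach R (P (Suc n)) \<noteq> {}"
          using reach_refl[OF reach_in[OF P_reach[of "Suc n"]]] by blast
        show "\<tau> ` reach R (P (Suc n)) \<subseteq> \<tau> ` reach R (P n)"
          using nxt[OF P_reach[of n]] reach_trans[OF R] unfolding PSuc by blast
      qed
      moreover have "(\<tau> (P n) + s (P n)) / 2 < \<tau> (P (Suc n))"
        using nxt[OF P_reach[of n]] PSuc by simp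
      ultimately have "s (P (Suc n)) - \<tau> (P (Suc n)) \<le> (s (P n) - \<tau> (P n)) / 2"
        by (simp add: field_simps)
      also have "\<dots> \<le> (s x - \<tau> x) / 2 ^ n / 2"
        using Suc by (intro divide_right_mono) auto
      finally show ?case
        by (simp add: mult.commute)
    qed (simp add: P0)
    have "\<tau> r - \<tau> q \<le> (s x - \<tau> x) / 2 ^ n" for n
    proof -
      have "\<tau> r \<le> s (P n)"
        using s_upper reach_trans[OF R q_reach r(1)] by blast
      moreover have "\<tau> (P n) \<le> \<tau> q"
        using \<tau>(2) reach_le[OF R q_reach] reach_in P_reach q_reach by blast
      ultimately show ?thesis
        using gap[of n] by linarith
    qed
    moreover have "(\<lambda>n. (s x - \<tau> x) / 2 ^ n) \<longlonglongrightarrow> 0"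
      using LIMSEQ_divide_realpow_zero[of 2] by simp
    ultimately have "\<tau> r - \<tau> q \<le> 0"
      by (intro LIMSEQ_le_const) auto
    then show False
      using \<open>\<tau> q < \<tau> r\<close> by simp
  qed
  then show ?thesis
    using that[of "{0..}" g] g g_nat[of 0] P0 by auto
qed

lemma past_ray:
  assumes R: "curve_order R" and x: "x \<in> X"
  obtains I g where "0 \<in> I" "I \<subseteq> {..0}" "rel_curve R C I g" "g 0 = x"
    "\<nexists>q. q \<in> X \<and> (\<forall>t\<in>I. q \<sqsubset> g t)"
proof -
  interpret rev: spacetime T C "time_reversal l"
    by (rule rev)
  have "rev.curve_order (\<lambda>x y. R y x)"
    using R unfolding curve_order_def rev.curve_order_def chron_rev strict_le_rev by auto
  then obtain I g where g: "0 \<in> I" "I \<subseteq> {0..}" "rel_curve (\<lambda>x y. R y x) C I g" "g 0 = x"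
    "\<nexists>q. q \<in> X \<and> (\<forall>t\<in>I. q \<sqsubset> g t)"
    using rev.future_ray[OF _ x] unfolding strict_le_rev by metis
  have "\<nexists>q. q \<in> X \<and> (\<forall>t\<in>uminus -` I. q \<sqsubset> g (- t))"
    using g(5) by (metis minus_minus vimage_eq)
  moreover have "uminus -` I \<subseteq> {..0}"
    using g(2) by fastforce
  ultimately show ?thesis
    using that[of "uminus -` I" "\<lambda>t. g (- t)"] g(1,4) rel_curve_reverse[OF g(3)] by simp
qed

text \<open>A strict bound of the whole curve would bound one of its two outer pieces. The domain
  and the curve are given by explicit formulas because for weak Cauchy sets the completeness of the
  result is later checked piece by piece.\<close>

lemma full_curve:
  assumes R: "curve_order R"
    and past: "rel_curve R C I1 g1" "0 \<in> I1" "I1 \<subseteq> {..0}" "\<nexists>q. q \<in> X \<and> (\<forall>t\<in>I1. q \<sqsubset> g1 t)"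
    and mid: "rel_curve R C {0..b} g" "0 \<le> b" "g1 0 = g 0" "g2 0 = g b"
    and future: "rel_curve R C I2 g2" "0 \<in> I2" "I2 \<subseteq> {0..}" "\<nexists>q. q \<in> X \<and> (\<forall>t\<in>I2. g2 t \<sqsubset> q)"
    and I: "I = I1 \<union> ({0..b} \<union> (\<lambda>t. t - b) -` I2)"
    and \<delta>: "\<delta> = (\<lambda>t. if t \<le> 0 then g1 t else if t \<le> b then g t else g2 (t - b))"
  shows "rel_curve R C I \<delta>" "inextendible l C I \<delta>"
    "\<And>t. t \<in> I1 \<Longrightarrow> \<delta> t = g1 t" "\<And>t. t \<in> {0..b} \<Longrightarrow> \<delta> t = g t" "\<And>t. t \<in> I2 \<Longrightarrow> \<delta> (t + b) = g2 t"
proof -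
  let ?K = "{0..b} \<union> (\<lambda>t. t - b) -` I2" and ?\<kappa> = "\<lambda>t. if t \<le> b then g t else g2 (t - b)"
  have K: "rel_curve R C ?K ?\<kappa>"
    using mid future(2,3) by (intro rel_curve_join[OF R mid(1) future(1)]) auto
  have "?K \<subseteq> {0..}"
    using future(3) mid(2) by force
  then have "rel_curve R C (I1 \<union> (\<lambda>t. t - 0) -` ?K) (\<lambda>t. if t \<le> 0 then g1 t else ?\<kappa> (t - 0))"
    using past mid(2,3) by (intro rel_curve_join[OF R past(1) K]) auto
  moreover have "(\<lambda>t. t - 0) -` ?K = ?K"
    by auto
  ultimately show curve: "rel_curve R C I \<delta>"
    unfolding I \<delta> by (simp cong: if_cong)
  show eq1: "\<delta> t = g1 t" if "t \<in> I1" for t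
    using that past(3) by (auto simp: \<delta>)
  show eq: "\<delta> t = g t" if "t \<in> {0..b}" for t
    using that mid(3) by (cases "t = 0") (auto simp: \<delta>)
  show eq2: "\<delta> (t + b) = g2 t" if "t \<in> I2" for t
  proof (cases "t = 0")
    case True
    then show ?thesis
      using eq[of b] mid(2,4) by simp
  next
    case False
    then have "0 < t"
      using that future(3) by auto
    then show ?thesis
      using mid(2) by (simp add: \<delta>)
  qed
  show "inextendible l C I \<delta>"
    unfolding inextendible_iff[OF rel_curve_strict[OF R curve]]
  proof
    have "t + b \<in> I" if "t \<in> I2" for t
      using that by (simp add: I)
    then show "\<nexists>q. q \<in> X \<and> (\<forall>t\<in>I. \<delta> t \<sqsubset> q)"
      using future(4) eq2 by metis
    have "t \<in> I" if "t \<in> I1" for t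
      using that by (simp add: I)
    then show "\<nexists>q. q \<in> X \<and> (\<forall>t\<in>I. q \<sqsubset> \<delta> t)"
      using past(4) eq1 by metis
  qed
qed

lemma inextendible_extension:
  assumes R: "curve_order R" and g: "rel_curve R C {0..b} g" "0 \<le> b"
  obtains I \<delta> where "rel_curve R C I \<delta>" "inextendible l C I \<delta>" "{0..b} \<subseteq> I"
    "\<And>t. t \<in> {0..b} \<Longrightarrow> \<delta> t = g t"
proof -
  have "g 0 \<in> X" "g b \<in> X"
    using g curve_in unfolding rel_curve_def by auto
  obtain I1 g1 where 1: "0 \<in> I1" "I1 \<subseteq> {..0}" "rel_curve R C I1 g1" "g1 0 = g 0"
    "\<nexists>q. q \<in> X \<and> (\<forall>t\<in>I1. q \<sqsubset> g1 t)"
    using past_ray[OF R \<open>g 0 \<in> X\<close>] by metis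
  obtain I2 g2 where 2: "0 \<in> I2" "I2 \<subseteq> {0..}" "rel_curve R C I2 g2" "g2 0 = g b"
    "\<nexists>q. q \<in> X \<and> (\<forall>t\<in>I2. g2 t \<sqsubset> q)"
    using future_ray[OF R \<open>g b \<in> X\<close>] by metis
  note full = full_curve[OF R 1(3,1,2,5) g 1(4) 2(4) 2(3,1,2,5) refl refl]
  show ?thesis
    by (rule that[OF full(1,2)]) (use full(4) in auto)
qed

lemma inextendible_timelike_curve_through:
  assumes x: "x \<in> X"
  obtains I g where "timelike_curve l C I g" "inextendible l C I g" "0 \<in> I" "g 0 = x"
proof -
  have R: "curve_order (\<lless>)"
    by (simp add: curve_order_def)
  have "rel_curve (\<lless>) C {0..0} (\<lambda>_. x)"
    using rel_curve_point[OF x, of _ 0] by simp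
  then show ?thesis
    using inextendible_extension[OF R] that unfolding timelike_curve_rel_curve
    by (metis atLeastAtMost_singleton insert_subset order_refl singletonI)
qed

section \<open>Separating sets\<close>

text \<open>Equivalently, \<open>B\<close> and its chronological past and future partition
  \<open>X\<close>. This is the common consequence of the three Cauchy properties from which the
  metric axioms are derived.\<close>

definition separating :: "'a set \<Rightarrow> bool" where
  "separating B \<longleftrightarrow> B \<subseteq> X \<and> (\<forall>x\<in>X. \<exists>y\<in>B. x = y \<or> x \<lless> y \<or> y \<lless> x) \<and> (\<forall>x\<in>B. \<forall>y\<in>B. \<not> x \<lless> y)"

text \<open>If \<open>x \<lless> y\<close> were both in \<open>B\<close>, the function in
  \<open>once\<close> would meet \<open>B\<close> at two parameters. Its kind is left open, so that
  causal curves can serve strong Cauchy sets and timelike curves the other two.\<close>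

lemma separatingI:
  assumes "B \<subseteq> X"
    and meet: "\<And>x. x \<in> X \<Longrightarrow> \<exists>I g. rel_curve (\<lless>) C I g \<and> x \<in> g ` I \<and> (\<exists>t\<in>I. g t \<in> B)"
    and once: "\<And>x y. x \<in> X \<Longrightarrow> y \<in> X \<Longrightarrow> x \<lless> y \<Longrightarrow>
      \<exists>(I::real set) g s t. s \<in> I \<and> t \<in> I \<and> s \<noteq> t \<and> g s = x \<and> g t = y \<and> (\<exists>!t. t \<in> I \<and> g t \<in> B)"
  shows "separating B"
  unfolding separating_def
proof (intro conjI ballI)
  fix x assume "x \<in> X"
  then obtain I g s t where h: "rel_curve (\<lless>) C I g" "s \<in> I" "g s = x" "t \<in> I" "g t \<in> B"
    using meet by blast
  then have "g s = g t \<or> g s \<lless> g t \<or> g t \<lless> g s"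
    unfolding rel_curve_def by (metis linorder_neqE_linordered_idom)
  then show "\<exists>y\<in>B. x = y \<or> x \<lless> y \<or> y \<lless> x"
    using h by blast
next
  fix x y assume "x \<in> B" "y \<in> B"
  then show "\<not> x \<lless> y"
    using once[of x y] assms(1) by blast
qed (fact assms(1))

section \<open>The distance \<open>d_J\<close> on separating sets\<close>

lemma d_J_upper: "x \<in> A \<Longrightarrow> y \<in> B \<Longrightarrow> tdist l x y + tdist l y x \<le> d_J l A B"
  unfolding d_J_def by (rule SUP_upper2[of "(x, y)"]) auto

lemma d_J_upper1: "x \<in> A \<Longrightarrow> y \<in> B \<Longrightarrow> tdist l x y \<le> d_J l A B"
  by (rule order_trans[OF _ d_J_upper[of x A y B]]) simp_all

lemma d_J_commute: "d_J l A B = d_J l B A"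
proof -
  have "d_J l A B \<le> d_J l B A" for A B
    unfolding d_J_def[of l A B]
  proof (intro SUP_least, clarify)
    fix x y assume "x \<in> A" "y \<in> B"
    then show "tdist l x y + tdist l y x \<le> d_J l B A"
      using d_J_upper[of y B x A] by (simp add: add.commute)
  qed
  then show ?thesis
    by (intro antisym)
qed

text \<open>Length is an infimum over partitions, so the single division point \<open>t\<close>
  bounds it from above. For an almost maximal curve this is a triangle inequality in the usual
  direction, opposite to \<open>tdist_triangle\<close>.\<close>

lemma lor_length_split:
  assumes "a < t" "t < b"
  shows "lor_length l a b g \<le> tdist l (g a) (g t) + tdist l (g t) (g b)"
proof -
  define u where "u = (\<lambda>i::nat. if i = 0 then a else if i = 1 then t else b)"
  have "(2, u) \<in> partitions a b"
    using assms by (auto simp: partitions_def u_def less_2_cases_iff)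
  then have "lor_length l a b g \<le> (\<Sum>i<2. tdist l (g (u i)) (g (u (Suc i))))"
    unfolding lor_length_def by (rule INF_lower2) simp
  then show ?thesis
    by (simp add: u_def numeral_2_eq_2)
qed

text \<open>By connectedness of \<open>{a..b}\<close>: a curve that avoided \<open>B\<close> would
  split its parameter interval into the disjoint open preimages of the chronological past and future
  of \<open>B\<close>, and each contains an end point.\<close>

lemma separating_crossing:
  assumes B: "separating B" and g: "C {a..b} g" "a \<le> b"
    and ends: "y1 \<in> B" "g a \<lless> y1" "y2 \<in> B" "y2 \<lless> g b"
  obtains t where "t \<in> {a..b}" "g t \<in> B"
proof (rule ccontr)
  assume none: "\<not> thesis"
  have BX: "B \<subseteq> X"
    using B by (simp add: separating_def)
  define U where "U = (\<Union>y\<in>B. I_minus X l y)"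
  define V where "V = (\<Union>y\<in>B. I_plus X l y)"
  have "openin T U" "openin T V"
    unfolding U_def V_def using BX open_I_minus open_I_plus by auto
  then have "openin (top_of_set {a..b}) {t \<in> {a..b}. g t \<in> U}"
    "openin (top_of_set {a..b}) {t \<in> {a..b}. g t \<in> V}"
    using is_curve[OF g(1)] unfolding curve_def continuous_map_def by simp_all
  moreover have "{a..b} \<subseteq> {t \<in> {a..b}. g t \<in> U} \<union> {t \<in> {a..b}. g t \<in> V}"
  proof
    fix t assume t: "t \<in> {a..b}"
    have "g t \<in> X" "g t \<notin> B"
      using curve_in[OF g(1)] none that t by auto
    then show "t \<in> {t \<in> {a..b}. g t \<in> U} \<union> {t \<in> {a..b}. g t \<in> V}"
      using B t unfolding separating_def U_def V_def I_minus_def I_plus_def by blast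
  qed
  moreover have "U \<inter> V = {}"
  proof -
    have False if x: "x \<in> U" "x \<in> V" for x
    proof -
      obtain y z where "y \<in> B" "z \<in> B" "x \<in> X" "x \<lless> y" "z \<lless> x"
        using x by (auto simp: U_def V_def I_minus_def I_plus_def)
      then show False
        using B BX chron_trans[of z x y] unfolding separating_def by blast
    qed
    then show ?thesis
      by blast
  qed
  then have "{t \<in> {a..b}. g t \<in> U} \<inter> {t \<in> {a..b}. g t \<in> V} = {}"
    by blast
  moreover have "a \<in> {t \<in> {a..b}. g t \<in> U}" "b \<in> {t \<in> {a..b}. g t \<in> V}"
    using ends g(2) curve_in[OF g(1)] by (auto simp: U_def V_def I_minus_def I_plus_def)
  ultimately show False
    using connected_Icc[of a b] unfolding connected_openin by blast
qed

end

locale length_spacetime = spacetime +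
  assumes length_sup: "chron l x y \<Longrightarrow> x \<in> topspace T \<Longrightarrow> y \<in> topspace T \<Longrightarrow> r < tdist l x y \<Longrightarrow>
    \<exists>a b g. joins g a b x y \<and> causal_curve l C {a..b} g \<and> r < lor_length l a b g"
begin

text \<open>If \<open>x\<close> lies in \<open>B\<close> or after it, going back to a point of
  \<open>B\<close> only increases the distance to \<open>z\<close>, and \<open>d_J l B E\<close>
  alone is a bound; dually if \<open>z\<close> lies in \<open>B\<close> or before it. Otherwise
  \<open>x\<close> is before \<open>B\<close> and \<open>z\<close> after it, and a curve from
  \<open>x\<close> to \<open>z\<close> has to cross \<open>B\<close>.\<close>

lemma separating_triangle:
  assumes "separating A" "separating B" "separating E"
    and x: "x \<in> A" and z: "z \<in> E" and xz: "x \<lless> z"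
  shows "tdist l x z \<le> d_J l A B + d_J l B E"
proof -
  have X: "x \<in> X" "z \<in> X" "B \<subseteq> X"
    using assms by (auto simp: separating_def)
  consider y where "y \<in> B" "y \<sqsubseteq> x" | y where "y \<in> B" "z \<sqsubseteq> y"
    | y1 y2 where "y1 \<in> B" "x \<lless> y1" "y2 \<in> B" "y2 \<lless> z" "x \<notin> B" "z \<notin> B"
    using assms(2) X(1,2) chron_imp_causal_le le_refl unfolding separating_def by metis
  then show ?thesis
  proof cases
    case 1
    then have "tdist l x z \<le> tdist l y x + tdist l x z"
      by simp
    also have "\<dots> \<le> tdist l y z"
      using 1 X chron_imp_causal_le[OF xz] by (intro tdist_triangle_le) auto
    also have "\<dots> \<le> d_J l A B + d_J l B E"
      using d_J_upper1[OF 1(1) z] by (intro add_increasing) auto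
    finally show ?thesis .
  next
    case 2
    then have "tdist l x z \<le> tdist l x z + tdist l z y"
      by simp
    also have "\<dots> \<le> tdist l x y"
      using 2 X chron_imp_causal_le[OF xz] by (intro tdist_triangle_le) auto
    also have "\<dots> \<le> d_J l A B + d_J l B E"
      using d_J_upper1[OF x 2(1)] by (intro add_increasing2) auto
    finally show ?thesis .
  next
    case 3
    show ?thesis
    \<comment> \<open>The supremum of lengths need not be attained, so each \<open>r\<close> below
      \<open>tdist l x z\<close> gets its own curve.\<close>
    proof (rule dense_le)
      fix r assume "r < tdist l x z"
      then obtain a b g where g: "joins g a b x z" "causal_curve l C {a..b} g" "r < lor_length l a b g"
        using length_sup[OF xz X(1,2)] by blast
      then have ab: "a \<le> b" "g a = x" "g b = z" and C: "C {a..b} g"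
        by (auto simp: joins_def causal_curve_def)
      obtain t where t: "t \<in> {a..b}" "g t \<in> B"
        using separating_crossing[OF assms(2) C ab(1) 3(1) _ 3(3)] 3(2,4) ab by metis
      then have "t \<noteq> a" "t \<noteq> b"
        using 3(5,6) ab by auto
      then have "lor_length l a b g \<le> tdist l x (g t) + tdist l (g t) z"
        using lor_length_split[of a t b g] t(1) ab(2,3) by simp
      also have "\<dots> \<le> d_J l A B + d_J l B E"
        using d_J_upper1[OF x t(2)] d_J_upper1[OF t(2) z] by (rule add_mono)
      finally show "r \<le> d_J l A B + d_J l B E"
        using g(3) by simp
    qed
  qed
qed

text \<open>Two points cannot be chronologically related both ways, so at most one summand of
  \<open>tdist l x z + tdist l z x\<close> is nonzero and \<open>separating_triangle\<close>
  applies, in reversed order if it is the second. If \<open>d_J\<close> vanishes, the point of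
  \<open>B\<close> related to a given point of \<open>A\<close> can only be that point
  itself.\<close>

lemma separating_extended_metric:
  assumes M: "\<And>A. A \<in> M \<Longrightarrow> separating A"
  shows "extended_metric_on M (d_J l)"
  unfolding extended_metric_on_def
proof (intro conjI ballI)
  have subset: "A \<subseteq> B" if sep: "separating A" "separating B" and zero: "d_J l A B = 0" for A B
  proof
    fix x assume x: "x \<in> A"
    then obtain y where y: "y \<in> B" "x = y \<or> x \<lless> y \<or> y \<lless> x"
      using sep unfolding separating_def by blast
    have "tdist l x y = 0" "tdist l y x = 0"
      using d_J_upper[OF x y(1)] zero by auto
    then show "x \<in> B"
      using y unfolding chron_def by auto
  qed
  fix A B assume AB: "A \<in> M" "B \<in> M"
  show "d_J l A B = 0 \<longleftrightarrow> A = B"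
  proof
    assume "d_J l A B = 0"
    then show "A = B"
      using subset[of A B] subset[of B A] M AB d_J_commute[of A B] by (intro equalityI) simp_all
  next
    assume "A = B"
    then have "tdist l x y = 0" if "x \<in> A" "y \<in> B" for x y
      using that M[OF AB(1)] tdist_eq_0[of l x y] unfolding separating_def by blast
    then show "d_J l A B = 0"
      unfolding d_J_def using \<open>A = B\<close> by (intro antisym SUP_least) auto
  qed
  show "d_J l A B = d_J l B A"
    by (rule d_J_commute)
  fix E assume E: "E \<in> M"
  note sep = M[OF AB(1)] M[OF AB(2)] M[OF E]
  have "tdist l x z + tdist l z x \<le> d_J l A B + d_J l B E" if xz: "x \<in> A" "z \<in> E" for x z
  proof -
    have X: "x \<in> X" "z \<in> X"
      using xz sep by (auto simp: separating_def)
    consider "x \<lless> z" "\<not> z \<lless> x" | "z \<lless> x" "\<not> x \<lless> z" | "\<not> x \<lless> z" "\<not> z \<lless> x"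
      using chron_trans[of x z x] chron_irrefl X by blast
    then show ?thesis
    proof cases
      case 1
      then show ?thesis
        using separating_triangle[OF sep xz] tdist_eq_0[of l z x] by simp
    next
      case 2
      then show ?thesis
        using separating_triangle[OF sep(3,2,1) xz(2,1)] tdist_eq_0[of l x z]
          d_J_commute[of A B] d_J_commute[of B E] by (simp add: add.commute)
    qed (simp add: tdist_eq_0)
  qed
  then show "d_J l A E \<le> d_J l A B + d_J l B E"
    unfolding d_J_def[of l A E] by (intro SUP_least) auto
qed

end

section \<open>Cauchy sets as separating sets\<close>

context spacetime
begin

lemma inextendible_chron_separating:
  assumes "B \<subseteq> X"
    and meet: "\<And>I g. timelike_curve l C I g \<Longrightarrow> inextendible l C I g \<Longrightarrow> \<exists>t\<in>I. g t \<in> B"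
    and once: "\<And>x y. x \<in> X \<Longrightarrow> y \<in> X \<Longrightarrow> x \<lless> y \<Longrightarrow>
      \<exists>(I::real set) g s t. s \<in> I \<and> t \<in> I \<and> s \<noteq> t \<and> g s = x \<and> g t = y \<and> (\<exists>!t. t \<in> I \<and> g t \<in> B)"
  shows "separating B"
proof (rule separatingI[OF assms(1) _ once])
  fix x assume "x \<in> X"
  then obtain I g where g: "timelike_curve l C I g" "inextendible l C I g" "0 \<in> I" "g 0 = x"
    by (rule inextendible_timelike_curve_through)
  then show "\<exists>I g. rel_curve (\<lless>) C I g \<and> x \<in> g ` I \<and> (\<exists>t\<in>I. g t \<in> B)"
    using meet[OF g(1,2)] unfolding timelike_curve_rel_curve by blast
qed

lemma curve_extension_meets_twice:
  assumes R: "curve_order R" and g: "rel_curve R C {a..b} g" "joins g a b x y" "x \<noteq> y"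
  obtains I \<delta> s t where "rel_curve R C I \<delta>" "inextendible l C I \<delta>"
    "s \<in> I" "t \<in> I" "s \<noteq> t" "\<delta> s = x" "\<delta> t = y"
proof -
  have ab: "a < b" "g a = x" "g b = y"
    using g(2,3) by (auto simp: joins_def le_less)
  obtain I \<delta> where I: "rel_curve R C I \<delta>" "inextendible l C I \<delta>" "{0..1} \<subseteq> I"
    "\<And>t. t \<in> {0..1} \<Longrightarrow> \<delta> t = g ((b - a) * t + a)"
    using inextendible_extension[OF R rel_curve_unit_interval[OF g(1) ab(1)]] by auto
  show ?thesis
    using that[OF I(1,2), of 0 1] I(3) I(4)[of 0] I(4)[of 1] ab by (auto simp: subset_iff)
qed

text \<open>Timelike path-connectedness joins chronologically related points by a timelike curve; an
  inextendible timelike extension of it cannot meet \<open>B\<close> at both.\<close>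

lemma cauchy_set_separating:
  assumes "timelike_path_connected X l C" and B: "B \<in> cauchy_sets X l C"
  shows "separating B"
proof (rule inextendible_chron_separating)
  show "B \<subseteq> X"
    using B by (simp add: cauchy_sets_def)
  have meet: "\<exists>!t. t \<in> I \<and> g t \<in> B" if "timelike_curve l C I g" "inextendible l C I g" for I g
    using B that by (simp add: cauchy_sets_def)
  then show "\<exists>t\<in>I. g t \<in> B" if "timelike_curve l C I g" "inextendible l C I g" for I g
    using that by blast
  fix x y assume xy: "x \<in> X" "y \<in> X" "x \<lless> y"
  obtain a b g where g: "joins g a b x y" "timelike_curve l C {a..b} g"
    using assms(1)[unfolded timelike_path_connected_def, rule_format, OF xy] by blast
  have R: "curve_order (\<lless>)" and ne: "x \<noteq> y"
    using xy chron_irrefl by (auto simp: curve_order_def)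
  obtain I \<delta> s t where \<delta>: "rel_curve (\<lless>) C I \<delta>" "inextendible l C I \<delta>"
    "s \<in> I" "t \<in> I" "s \<noteq> t" "\<delta> s = x" "\<delta> t = y"
    by (rule curve_extension_meets_twice[OF R g(2)[unfolded timelike_curve_rel_curve] g(1) ne])
  then have "\<exists>!t. t \<in> I \<and> \<delta> t \<in> B"
    using meet[unfolded timelike_curve_rel_curve] by blast
  then show "\<exists>(I::real set) g s t. s \<in> I \<and> t \<in> I \<and> s \<noteq> t \<and> g s = x \<and> g t = y \<and> (\<exists>!t. t \<in> I \<and> g t \<in> B)"
    using \<delta>(3-7) by blast
qed

section \<open>Gluing of Cauchy complete curves\<close>

lemma tdist_mono:
  assumes "x' \<sqsubseteq> x" "x \<sqsubseteq> y" "y \<sqsubseteq> y'" "x \<in> X" "y \<in> X" "x' \<in> X" "y' \<in> X"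
  shows "tdist l x y \<le> tdist l x' y'"
proof -
  have "tdist l x y \<le> tdist l x y + tdist l y y'"
    by simp
  also have "\<dots> \<le> tdist l x y'"
    using assms by (intro tdist_triangle_le)
  also have "\<dots> \<le> tdist l x' x + tdist l x y'"
    by simp
  also have "\<dots> \<le> tdist l x' y'"
    using assms le_trans by (intro tdist_triangle_le) blast+
  finally show ?thesis .
qed

text \<open>A strict upper bound of the part from \<open>s\<close> on bounds the whole curve,
  because the earlier points lie below \<open>g s\<close>. The completeness condition at the future
  end compares a parameter with later ones only, so it passes to this part. The shift by
  \<open>s\<close> moves its starting point to 0, as \<open>full_curve\<close> expects.\<close>

lemma cauchy_complete_future_half:
  assumes g: "cauchy_complete_curve l C I g" and s: "s \<in> I"
  defines "J \<equiv> (\<lambda>t. t + s) -` I \<inter> {0..}" and "g' \<equiv> \<lambda>t. g (t + s)"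
  shows "rel_curve (\<lless>) C J g'" "0 \<in> J" "\<nexists>q. q \<in> X \<and> (\<forall>t\<in>J. g' t \<sqsubset> q)"
    and "\<And>t0 B. t0 \<in> J \<Longrightarrow> (\<And>t. t \<in> J \<Longrightarrow> t0 \<le> t \<Longrightarrow> tdist l (g' t0) (g' t) \<le> ennreal B) \<Longrightarrow>
      \<exists>m\<in>J. \<forall>t\<in>J. t \<le> m"
proof -
  have tl: "rel_curve (\<lless>) C I g" and inext: "inextendible l C I g"
    using g by (simp_all add: cauchy_complete_curve_def timelike_curve_rel_curve)
  then have CI: "C I g"
    by (simp add: rel_curve_def)
  have strict: "rel_curve (\<sqsubset>) C I g"
    using rel_curve_strict[OF _ tl] by (simp add: curve_order_def)
  show J0: "0 \<in> J"
    using s by (simp add: J_def)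
  have shifted: "rel_curve (\<lless>) C ((\<lambda>t. t + s) -` I) g'"
    unfolding g'_def by (rule rel_curve_shift[OF tl])
  then have "is_interval ((\<lambda>t. t + s) -` I)"
    using curve_interval unfolding rel_curve_def by blast
  then have "is_interval J"
    unfolding J_def by (intro is_interval_Int) (auto simp: is_interval_ci)
  then show "rel_curve (\<lless>) C J g'"
    using rel_curve_subinterval[OF shifted, of J] J0 unfolding J_def by blast
  show "\<nexists>q. q \<in> X \<and> (\<forall>t\<in>J. g' t \<sqsubset> q)"
  proof
    assume "\<exists>q. q \<in> X \<and> (\<forall>t\<in>J. g' t \<sqsubset> q)"
    then obtain q where q: "q \<in> X" "\<And>t. t \<in> J \<Longrightarrow> g' t \<sqsubset> q"
      by blast
    have "g t \<sqsubset> q" if t: "t \<in> I" for t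
    proof (cases "s \<le> t")
      case True
      then show ?thesis
        using q(2)[of "t - s"] t by (simp add: J_def g'_def)
    next
      case False
      then have "g t \<sqsubseteq> g s" "g s \<sqsubset> q"
        using strict_curve_le[OF strict t s] q(2)[OF J0] by (simp_all add: g'_def)
      then show ?thesis
        using le_strict_trans curve_in[OF CI] t s q(1) by blast
    qed
    then show False
      using inext q(1) unfolding inextendible_iff[OF strict] by blast
  qed
  fix t0 B assume t0: "t0 \<in> J" and bound: "\<And>t. t \<in> J \<Longrightarrow> t0 \<le> t \<Longrightarrow> tdist l (g' t0) (g' t) \<le> ennreal B"
  have "tdist l (g (t0 + s)) (g t) \<le> ennreal B" if "t \<in> {t0 + s..} \<inter> I" for t
    using bound[of "t - s"] that t0 by (simp add: J_def g'_def)
  moreover have "t0 + s \<in> I"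
    using t0 by (simp add: J_def)
  ultimately obtain m where m: "m \<in> I" "\<forall>t\<in>I. t \<le> m"
    using g unfolding cauchy_complete_curve_def by blast
  have "m - s \<in> J"
    using m s by (simp add: J_def)
  moreover have "t \<le> m - s" if "t \<in> J" for t
    using m(2) that by (force simp: J_def)
  ultimately show "\<exists>m\<in>J. \<forall>t\<in>J. t \<le> m"
    by blast
qed

lemma cauchy_complete_past_half:
  assumes g: "cauchy_complete_curve l C I g" and s: "s \<in> I"
  defines "J \<equiv> (\<lambda>t. t + s) -` I \<inter> {..0}" and "g' \<equiv> \<lambda>t. g (t + s)"
  shows "rel_curve (\<lless>) C J g'" "0 \<in> J" "\<nexists>q. q \<in> X \<and> (\<forall>t\<in>J. q \<sqsubset> g' t)"
    and "\<And>t0 B. t0 \<in> J \<Longrightarrow> (\<And>t. t \<in> J \<Longrightarrow> t \<le> t0 \<Longrightarrow> tdist l (g' t) (g' t0) \<le> ennreal B) \<Longrightarrow>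
      \<exists>m\<in>J. \<forall>t\<in>J. m \<le> t"
proof -
  have tl: "rel_curve (\<lless>) C I g" and inext: "inextendible l C I g"
    using g by (simp_all add: cauchy_complete_curve_def timelike_curve_rel_curve)
  then have CI: "C I g"
    by (simp add: rel_curve_def)
  have strict: "rel_curve (\<sqsubset>) C I g"
    using rel_curve_strict[OF _ tl] by (simp add: curve_order_def)
  show J0: "0 \<in> J"
    using s by (simp add: J_def)
  have shifted: "rel_curve (\<lless>) C ((\<lambda>t. t + s) -` I) g'"
    unfolding g'_def by (rule rel_curve_shift[OF tl])
  then have "is_interval ((\<lambda>t. t + s) -` I)"
    using curve_interval unfolding rel_curve_def by blast
  then have "is_interval J"
    unfolding J_def by (intro is_interval_Int) (auto simp: is_interval_ic)
  then show "rel_curve (\<lless>) C J g'"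
    using rel_curve_subinterval[OF shifted, of J] J0 unfolding J_def by blast
  show "\<nexists>q. q \<in> X \<and> (\<forall>t\<in>J. q \<sqsubset> g' t)"
  proof
    assume "\<exists>q. q \<in> X \<and> (\<forall>t\<in>J. q \<sqsubset> g' t)"
    then obtain q where q: "q \<in> X" "\<And>t. t \<in> J \<Longrightarrow> q \<sqsubset> g' t"
      by blast
    have "q \<sqsubset> g t" if t: "t \<in> I" for t
    proof (cases "t \<le> s")
      case True
      then show ?thesis
        using q(2)[of "t - s"] t by (simp add: J_def g'_def)
    next
      case False
      then have "g s \<sqsubseteq> g t" "q \<sqsubset> g s"
        using strict_curve_le[OF strict s t] q(2)[OF J0] by (simp_all add: g'_def)
      then show ?thesis
        using strict_le_trans curve_in[OF CI] t s q(1) by blast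
    qed
    then show False
      using inext q(1) unfolding inextendible_iff[OF strict] by blast
  qed
  fix t0 B assume t0: "t0 \<in> J" and bound: "\<And>t. t \<in> J \<Longrightarrow> t \<le> t0 \<Longrightarrow> tdist l (g' t) (g' t0) \<le> ennreal B"
  have "tdist l (g t) (g (t0 + s)) \<le> ennreal B" if "t \<in> {..t0 + s} \<inter> I" for t
    using bound[of "t - s"] that t0 by (simp add: J_def g'_def)
  moreover have "t0 + s \<in> I"
    using t0 by (simp add: J_def)
  ultimately obtain m where m: "m \<in> I" "\<forall>t\<in>I. m \<le> t"
    using g unfolding cauchy_complete_curve_def by blast
  have "m - s \<in> J"
    using m s by (simp add: J_def)
  moreover have "m - s \<le> t" if "t \<in> J" for t
    using m(2) that by (force simp: J_def)
  ultimately show "\<exists>m\<in>J. \<forall>t\<in>J. m \<le> t"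
    by blast
qed

text \<open>An arbitrary inextendible extension of a timelike curve from \<open>x\<close> to
  \<open>y\<close> need not be Cauchy complete. The curve is therefore prolonged by the past half of
  a Cauchy complete curve through \<open>x\<close> and the future half of one through
  \<open>y\<close>; each completeness condition concerns one end only.\<close>

lemma weak_cauchy_set_separating:
  assumes "timelike_path_connected X l C"
    and through: "\<forall>x\<in>X. \<exists>I g. cauchy_complete_curve l C I g \<and> x \<in> g ` I"
    and B: "B \<in> weak_cauchy_sets X l C"
  shows "separating B"
proof (rule separatingI)
  show "B \<subseteq> X"
    using B by (simp add: weak_cauchy_sets_def)
  have meet: "\<exists>!t. t \<in> I \<and> g t \<in> B" if "cauchy_complete_curve l C I g" for I g
    using B that by (simp add: weak_cauchy_sets_def)
  show "\<exists>I g. rel_curve (\<lless>) C I g \<and> x \<in> g ` I \<and> (\<exists>t\<in>I. g t \<in> B)" if x: "x \<in> X" for x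
  proof -
    obtain I g where g: "cauchy_complete_curve l C I g" "x \<in> g ` I"
      using through x by blast
    then have "rel_curve (\<lless>) C I g"
      by (simp add: cauchy_complete_curve_def timelike_curve_rel_curve)
    with g show ?thesis
      using meet[OF g(1)] by blast
  qed
  fix x y assume xy: "x \<in> X" "y \<in> X" "x \<lless> y"
  obtain a b g where "joins g a b x y" "timelike_curve l C {a..b} g"
    using assms(1)[unfolded timelike_path_connected_def, rule_format, OF xy] by blast
  then have ab: "a < b" "g a = x" "g b = y" and g: "rel_curve (\<lless>) C {a..b} g"
    using chron_irrefl xy by (auto simp: joins_def le_less timelike_curve_rel_curve)
  define c where "c = (\<lambda>t. g ((b - a) * t + a))"
  have c: "rel_curve (\<lless>) C {0..1} c" "c 0 = x" "c 1 = y"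
    using rel_curve_unit_interval[OF g ab(1)] ab by (simp_all add: c_def)
  obtain I1 g1 s1 where 1: "cauchy_complete_curve l C I1 g1" "s1 \<in> I1" "g1 s1 = x"
    using through[rule_format, OF xy(1)] by (auto simp: image_iff)
  obtain I2 g2 s2 where 2: "cauchy_complete_curve l C I2 g2" "s2 \<in> I2" "g2 s2 = y"
    using through[rule_format, OF xy(2)] by (auto simp: image_iff)
  define J1 where "J1 = (\<lambda>t. t + s1) -` I1 \<inter> {..0}"
  define g1' where "g1' = (\<lambda>t. g1 (t + s1))"
  define J2 where "J2 = (\<lambda>t. t + s2) -` I2 \<inter> {0..}"
  define g2' where "g2' = (\<lambda>t. g2 (t + s2))"
  have shift: "g1 (t + s1) = g1' t" "g2 (t + s2) = g2' t" for t
    by (simp_all add: g1'_def g2'_def)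
  note past = cauchy_complete_past_half[OF 1(1,2), folded J1_def, unfolded shift]
  note future = cauchy_complete_future_half[OF 2(1,2), folded J2_def, unfolded shift]
  have R: "curve_order (\<lless>)"
    by (simp add: curve_order_def)
  define I where "I = J1 \<union> ({0..1} \<union> (\<lambda>t. t - 1) -` J2)"
  define \<delta> where "\<delta> = (\<lambda>t. if t \<le> 0 then g1' t else if t \<le> 1 then c t else g2' (t - 1))"
  have J: "J1 \<subseteq> {..0}" "J2 \<subseteq> {0..}"
    by (auto simp: J1_def J2_def)
  have join: "g1' 0 = c 0" "g2' 0 = c 1"
    using 1(3) 2(3) c by (simp_all add: g1'_def g2'_def)
  note full = full_curve[OF R past(1,2) J(1) past(3) c(1) zero_le_one join future(1,2) J(2) future(3) I_def \<delta>_def]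
  have strict: "rel_curve (\<sqsubset>) C I \<delta>"
    by (rule rel_curve_strict[OF R full(1)])
  have IX: "\<delta> t \<in> X" if "t \<in> I" for t
    using full(1) that curve_in unfolding rel_curve_def by blast
  have I1: "t \<in> I" if "t \<in> J1" for t
    using that by (simp add: I_def)
  have I2: "t + 1 \<in> I" if "t \<in> J2" for t
    using that by (simp add: I_def)
  have I01: "0 \<in> I" "1 \<in> I"
    by (simp_all add: I_def)
  have "cauchy_complete_curve l C I \<delta>"
    unfolding cauchy_complete_curve_def timelike_curve_rel_curve
  proof (intro conjI impI full(1,2))
    assume "\<exists>t0\<in>I. \<exists>B::real. \<forall>t\<in>{t0..} \<inter> I. tdist l (\<delta> t0) (\<delta> t) \<le> ennreal B"
    then obtain t0 B where t0: "t0 \<in> I" and B: "\<And>t. t \<in> I \<Longrightarrow> t0 \<le> t \<Longrightarrow> tdist l (\<delta> t0) (\<delta> t) \<le> ennreal B"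
      by auto
    \<comment> \<open>The future half is shifted by 1, the length of the middle piece. As
      \<open>t0 \<le> u + 1\<close>, the reverse triangle inequality carries the bound from
      \<open>t0\<close> over to the parameter \<open>u\<close> of that half.\<close>
    define u where "u = max 0 (t0 - 1)"
    have u: "u \<in> J2" "t0 \<le> u + 1"
      using t0 future(2) J(1) unfolding I_def u_def by (auto simp: max_def)
    have "tdist l (g2' u) (g2' t) \<le> ennreal B" if t: "t \<in> J2" "u \<le> t" for t
    proof -
      have "tdist l (\<delta> (u + 1)) (\<delta> (t + 1)) \<le> tdist l (\<delta> t0) (\<delta> (t + 1))"
        using strict_curve_le[OF strict] I2 t0 u t IX le_refl by (intro tdist_mono) auto
      also have "\<dots> \<le> ennreal B"
        using B I2 t u by auto
      finally show ?thesis
        using full(5) t(1) u(1) by simp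
    qed
    then obtain m where m: "m \<in> J2" "\<forall>t\<in>J2. t \<le> m"
      using future(4)[OF u(1)] by blast
    moreover have "t \<le> m + 1" if "t \<in> I" for t
    proof -
      have "0 \<le> m"
        using m future(2) by blast
      then show ?thesis
        using that m(2) J(1) by (force simp: I_def)
    qed
    ultimately show "\<exists>m\<in>I. \<forall>t\<in>I. t \<le> m"
      using I2 by blast
  next
    assume "\<exists>t0\<in>I. \<exists>B::real. \<forall>t\<in>{..t0} \<inter> I. tdist l (\<delta> t) (\<delta> t0) \<le> ennreal B"
    then obtain t0 B where t0: "t0 \<in> I" and B: "\<And>t. t \<in> I \<Longrightarrow> t \<le> t0 \<Longrightarrow> tdist l (\<delta> t) (\<delta> t0) \<le> ennreal B"
      by auto
    define u where "u = min 0 t0"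
    have u: "u \<in> J1" "u \<le> t0"
      using t0 past(2) J(2) unfolding I_def u_def by (auto simp: min_def)
    have "tdist l (g1' t) (g1' u) \<le> ennreal B" if t: "t \<in> J1" "t \<le> u" for t
    proof -
      have "tdist l (\<delta> t) (\<delta> u) \<le> tdist l (\<delta> t) (\<delta> t0)"
        using strict_curve_le[OF strict] I1 t0 u t IX le_refl by (intro tdist_mono) auto
      also have "\<dots> \<le> ennreal B"
        using B I1 t u by auto
      finally show ?thesis
        using full(3) t(1) u(1) by simp
    qed
    then obtain m where m: "m \<in> J1" "\<forall>t\<in>J1. m \<le> t"
      using past(4)[OF u(1)] by blast
    moreover have "m \<le> t" if "t \<in> I" for t
    proof -
      have "m \<le> 0"
        using m past(2) by blast
      then show ?thesis
        using that m(2) J(2) by (force simp: I_def)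
    qed
    ultimately show "\<exists>m\<in>I. \<forall>t\<in>I. m \<le> t"
      using I1 by blast
  qed
  then have "\<exists>!t. t \<in> I \<and> \<delta> t \<in> B"
    by (rule meet)
  moreover have "\<delta> 0 = x" "\<delta> 1 = y"
    using full(4)[of 0] full(4)[of 1] c by simp_all
  ultimately show "\<exists>(I::real set) g s t. s \<in> I \<and> t \<in> I \<and> s \<noteq> t \<and> g s = x \<and> g t = y \<and> (\<exists>!t. t \<in> I \<and> g t \<in> B)"
    using I01 by (intro exI[of _ I] exI[of _ \<delta>] exI[of _ "0::real"] exI[of _ "1::real"]) simp
qed

section \<open>Existence of strong Cauchy sets\<close>

text \<open>Near its past end the curve either sits in the past boundary, where \<open>\<tau>\<close> vanishes and
  \<open>\<sigma>\<close> does not, or leaves \<open>J_plus q\<close> for every \<open>q\<close>.\<close>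

lemma past_end_sign:
  fixes \<tau> \<sigma> :: "'a \<Rightarrow> real"
  assumes \<tau>: "\<And>x. x \<in> X \<Longrightarrow> 0 < \<tau> x \<Longrightarrow> I_minus X l x \<noteq> {}"
    and small: "\<And>e. 0 < e \<Longrightarrow> \<exists>F. finite F \<and> F \<subseteq> X \<and> (\<forall>x\<in>X. (\<forall>q\<in>F. \<not> q \<sqsubseteq> x) \<longrightarrow> \<tau> x < e)"
    and \<sigma>: "\<And>x. x \<in> X \<Longrightarrow> I_plus X l x \<noteq> {} \<Longrightarrow> 0 < \<sigma> x"
    and \<sigma>_anti: "\<And>x y. x \<sqsubseteq> y \<Longrightarrow> x \<in> X \<Longrightarrow> y \<in> X \<Longrightarrow> \<sigma> y \<le> \<sigma> x"
    and g: "rel_curve (\<sqsubset>) C I g" and inext: "\<nexists>q. q \<in> X \<and> (\<forall>t\<in>I. q \<sqsubset> g t)"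
  obtains t where "t \<in> I" "\<tau> (g t) < \<sigma> (g t)"
proof -
  have CI: "C I g"
    using g by (simp add: rel_curve_def)
  note X = curve_in[OF CI]
  show ?thesis
  proof (cases "\<forall>t\<in>I. \<exists>s\<in>I. s < t")
    case False
    then obtain m where m: "m \<in> I" "\<And>t. t \<in> I \<Longrightarrow> m \<le> t"
      by (metis not_le)
    have I_minus: "I_minus X l (g m) = {}"
    proof (rule ccontr)
      assume "I_minus X l (g m) \<noteq> {}"
      then obtain q where q: "q \<in> X" "q \<lless> g m"
        by (auto simp: I_minus_def)
      have "q \<sqsubset> g t" if t: "t \<in> I" for t
        using chron_le_trans[OF q(2) strict_curve_le[OF g m(1) t m(2)[OF t]]] q(1) X m(1) t
        by (intro chron_strict) auto
      then show False
        using inext q(1) by blast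
    qed
    then have "I_plus X l (g m) \<noteq> {}"
      using no_spacelike_boundary X m(1) by blast
    then have "0 < \<sigma> (g m)"
      using \<sigma> X m(1) by blast
    moreover have "\<tau> (g m) \<le> 0"
      using \<tau> X m(1) I_minus by (meson not_le)
    ultimately show ?thesis
      using that m(1) by fastforce
  next
    case True
    obtain t1 where t1: "t1 \<in> I"
      using curve_nonempty[OF CI] by blast
    then obtain t0 where t0: "t0 \<in> I" "t0 < t1"
      using True by blast
    then have "g t0 \<sqsubset> g t1"
      using g t1 by (simp add: rel_curve_def)
    \<comment> \<open>\<open>\<sigma>\<close> only grows towards the past, so it is enough to bring
      \<open>\<tau>\<close> below the fixed positive value \<open>\<sigma> (g t0)\<close>.\<close>
    then have pos: "0 < \<sigma> (g t0)"
      using \<sigma> future_bubbling X t0(1) t1 by blast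
    then obtain F where F: "finite F" "F \<subseteq> X"
      "\<forall>x\<in>X. (\<forall>q\<in>F. \<not> q \<sqsubseteq> x) \<longrightarrow> \<tau> x < \<sigma> (g t0)"
      using small[OF pos] by blast
    have leaves: "\<exists>t\<in>I. \<not> q \<sqsubseteq> g t" if q: "q \<in> X" for q
    proof (rule ccontr)
      assume "\<not> ?thesis"
      then have le: "q \<sqsubseteq> g t" if "t \<in> I" for t
        using that by blast
      have "q \<sqsubset> g t" if t: "t \<in> I" for t
      proof -
        obtain s where s: "s \<in> I" "s < t"
          using True t by blast
        then have "g s \<sqsubset> g t"
          using g t by (simp add: rel_curve_def)
        then show ?thesis
          using le_strict_trans[OF le[OF s(1)]] q X s(1) t by blast
      qed
      then show False
        using inext q by blast
    qed
    \<comment> \<open>Once the curve has left \<open>J_plus X l q\<close> towards the past, it stays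
      outside. Hence finitely many points are dealt with one after the other, moving further back
      each time.\<close>
    have "\<exists>t\<in>I. t \<le> t0 \<and> (\<forall>q\<in>F. \<not> q \<sqsubseteq> g t)"
      using F(1,2)
    proof (induction rule: finite_induct)
      case (insert q F)
      then obtain t where t: "t \<in> I" "t \<le> t0" "\<And>p. p \<in> F \<Longrightarrow> \<not> p \<sqsubseteq> g t"
        by auto
      obtain s where s: "s \<in> I" "\<not> q \<sqsubseteq> g s"
        using leaves insert.prems by blast
      define u where "u = min s t"
      have u: "u \<in> I" "u \<le> t" "u \<le> s"
        using s t by (auto simp: u_def min_def)
      have "\<not> p \<sqsubseteq> g u" if "p \<in> insert q F" for p
      proof
        assume p: "p \<sqsubseteq> g u"
        have pX: "p \<in> X"
          using that insert.prems by blast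
        have "p \<sqsubseteq> g s"
          using le_trans[OF p strict_curve_le[OF g u(1) s(1) u(3)]] pX X u(1) s(1) by blast
        moreover have "p \<sqsubseteq> g t"
          using le_trans[OF p strict_curve_le[OF g u(1) t(1) u(2)]] pX X u(1) t(1) by blast
        ultimately show False
          using that s(2) t(3) by blast
      qed
      then show ?case
        using u t(2) by (intro bexI[of _ u]) auto
    qed (use t0 in auto)
    then obtain t where t: "t \<in> I" "t \<le> t0" "\<forall>q\<in>F. \<not> q \<sqsubseteq> g t"
      by blast
    have "\<tau> (g t) < \<sigma> (g t0)"
      using F(3) t X by blast
    also have "\<dots> \<le> \<sigma> (g t)"
      using \<sigma>_anti strict_curve_le[OF g t(1) t0(1) t(2)] X t(1) t0(1) by blast
    finally show ?thesis
      using that t(1) by blast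
  qed
qed

text \<open>Along an inextendible causal curve \<open>\<tau> - \<sigma>\<close> is continuous and
  strictly increasing; \<open>past_end_sign\<close> makes it negative somewhere and the time
  reversal of that lemma makes it positive somewhere, so it has exactly one zero.\<close>

lemma strong_cauchy_set_exists: "strong_cauchy_sets X l C \<noteq> {}"
proof -
  interpret rev: spacetime T C "time_reversal l"
    by (rule rev)
  obtain \<tau> :: "'a \<Rightarrow> real" where \<tau>: "\<And>x y. x \<sqsubseteq> y \<Longrightarrow> x \<in> X \<Longrightarrow> y \<in> X \<Longrightarrow> \<tau> x \<le> \<tau> y"
    "\<And>x y. x \<sqsubset> y \<Longrightarrow> x \<in> X \<Longrightarrow> y \<in> X \<Longrightarrow> \<tau> x < \<tau> y"
    "\<And>x. x \<in> X \<Longrightarrow> 0 < \<tau> x \<longleftrightarrow> I_minus X l x \<noteq> {}"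
    "\<And>e. 0 < e \<Longrightarrow> \<exists>F. finite F \<and> F \<subseteq> X \<and> (\<forall>x\<in>X. (\<forall>q\<in>F. \<not> q \<sqsubseteq> x) \<longrightarrow> \<tau> x < e)"
    "\<And>I g. C I g \<Longrightarrow> continuous_on I (\<lambda>t. \<tau> (g t))"
    by (rule exists_time_function) blast
  obtain \<sigma> :: "'a \<Rightarrow> real" where \<sigma>: "\<And>x y. y \<sqsubseteq> x \<Longrightarrow> x \<in> X \<Longrightarrow> y \<in> X \<Longrightarrow> \<sigma> x \<le> \<sigma> y"
    "\<And>x y. y \<sqsubset> x \<Longrightarrow> x \<in> X \<Longrightarrow> y \<in> X \<Longrightarrow> \<sigma> x < \<sigma> y"
    "\<And>x. x \<in> X \<Longrightarrow> 0 < \<sigma> x \<longleftrightarrow> I_plus X l x \<noteq> {}"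
    "\<And>e. 0 < e \<Longrightarrow> \<exists>F. finite F \<and> F \<subseteq> X \<and> (\<forall>x\<in>X. (\<forall>q\<in>F. \<not> x \<sqsubseteq> q) \<longrightarrow> \<sigma> x < e)"
    "\<And>I g. C I g \<Longrightarrow> continuous_on I (\<lambda>t. \<sigma> (g t))"
    by (rule rev.exists_time_function[unfolded reversal]) blast
  define S where "S = {x \<in> X. \<tau> x = \<sigma> x}"
  have "\<exists>!t. t \<in> I \<and> g t \<in> S" if "causal_curve l C I g" "inextendible l C I g" for I g
  proof -
    have g: "rel_curve (\<sqsubset>) C I g"
      using that(1) causal_curve_iff by blast
    then have CI: "C I g"
      by (simp add: rel_curve_def)
    note X = curve_in[OF CI]
    have inext: "\<nexists>q. q \<in> X \<and> (\<forall>t\<in>I. g t \<sqsubset> q)" "\<nexists>q. q \<in> X \<and> (\<forall>t\<in>I. q \<sqsubset> g t)"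
      using that(2) inextendible_iff[OF g] by blast+
    obtain a where a: "a \<in> I" "\<tau> (g a) < \<sigma> (g a)"
      by (rule past_end_sign[OF _ \<tau>(4) _ _ g inext(2), of \<sigma>]) (use \<tau>(3) \<sigma>(1,3) in auto)
    have no_end: "\<nexists>q. q \<in> X \<and> (\<forall>t\<in>uminus -` I. g (- t) \<sqsubset> q)"
      using inext(1) by (metis minus_minus vimage_eq)
    obtain b where b: "b \<in> uminus -` I" "\<sigma> (g (- b)) < \<tau> (g (- b))"
      by (rule rev.past_end_sign[unfolded reversal, OF _ \<sigma>(4) _ _ rel_curve_reverse[OF g] no_end, of \<tau>])
        (use \<tau>(1,3) \<sigma>(3) in auto)
    define f where "f = (\<lambda>t. \<tau> (g t) - \<sigma> (g t))"
    have f_less: "f s < f t" if "s \<in> I" "t \<in> I" "s < t" for s t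
    proof -
      have "g s \<sqsubset> g t"
        using g that by (simp add: rel_curve_def)
      then have "\<tau> (g s) < \<tau> (g t)" "\<sigma> (g t) < \<sigma> (g s)"
        using \<tau>(2) \<sigma>(2) X that by blast+
      then show ?thesis
        by (simp add: f_def)
    qed
    have fab: "f a < 0" "0 < f (- b)" "a \<in> I" "- b \<in> I"
      using a b by (auto simp: f_def)
    then have "a \<le> - b"
      using f_less[of "- b" a] by force
    moreover from this have sub: "{a..- b} \<subseteq> I"
      using curve_between[OF CI fab(3,4)] by auto
    moreover have "continuous_on I f"
      unfolding f_def using \<tau>(5) \<sigma>(5) CI by (intro continuous_intros) auto
    ultimately obtain t where t: "a \<le> t" "t \<le> - b" "f t = 0"
      using IVT'[of f a 0 "- b"] fab continuous_on_subset by (metis less_imp_le)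
    then have "t \<in> I"
      using sub by auto
    have S_iff: "g u \<in> S \<longleftrightarrow> f u = 0" if "u \<in> I" for u
      using X[OF that] by (simp add: S_def f_def)
    show ?thesis
    proof (rule ex1I[of _ t])
      show "t \<in> I \<and> g t \<in> S"
        using \<open>t \<in> I\<close> t(3) S_iff by blast
      fix u assume u: "u \<in> I \<and> g u \<in> S"
      then have "f u = 0"
        using S_iff by blast
      then show "u = t"
        using f_less[of u t] f_less[of t u] u \<open>t \<in> I\<close> t(3) by force
    qed
  qed
  then have "S \<in> strong_cauchy_sets X l C"
    by (simp add: strong_cauchy_sets_def S_def)
  then show ?thesis
    by blast
qed

end

context length_spacetime
begin

text \<open>The joining curve may be merely causal here, and \<open>length_sup\<close> below the
  positive value \<open>tdist l x y\<close> supplies one. It extends to an inextendible causal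
  curve, which cannot meet \<open>B\<close> at both points.\<close>

lemma strong_cauchy_set_separating:
  assumes B: "B \<in> strong_cauchy_sets X l C"
  shows "separating B"
proof (rule inextendible_chron_separating)
  show "B \<subseteq> X"
    using B by (simp add: strong_cauchy_sets_def)
  have meet: "\<exists>!t. t \<in> I \<and> g t \<in> B" if "causal_curve l C I g" "inextendible l C I g" for I g
    using B that by (simp add: strong_cauchy_sets_def)
  then show "\<exists>t\<in>I. g t \<in> B" if "inextendible l C I g" for I g
    using that unfolding inextendible_def by blast
  fix x y assume xy: "x \<in> X" "y \<in> X" "x \<lless> y"
  then have "0 < tdist l x y"
    by (simp add: chron_def)
  then obtain a b g where g: "joins g a b x y" "causal_curve l C {a..b} g"
    using length_sup[OF xy(3,1,2)] by blast
  have R: "curve_order (\<sqsubset>)" and ne: "x \<noteq> y"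
    using xy chron_irrefl by (auto simp: curve_order_def)
  obtain I \<delta> s t where \<delta>: "rel_curve (\<sqsubset>) C I \<delta>" "inextendible l C I \<delta>"
    "s \<in> I" "t \<in> I" "s \<noteq> t" "\<delta> s = x" "\<delta> t = y"
    by (rule curve_extension_meets_twice[OF R g(2)[unfolded causal_curve_iff] g(1) ne])
  then have "\<exists>!t. t \<in> I \<and> \<delta> t \<in> B"
    using meet[unfolded causal_curve_iff] by blast
  then show "\<exists>(I::real set) g s t. s \<in> I \<and> t \<in> I \<and> s \<noteq> t \<and> g s = x \<and> g t = y \<and> (\<exists>!t. t \<in> I \<and> g t \<in> B)"
    using \<delta>(3-7) by blast
qed

lemma cauchy_sets_extended_metrics:
  "strong_cauchy_sets X l C \<noteq> {} \<and> extended_metric_on (strong_cauchy_sets X l C) (d_J l) \<and>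
    (timelike_path_connected X l C \<longrightarrow>
      extended_metric_on (cauchy_sets X l C) (d_J l) \<and>
      ((\<forall>x\<in>X. \<exists>I g. cauchy_complete_curve l C I g \<and> x \<in> g ` I) \<longrightarrow>
        extended_metric_on (weak_cauchy_sets X l C) (d_J l)))"
  using strong_cauchy_set_exists separating_extended_metric strong_cauchy_set_separating
    cauchy_set_separating weak_cauchy_set_separating by blast

end

section \<open>Continuous and locally Lipschitz curves\<close>

lemma curve_iff:
  "curve T I g \<longleftrightarrow> is_interval I \<and> I \<noteq> {} \<and> (\<forall>t\<in>I. g t \<in> topspace T \<and>
    (\<forall>U. openin T U \<and> g t \<in> U \<longrightarrow> (\<exists>e>0. \<forall>s\<in>I. \<bar>s - t\<bar> < e \<longrightarrow> g s \<in> U)))"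
proof -
  have *: "ball t e \<inter> I \<subseteq> {s \<in> I. P s} \<longleftrightarrow> (\<forall>s\<in>I. \<bar>s - t\<bar> < e \<longrightarrow> P s)" for t e :: real and P
    by (auto simp: subset_eq dist_real_def abs_minus_commute)
  have "continuous_map (top_of_set I) T g \<longleftrightarrow> (\<forall>t\<in>I. g t \<in> topspace T \<and>
    (\<forall>U. openin T U \<and> g t \<in> U \<longrightarrow> (\<exists>e>0. \<forall>s\<in>I. \<bar>s - t\<bar> < e \<longrightarrow> g s \<in> U)))"
    unfolding continuous_map_def openin_contains_ball topspace_euclidean_subtopology *
    by (auto simp: Pi_iff)
  then show ?thesis
    unfolding curve_def by blast
qed

lemma curveI:
  assumes "is_interval I" "I \<noteq> {}" "\<And>t. t \<in> I \<Longrightarrow> g t \<in> topspace T"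
    and "\<And>t U. t \<in> I \<Longrightarrow> openin T U \<Longrightarrow> g t \<in> U \<Longrightarrow> \<exists>e>0. \<forall>s\<in>I. \<bar>s - t\<bar> < e \<longrightarrow> g s \<in> U"
  shows "curve T I g"
  using assms unfolding curve_iff by simp

lemma curveD:
  assumes "curve T I g"
  shows "is_interval I" "I \<noteq> {}" "\<And>t. t \<in> I \<Longrightarrow> g t \<in> topspace T"
    and "\<And>t U. t \<in> I \<Longrightarrow> openin T U \<Longrightarrow> g t \<in> U \<Longrightarrow> \<exists>e>0. \<forall>s\<in>I. \<bar>s - t\<bar> < e \<longrightarrow> g s \<in> U"
  using assms unfolding curve_iff by simp_all

lemma is_interval_affine_vimage:
  fixes I :: "real set"
  assumes "is_interval I"
  shows "is_interval ((\<lambda>t. a * t + c) -` I)"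
  unfolding is_interval_1
proof (intro ballI allI impI)
  fix s t u assume h: "s \<in> (\<lambda>t. a * t + c) -` I" "t \<in> (\<lambda>t. a * t + c) -` I" "s \<le> u \<and> u \<le> t"
  have I: "z \<in> I" if "x \<in> I" "y \<in> I" "x \<le> z" "z \<le> y" for x y z
    using assms that unfolding is_interval_1 by blast
  show "u \<in> (\<lambda>t. a * t + c) -` I"
  proof (cases "0 \<le> a")
    case True
    then show ?thesis
      using h I[of "a * s + c" "a * t + c" "a * u + c"] by (simp add: mult_left_mono)
  next
    case False
    then show ?thesis
      using h I[of "a * t + c" "a * s + c" "a * u + c"] by (simp add: mult_left_mono_neg)
  qed
qed

lemma is_interval_glue:
  fixes I J :: "real set"
  assumes "is_interval I" "is_interval J" "b \<in> I" "b \<in> J" "I \<subseteq> {..b}" "J \<subseteq> {b..}"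
  shows "is_interval (I \<union> J)"
  unfolding is_interval_1
proof (intro ballI allI impI)
  fix s t u assume h: "s \<in> I \<union> J" "t \<in> I \<union> J" "s \<le> u \<and> u \<le> t"
  have I: "z \<in> I" if "x \<in> I" "y \<in> I" "x \<le> z" "z \<le> y" for x y z
    using assms(1) that unfolding is_interval_1 by blast
  have J: "z \<in> J" if "x \<in> J" "y \<in> J" "x \<le> z" "z \<le> y" for x y z
    using assms(2) that unfolding is_interval_1 by blast
  show "u \<in> I \<union> J"
  proof (cases "u \<le> b")
    case True
    then show ?thesis
      using h I[of s b u] J[of s t u] assms(3-6) by (metis UnE UnI1 UnI2 atLeast_iff order_antisym order_trans subsetD)
  next
    case False
    then have "t \<in> J"
      using h assms(5) by force
    then show ?thesis
      using J[of b t u] False h assms(4) by auto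
  qed
qed

lemma curve_class_curve: "curve_class T (curve T)"
proof
  show "curve T I g" if "curve T I g" for I g
    by fact
  show "curve T I g'" if "curve T I g" "\<And>t. t \<in> I \<Longrightarrow> g t = g' t" for I g g'
    using that unfolding curve_iff by simp
  show "curve T J g" if "curve T I g" "J \<subseteq> I" "is_interval J" "J \<noteq> {}" for I J g
    using that unfolding curve_iff by (meson subsetD)
  show "curve T ((\<lambda>t. a * t + c) -` I) (\<lambda>t. g (a * t + c))" if g: "curve T I g" and a: "a \<noteq> 0" for I g a c
  proof (rule curveI)
    show "is_interval ((\<lambda>t. a * t + c) -` I)"
      using curveD(1)[OF g] by (rule is_interval_affine_vimage)
    obtain t where "t \<in> I"
      using curveD(2)[OF g] by blast
    then have "(t - c) / a \<in> (\<lambda>t. a * t + c) -` I"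
      using a by simp
    then show "(\<lambda>t. a * t + c) -` I \<noteq> {}"
      by blast
    fix t assume t: "t \<in> (\<lambda>t. a * t + c) -` I"
    then show "g (a * t + c) \<in> topspace T"
      using curveD(3)[OF g] by simp
    fix U assume "openin T U" "g (a * t + c) \<in> U"
    then obtain e where e: "e > 0" "\<And>s. s \<in> I \<Longrightarrow> \<bar>s - (a * t + c)\<bar> < e \<Longrightarrow> g s \<in> U"
      using curveD(4)[OF g] t by (metis vimage_eq)
    have "g (a * s + c) \<in> U" if "a * s + c \<in> I" "\<bar>s - t\<bar> < e / \<bar>a\<bar>" for s
    proof (rule e(2)[OF that(1)])
      have "\<bar>a * s + c - (a * t + c)\<bar> = \<bar>a\<bar> * \<bar>s - t\<bar>"
        by (simp add: abs_mult[symmetric] right_diff_distrib)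
      also have "\<dots> < e"
        using that(2) a by (simp add: field_simps)
      finally show "\<bar>a * s + c - (a * t + c)\<bar> < e" .
    qed
    then show "\<exists>e>0. \<forall>s\<in>(\<lambda>t. a * t + c) -` I. \<bar>s - t\<bar> < e \<longrightarrow> g (a * s + c) \<in> U"
      using e(1) a by (intro exI[of _ "e / \<bar>a\<bar>"]) auto
  qed
  show "curve T (I \<union> J) g" if g: "curve T I g" "curve T J g"
    and b: "b \<in> I" "b \<in> J" "I \<subseteq> {..b}" "J \<subseteq> {b..}" for I J g b
  proof (rule curveI)
    show "is_interval (I \<union> J)"
      using curveD(1)[OF g(1)] curveD(1)[OF g(2)] b by (rule is_interval_glue)
    fix t U assume t: "t \<in> I \<union> J" and U: "openin T U" "g t \<in> U"
    have "\<exists>e>0. \<forall>s\<in>I. \<bar>s - t\<bar> < e \<longrightarrow> g s \<in> U"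
    proof (cases "t \<in> I")
      case False
      then have "b < t"
        using t b by (metis UnE atLeast_iff le_less subsetD)
      then show ?thesis
        using b(3) by (intro exI[of _ "t - b"]) auto
    qed (use curveD(4)[OF g(1)] U in blast)
    moreover have "\<exists>e>0. \<forall>s\<in>J. \<bar>s - t\<bar> < e \<longrightarrow> g s \<in> U"
    proof (cases "t \<in> J")
      case False
      then have "t < b"
        using t b by (metis UnE atMost_iff le_less subsetD)
      then show ?thesis
        using b(4) by (intro exI[of _ "b - t"]) auto
    qed (use curveD(4)[OF g(2)] U in blast)
    ultimately obtain d e where "d > 0" "\<forall>s\<in>I. \<bar>s - t\<bar> < d \<longrightarrow> g s \<in> U"
      "e > 0" "\<forall>s\<in>J. \<bar>s - t\<bar> < e \<longrightarrow> g s \<in> U"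
      by blast
    then show "\<exists>e>0. \<forall>s\<in>I \<union> J. \<bar>s - t\<bar> < e \<longrightarrow> g s \<in> U"
      by (intro exI[of _ "min d e"]) auto
  qed (use curveD(3)[OF g(1)] curveD(3)[OF g(2)] b in auto)
  show "curve T {0..} g" if g: "\<And>n::nat. curve T {0..real n} g" for g
  proof (rule curveI)
    have n: "\<exists>n. t < real n" for t :: real
      by (rule reals_Archimedean2)
    show "g t \<in> topspace T" if t: "t \<in> {0..}" for t
    proof -
      obtain n where "t < real n"
        using n by blast
      then show ?thesis
        using curveD(3)[OF g[of n], of t] t by auto
    qed
    fix t U assume t: "t \<in> {0::real..}" and U: "openin T U" "g t \<in> U"
    obtain n where n: "t < real n"
      using n by blast
    then obtain e where e: "e > 0" "\<And>s. s \<in> {0..real n} \<Longrightarrow> \<bar>s - t\<bar> < e \<Longrightarrow> g s \<in> U"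
      using curveD(4)[OF g _ U, of n] t by auto
    then show "\<exists>e>0. \<forall>s\<in>{0..}. \<bar>s - t\<bar> < e \<longrightarrow> g s \<in> U"
      using n by (intro exI[of _ "min e (real n - t)"]) auto
  qed (auto simp: is_interval_ci)
  show "curve T {t} (\<lambda>_. x)" if "x \<in> topspace T" for x and t :: real
    using that by (intro curveI) (auto simp: is_interval_1 intro: exI[of _ "1::real"])
qed

section \<open>Locally Lipschitz curves\<close>

lemma lipschitz_curveI:
  assumes "curve T I g"
    and "\<And>t. t \<in> I \<Longrightarrow> \<exists>e>0. \<exists>L. \<forall>r\<in>I. \<forall>s\<in>I. \<bar>r - t\<bar> < e \<longrightarrow> \<bar>s - t\<bar> < e \<longrightarrow> \<rho> (g r) (g s) \<le> L * \<bar>r - s\<bar>"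
  shows "lipschitz_curve T \<rho> I g"
proof -
  have "\<exists>e>0. \<exists>L. \<forall>r\<in>I \<inter> ball t e. \<forall>s\<in>I \<inter> ball t e. \<rho> (g r) (g s) \<le> L * \<bar>r - s\<bar>" if t: "t \<in> I" for t
  proof -
    obtain e L where "e > 0"
      "\<forall>r\<in>I. \<forall>s\<in>I. \<bar>r - t\<bar> < e \<longrightarrow> \<bar>s - t\<bar> < e \<longrightarrow> \<rho> (g r) (g s) \<le> L * \<bar>r - s\<bar>"
      using assms(2)[OF t] by blast
    then show ?thesis
      by (intro exI[of _ e] conjI exI[of _ L]) (auto simp: dist_real_def abs_minus_commute)
  qed
  then show ?thesis
    using assms(1) by (simp add: lipschitz_curve_def)
qed

text \<open>Passing to \<open>\<bar>L\<bar>\<close> makes the constant nonnegative, so that the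
  constants of two pieces can be added when curves are glued.\<close>

lemma lipschitz_curveD:
  assumes "lipschitz_curve T \<rho> I g" "t \<in> I"
  obtains e L where "e > 0" "L \<ge> 0"
    "\<And>r s. r \<in> I \<Longrightarrow> s \<in> I \<Longrightarrow> \<bar>r - t\<bar> < e \<Longrightarrow> \<bar>s - t\<bar> < e \<Longrightarrow> \<rho> (g r) (g s) \<le> L * \<bar>r - s\<bar>"
proof -
  obtain e L where e: "e > 0" "\<forall>r\<in>I \<inter> ball t e. \<forall>s\<in>I \<inter> ball t e. \<rho> (g r) (g s) \<le> L * \<bar>r - s\<bar>"
    using assms unfolding lipschitz_curve_def by blast
  have "\<rho> (g r) (g s) \<le> \<bar>L\<bar> * \<bar>r - s\<bar>" if "r \<in> I" "s \<in> I" "\<bar>r - t\<bar> < e" "\<bar>s - t\<bar> < e" for r s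
  proof -
    have "r \<in> I \<inter> ball t e" "s \<in> I \<inter> ball t e"
      using that by (auto simp: dist_real_def abs_minus_commute)
    then have "\<rho> (g r) (g s) \<le> L * \<bar>r - s\<bar>"
      using e(2) by blast
    also have "\<dots> \<le> \<bar>L\<bar> * \<bar>r - s\<bar>"
      by (intro mult_right_mono) auto
    finally show ?thesis .
  qed
  with e(1) show ?thesis
    using that[of e "\<bar>L\<bar>"] by auto
qed

lemma lipschitz_curve_curve: "lipschitz_curve T \<rho> I g \<Longrightarrow> curve T I g"
  by (simp add: lipschitz_curve_def)

lemma curve_class_lipschitz:
  assumes "Metric_space (topspace T) \<rho>"
  shows "curve_class T (lipschitz_curve T \<rho>)"
proof -
  interpret Metric_space "topspace T" \<rho>
    by fact
  interpret curve_class T "curve T"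
    by (rule curve_class_curve)
  show ?thesis
  proof
    fix I g assume g: "lipschitz_curve T \<rho> I g"
    then show c: "curve T I g"
      by (rule lipschitz_curve_curve)
    show "lipschitz_curve T \<rho> I g'" if eq: "\<And>t. t \<in> I \<Longrightarrow> g t = g' t" for g'
    proof (rule lipschitz_curveI)
      show "curve T I g'"
        using cong_curve[OF c eq] .
      fix t assume "t \<in> I"
      then obtain e L where "e > 0"
        "\<And>r s. r \<in> I \<Longrightarrow> s \<in> I \<Longrightarrow> \<bar>r - t\<bar> < e \<Longrightarrow> \<bar>s - t\<bar> < e \<Longrightarrow> \<rho> (g r) (g s) \<le> L * \<bar>r - s\<bar>"
        using lipschitz_curveD[OF g] by metis
      then show "\<exists>e>0. \<exists>L. \<forall>r\<in>I. \<forall>s\<in>I. \<bar>r - t\<bar> < e \<longrightarrow> \<bar>s - t\<bar> < e \<longrightarrow> \<rho> (g' r) (g' s) \<le> L * \<bar>r - s\<bar>"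
        using eq by (intro exI[of _ e] conjI exI[of _ L]) auto
    qed
    show "lipschitz_curve T \<rho> J g" if J: "J \<subseteq> I" "is_interval J" "J \<noteq> {}" for J
    proof (rule lipschitz_curveI)
      show "curve T J g"
        using subinterval[OF c J] .
      fix t assume "t \<in> J"
      then obtain e L where "e > 0"
        "\<And>r s. r \<in> I \<Longrightarrow> s \<in> I \<Longrightarrow> \<bar>r - t\<bar> < e \<Longrightarrow> \<bar>s - t\<bar> < e \<Longrightarrow> \<rho> (g r) (g s) \<le> L * \<bar>r - s\<bar>"
        using lipschitz_curveD[OF g] J(1) by (metis subsetD)
      then show "\<exists>e>0. \<exists>L. \<forall>r\<in>J. \<forall>s\<in>J. \<bar>r - t\<bar> < e \<longrightarrow> \<bar>s - t\<bar> < e \<longrightarrow> \<rho> (g r) (g s) \<le> L * \<bar>r - s\<bar>"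
        using J(1) by (intro exI[of _ e] conjI exI[of _ L]) auto
    qed
    show "lipschitz_curve T \<rho> ((\<lambda>t. a * t + c) -` I) (\<lambda>t. g (a * t + c))" if a: "a \<noteq> 0" for a c
    proof (rule lipschitz_curveI)
      show "curve T ((\<lambda>t. a * t + c) -` I) (\<lambda>t. g (a * t + c))"
        using affine[OF lipschitz_curve_curve[OF g] a] .
      fix t assume "t \<in> (\<lambda>t. a * t + c) -` I"
      then obtain e L where e: "e > 0"
        "\<And>r s. r \<in> I \<Longrightarrow> s \<in> I \<Longrightarrow> \<bar>r - (a * t + c)\<bar> < e \<Longrightarrow> \<bar>s - (a * t + c)\<bar> < e \<Longrightarrow>
          \<rho> (g r) (g s) \<le> L * \<bar>r - s\<bar>"
        using lipschitz_curveD[OF g] by (metis vimage_eq)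
      have scale: "\<bar>a * r + c - (a * s + c)\<bar> = \<bar>a\<bar> * \<bar>r - s\<bar>" for r s
        by (simp add: abs_mult[symmetric] right_diff_distrib)
      have "\<bar>a\<bar> * \<bar>s - t\<bar> < e" if "\<bar>s - t\<bar> < e / \<bar>a\<bar>" for s
        using that a by (simp add: field_simps)
      then have "\<rho> (g (a * r + c)) (g (a * s + c)) \<le> (L * \<bar>a\<bar>) * \<bar>r - s\<bar>"
        if "a * r + c \<in> I" "a * s + c \<in> I" "\<bar>r - t\<bar> < e / \<bar>a\<bar>" "\<bar>s - t\<bar> < e / \<bar>a\<bar>" for r s
        using e(2)[of "a * r + c" "a * s + c"] that unfolding scale by (simp add: mult.assoc)
      then show "\<exists>e>0. \<exists>L. \<forall>r\<in>(\<lambda>t. a * t + c) -` I. \<forall>s\<in>(\<lambda>t. a * t + c) -` I.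
        \<bar>r - t\<bar> < e \<longrightarrow> \<bar>s - t\<bar> < e \<longrightarrow> \<rho> (g (a * r + c)) (g (a * s + c)) \<le> L * \<bar>r - s\<bar>"
        using e(1) a by (intro exI[of _ "e / \<bar>a\<bar>"] conjI exI[of _ "L * \<bar>a\<bar>"]) auto
    qed
    show "lipschitz_curve T \<rho> (I \<union> J) g" if J: "lipschitz_curve T \<rho> J g"
      and b: "b \<in> I" "b \<in> J" "I \<subseteq> {..b}" "J \<subseteq> {b..}" for J b
    proof (rule lipschitz_curveI)
      have cJ: "curve T J g"
        using J by (rule lipschitz_curve_curve)
      show "curve T (I \<union> J) g"
        using glue[OF c cJ b] .
      fix t assume t: "t \<in> I \<union> J"
      have I_le: "r \<le> b" if "r \<in> I" for r
        using that b(3) by auto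
      have J_ge: "b \<le> r" if "r \<in> J" for r
        using that b(4) by auto
      have "\<exists>e>0. \<exists>L\<ge>0. \<forall>r\<in>I. \<forall>s\<in>I. \<bar>r - t\<bar> < e \<longrightarrow> \<bar>s - t\<bar> < e \<longrightarrow> \<rho> (g r) (g s) \<le> L * \<bar>r - s\<bar>"
      proof (cases "t \<in> I")
        case True
        then show ?thesis
          by (metis lipschitz_curveD[OF g])
      next
        \<comment> \<open>With radius \<open>t - b\<close> no parameter of \<open>I\<close> is close
          to \<open>t\<close>, so the condition on \<open>I\<close> is vacuous.\<close>
        case False
        then have "b < t"
          using t b(1) J_ge by (metis UnE le_less)
        then show ?thesis
          using I_le by (intro exI[of _ "t - b"] conjI exI[of _ 0]) force+
      qed
      then obtain d M where d: "d > 0" "M \<ge> 0"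
        "\<And>r s. r \<in> I \<Longrightarrow> s \<in> I \<Longrightarrow> \<bar>r - t\<bar> < d \<Longrightarrow> \<bar>s - t\<bar> < d \<Longrightarrow> \<rho> (g r) (g s) \<le> M * \<bar>r - s\<bar>"
        by metis
      have "\<exists>e>0. \<exists>L\<ge>0. \<forall>r\<in>J. \<forall>s\<in>J. \<bar>r - t\<bar> < e \<longrightarrow> \<bar>s - t\<bar> < e \<longrightarrow> \<rho> (g r) (g s) \<le> L * \<bar>r - s\<bar>"
      proof (cases "t \<in> J")
        case True
        then show ?thesis
          by (metis lipschitz_curveD[OF J])
      next
        case False
        then have "t < b"
          using t b(2) I_le by (metis UnE le_less)
        then show ?thesis
          using J_ge by (intro exI[of _ "b - t"] conjI exI[of _ 0]) force+
      qed
      then obtain e L where e: "e > 0" "L \<ge> 0"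
        "\<And>r s. r \<in> J \<Longrightarrow> s \<in> J \<Longrightarrow> \<bar>r - t\<bar> < e \<Longrightarrow> \<bar>s - t\<bar> < e \<Longrightarrow> \<rho> (g r) (g s) \<le> L * \<bar>r - s\<bar>"
        by metis
      have X: "g r \<in> topspace T" if "r \<in> I \<union> J" for r
        using that curveD(3)[OF c] curveD(3)[OF cJ] by blast
      \<comment> \<open>The comparison goes through the junction: \<open>b\<close> lies between
        \<open>r\<close> and \<open>s\<close> and is therefore as close to \<open>t\<close> as they
        are.\<close>
      have cross: "\<rho> (g r) (g s) \<le> (M + L) * (s - r)"
        if "r \<in> I" "s \<in> J" "\<bar>r - t\<bar> < min d e" "\<bar>s - t\<bar> < min d e" for r s
      proof -
        have rb: "r \<le> b" and bs: "b \<le> s"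
          using that I_le J_ge by blast+
        moreover from this have "\<bar>b - t\<bar> < min d e"
          using that(3,4) by linarith
        ultimately have rbs: "r \<le> b" "b \<le> s" "\<bar>b - t\<bar> < min d e"
          by blast+
        have "\<rho> (g r) (g s) \<le> \<rho> (g r) (g b) + \<rho> (g b) (g s)"
          using X that b by (intro triangle) auto
        also have "\<dots> \<le> M * (b - r) + L * (s - b)"
          using d(3)[of r b] e(3)[of b s] that b rbs by auto
        also have "\<dots> \<le> M * (s - r) + L * (s - r)"
          using d(2) e(2) rbs by (intro add_mono mult_left_mono) auto
        finally show ?thesis
          by (simp add: algebra_simps)
      qed
      have "\<rho> (g r) (g s) \<le> (M + L) * \<bar>r - s\<bar>"
        if rs: "r \<in> I \<union> J" "s \<in> I \<union> J" "\<bar>r - t\<bar> < min d e" "\<bar>s - t\<bar> < min d e" for r s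
      proof -
        consider "r \<in> I" "s \<in> I" | "r \<in> J" "s \<in> J" | "r \<in> I" "s \<in> J" | "r \<in> J" "s \<in> I"
          using rs by blast
        then show ?thesis
        proof cases
          case 1
          then have "\<rho> (g r) (g s) \<le> M * \<bar>r - s\<bar>"
            using d(3) rs by simp
          then show ?thesis
            using e(2) by (simp add: distrib_right add_increasing2)
        next
          case 2
          then have "\<rho> (g r) (g s) \<le> L * \<bar>r - s\<bar>"
            using e(3) rs by simp
          then show ?thesis
            using d(2) by (simp add: distrib_right add_increasing)
        next
          case 3
          then have "r \<le> s"
            using I_le J_ge by fastforce
          then show ?thesis
            using cross[OF 3] rs by simp
        next
          case 4
          then have "s \<le> r"
            using I_le J_ge by fastforce
          then show ?thesis
            using cross[OF 4(2,1)] rs by (simp add: commute)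
        qed
      qed
      then show "\<exists>e>0. \<exists>L. \<forall>r\<in>I \<union> J. \<forall>s\<in>I \<union> J.
        \<bar>r - t\<bar> < e \<longrightarrow> \<bar>s - t\<bar> < e \<longrightarrow> \<rho> (g r) (g s) \<le> L * \<bar>r - s\<bar>"
        using d(1) e(1) by (intro exI[of _ "min d e"] conjI exI[of _ "M + L"]) auto
    qed
  next
    fix g assume g: "\<And>n::nat. lipschitz_curve T \<rho> {0..real n} g"
    show "lipschitz_curve T \<rho> {0..} g"
    proof (rule lipschitz_curveI)
      show "curve T {0..} g"
        using exhaust lipschitz_curve_curve[OF g] .
      fix t :: real assume t: "t \<in> {0..}"
      obtain n where n: "t < real n"
        using reals_Archimedean2 by blast
      have tn: "t \<in> {0..real n}"
        using t n by auto
      obtain e L where "e > 0" "\<And>r s. r \<in> {0..real n} \<Longrightarrow> s \<in> {0..real n} \<Longrightarrow>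
          \<bar>r - t\<bar> < e \<Longrightarrow> \<bar>s - t\<bar> < e \<Longrightarrow> \<rho> (g r) (g s) \<le> L * \<bar>r - s\<bar>"
        using lipschitz_curveD[OF g tn] by metis
      then show "\<exists>e>0. \<exists>L. \<forall>r\<in>{0..}. \<forall>s\<in>{0..}.
        \<bar>r - t\<bar> < e \<longrightarrow> \<bar>s - t\<bar> < e \<longrightarrow> \<rho> (g r) (g s) \<le> L * \<bar>r - s\<bar>"
        using n by (intro exI[of _ "min e (real n - t)"] conjI exI[of _ L]) auto
    qed
  next
    fix x and t :: real assume "x \<in> topspace T"
    then show "lipschitz_curve T \<rho> {t} (\<lambda>_. x)"
      using point by (intro lipschitz_curveI) (auto intro!: exI[of _ "1::real"])
  qed
qed

section \<open>Extension through limit points\<close>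

text \<open>The curve is reparametrised by a bounded increasing \<open>\<phi>\<close> and its limit
  \<open>p\<close> is put at the supremum \<open>w\<close> of the new parameters. Convergence makes
  the extension continuous; what remains class-specific, the membership of the extended curve in
  \<open>C\<close>, is the hypothesis \<open>extension\<close>.\<close>

lemma limit_extension:
  fixes \<phi> :: "real \<Rightarrow> real"
  assumes order: "antisymp_on (topspace T) (causal_le l)"
    and C: "curve_class T C" and g: "causal_curve l C I g" and p: "p \<in> topspace T"
    and no_max: "\<forall>t\<in>I. \<exists>s\<in>I. t < s" and bound: "\<And>t. t \<in> I \<Longrightarrow> causal_le l (g t) p"
    and limit: "\<And>U. openin T U \<Longrightarrow> p \<in> U \<Longrightarrow> \<exists>t\<in>I. \<forall>s\<in>I. t \<le> s \<longrightarrow> g s \<in> U"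
    and \<phi>: "strict_mono_on I \<phi>" "continuous_on I \<phi>" "bdd_above (\<phi> ` I)"
    and extension: "\<And>\<psi> w. homeomorphism I (\<phi> ` I) \<phi> \<psi> \<Longrightarrow> (\<And>t. t \<in> I \<Longrightarrow> \<phi> t < w) \<Longrightarrow>
      (\<And>r. r < w \<Longrightarrow> \<exists>t\<in>I. r < \<phi> t) \<Longrightarrow>
      curve T (insert w (\<phi> ` I)) (\<lambda>s. if s = w then p else g (\<psi> s)) \<Longrightarrow>
      C (insert w (\<phi> ` I)) (\<lambda>s. if s = w then p else g (\<psi> s))"
  shows "future_extendible l C I g"
proof -
  interpret curve_class T C
    by fact
  have CI: "C I g"
    using g by (simp add: causal_curve_def)
  note X = curve_in[OF CI]
  have I: "is_interval I" "I \<noteq> {}"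
    using curve_interval[OF CI] curve_nonempty[OF CI] .
  have "g ` I \<subseteq> topspace T"
    using X by blast
  then have strict: "rel_curve (strict_le l) C I g"
    using g causal_curve_rel_curve[OF antisymp_on_subset[OF order] I(1)] by blast
  have "inj_on \<phi> I"
    using \<phi>(1) by (rule strict_mono_on_imp_inj_on)
  moreover have "path_connected I"
    using I(1) by (simp add: is_interval_path_connected)
  ultimately obtain \<psi> where \<psi>: "homeomorphism I (\<phi> ` I) \<phi> \<psi>"
    using homeomorphism_into_1d[OF _ \<phi>(2) refl] by blast
  define w where "w = Sup (\<phi> ` I)"
  have less_w: "\<phi> t < w" if t: "t \<in> I" for t
  proof -
    obtain s where "s \<in> I" "t < s"
      using no_max t by blast
    then have "\<phi> t < \<phi> s" "\<phi> s \<le> w"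
      using strict_mono_onD[OF \<phi>(1) t] cSup_upper[OF _ \<phi>(3)] by (auto simp: w_def)
    then show ?thesis
      by simp
  qed
  have near_w: "\<exists>t\<in>I. r < \<phi> t" if "r < w" for r
    using that I(2) less_cSup_iff[OF _ \<phi>(3)] unfolding w_def by auto
  have inv: "\<psi> s \<in> I" "\<phi> (\<psi> s) = s" if "s \<in> \<phi> ` I" for s
    using \<psi> that unfolding homeomorphism_def by auto
  have inv': "\<psi> (\<phi> t) = t" if "t \<in> I" for t
    using \<psi> that unfolding homeomorphism_def by auto
  have \<phi>_le: "\<phi> s \<le> \<phi> t \<longleftrightarrow> s \<le> t" if "s \<in> I" "t \<in> I" for s t
    using \<phi>(1) that by (rule strict_mono_on_less_eq)
  have I': "is_interval (\<phi> ` I)"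
    using I(1) \<phi>(2) by (simp add: is_interval_connected_1 connected_continuous_image)
  let ?K = "insert w (\<phi> ` I)" and ?g = "\<lambda>s. if s = w then p else g (\<psi> s)"
  have below: "s < w" if "s \<in> \<phi> ` I" for s
    using that less_w by blast
  have K: "is_interval ?K"
    unfolding is_interval_1
  proof (intro ballI allI impI)
    fix a b x assume h: "a \<in> ?K" "b \<in> ?K" "a \<le> x \<and> x \<le> b"
    show "x \<in> ?K"
    proof (cases "x = w")
      case False
      have "b \<le> w"
        using h(2) below by force
      then have "x < w" "a \<in> \<phi> ` I"
        using h False by auto
      then obtain t where t: "t \<in> I" "x < \<phi> t"
        using near_w by blast
      then have "x \<in> \<phi> ` I"
        using I'[unfolded is_interval_1, rule_format, of a "\<phi> t" x] \<open>a \<in> \<phi> ` I\<close> h(3) by auto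
      then show ?thesis
        by simp
    qed simp
  qed
  have "curve T ?K ?g"
  proof (rule curveI[OF K])
    show "?g s \<in> topspace T" if "s \<in> ?K" for s
      using that p X inv by auto
    fix s U assume s: "s \<in> ?K" and U: "openin T U" "?g s \<in> U"
    show "\<exists>e>0. \<forall>r\<in>?K. \<bar>r - s\<bar> < e \<longrightarrow> ?g r \<in> U"
    proof (cases "s = w")
      case True
      then obtain t where t: "t \<in> I" "\<And>s. s \<in> I \<Longrightarrow> t \<le> s \<Longrightarrow> g s \<in> U"
        using limit[OF U(1)] U(2) by auto
      have "?g r \<in> U" if r: "r \<in> ?K" "\<bar>r - s\<bar> < w - \<phi> t" for r
      proof (cases "r = w")
        case False
        then have "r \<in> \<phi> ` I" "\<phi> t < r"
          using r True by auto
        then have "t \<le> \<psi> r"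
          using \<phi>_le[OF t(1) inv(1)[of r]] inv(2)[of r] by linarith
        then show ?thesis
          using t(2) inv(1) \<open>r \<in> \<phi> ` I\<close> False by simp
      qed (use U(2) True in simp)
      then show ?thesis
        using less_w[OF t(1)] by (intro exI[of _ "w - \<phi> t"]) simp
    next
      case False
      then have s: "s \<in> \<phi> ` I" "g (\<psi> s) \<in> U"
        using s U(2) by auto
      obtain d where d: "d > 0" "\<And>t. t \<in> I \<Longrightarrow> \<bar>t - \<psi> s\<bar> < d \<Longrightarrow> g t \<in> U"
        using curve_nbhd[OF CI inv(1)[OF s(1)] U(1) s(2)] by metis
      have "continuous_on (\<phi> ` I) \<psi>"
        using \<psi> by (simp add: homeomorphism_def)
      then obtain e where e: "e > 0" "\<And>r. r \<in> \<phi> ` I \<Longrightarrow> dist r s < e \<Longrightarrow> dist (\<psi> r) (\<psi> s) < d"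
        using s(1) d(1) unfolding continuous_on_iff by metis
      have "?g r \<in> U" if r: "r \<in> ?K" "\<bar>r - s\<bar> < min e (w - s)" for r
      proof -
        have "r \<noteq> w"
          using r(2) by auto
        then have "r \<in> \<phi> ` I"
          using r(1) by simp
        then show ?thesis
          using d(2)[OF inv(1)] e(2)[of r] r(2) \<open>r \<noteq> w\<close> by (simp add: dist_real_def)
      qed
      then show ?thesis
        using e(1) below[OF s(1)] by (intro exI[of _ "min e (w - s)"]) simp
    qed
  qed simp
  then have CK: "C ?K ?g"
    using extension[OF \<psi> less_w near_w] by blast
  have "strict_le l (?g r) (?g s)" if rs: "r \<in> ?K" "s \<in> ?K" "r < s" for r s
  proof -
    have r: "r \<in> \<phi> ` I" "r < w"
      using rs below by fastforce+
    note r' = inv[OF r(1)]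
    show ?thesis
    proof (cases "s = w")
      case True
      \<comment> \<open>The bound by \<open>p\<close> is only a weak one. An intermediate point of
        the curve makes it strict: \<open>g (\<psi> r) = p\<close> would squeeze \<open>g t\<close>
        between equal points.\<close>
      obtain t where t: "t \<in> I" "\<psi> r < t"
        using no_max r'(1) by blast
      then have "strict_le l (g (\<psi> r)) (g t)"
        using strict r'(1) by (simp add: rel_curve_def)
      moreover have "causal_le l (g t) p" "causal_le l (g (\<psi> r)) p"
        using bound t(1) r'(1) by auto
      ultimately have "strict_le l (g (\<psi> r)) p"
        using order X t(1) r'(1) unfolding strict_le_def antisymp_on_def by metis
      then show ?thesis
        using True r(2) by simp
    next
      case False
      then have s: "s \<in> \<phi> ` I"
        using rs(2) by simp
      then have "\<psi> r < \<psi> s"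
        using \<phi>_le[OF inv(1)[OF s] r'(1)] r'(2) inv(2)[OF s] rs(3) by simp
      then show ?thesis
        using strict r' inv(1)[OF s] False r(2) by (simp add: rel_curve_def)
    qed
  qed
  then have "rel_curve (strict_le l) C ?K ?g"
    using CK by (simp add: rel_curve_def)
  moreover have "?g ` ?K \<subseteq> topspace T"
    using curve_in[OF CK] by blast
  ultimately have "causal_curve l C ?K ?g"
    using causal_curve_rel_curve[OF antisymp_on_subset[OF order] K] by blast
  moreover have "\<exists>t\<in>?K. \<forall>s\<in>\<phi> ` I. s < t"
    using below by blast
  moreover have "\<forall>s\<in>\<phi> ` I. ?g s = g (\<psi> s)"
    using below by auto
  ultimately show ?thesis
    unfolding future_extendible_def using I' \<psi> \<phi>(1) K
    by (intro exI[of _ "\<phi> ` I"] exI[of _ \<phi>] exI[of _ \<psi>] exI[of _ ?K] exI[of _ ?g] conjI) auto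
qed

text \<open>For continuous curves any bounded increasing reparametrisation will do;
  \<open>arctan\<close> also handles unbounded intervals.\<close>

lemma limit_extendible_curve:
  assumes "antisymp_on (topspace T) (causal_le l)"
  shows "limit_extendible T l (curve T)"
  unfolding limit_extendible_def
proof (intro allI ballI impI)
  fix I g p
  assume p: "p \<in> topspace T" and h: "causal_curve l (curve T) I g \<and> (\<forall>t\<in>I. \<exists>s\<in>I. t < s) \<and>
    (\<forall>t\<in>I. causal_le l (g t) p) \<and>
    (\<forall>U. openin T U \<and> p \<in> U \<longrightarrow> (\<exists>t\<in>I. \<forall>s\<in>I. t \<le> s \<longrightarrow> g s \<in> U))"
  show "future_extendible l (curve T) I g"
  proof (rule limit_extension[OF assms curve_class_curve _ p, where \<phi> = arctan])
    show "strict_mono_on I arctan"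
      by (simp add: strict_mono_on_def arctan_less_iff)
    show "continuous_on I arctan"
      by (intro continuous_intros)
    show "bdd_above (arctan ` I)"
      using arctan_ubound by (intro bdd_aboveI[of _ "pi / 2"]) (auto intro: less_imp_le)
  qed (use h in auto)
qed

section \<open>Inscribed polygons and arclength\<close>

definition chain_length :: "('a \<Rightarrow> 'a \<Rightarrow> real) \<Rightarrow> (real \<Rightarrow> 'a) \<Rightarrow> nat \<Rightarrow> (nat \<Rightarrow> real) \<Rightarrow> real" where
  "chain_length \<rho> g n u = (\<Sum>i<n. \<rho> (g (u i)) (g (u (Suc i))))"

definition chain_in :: "real set \<Rightarrow> nat \<Rightarrow> (nat \<Rightarrow> real) \<Rightarrow> bool" where
  "chain_in I n u \<longleftrightarrow> (\<forall>i\<le>n. u i \<in> I) \<and> (\<forall>i<n. u i < u (Suc i))"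

text \<open>\<open>V t\<close> is the arclength from \<open>t0\<close> to \<open>t\<close>, the
  supremum of the lengths of inscribed polygons ending at \<open>t\<close>. Superadditivity comes
  from appending one node, continuity from the local Lipschitz bound. The value 0 up to
  \<open>t0\<close> allows \<open>V\<close> to be added to a parameter on all of
  \<open>I\<close>.\<close>

lemma rectifiable_length_function:
  assumes metric: "Metric_space (topspace T) \<rho>" and g: "lipschitz_curve T \<rho> I g" and t0: "t0 \<in> I"
    and B: "\<And>n u. chain_in (I \<inter> {t0..}) n u \<Longrightarrow> chain_length \<rho> g n u \<le> B"
  obtains V :: "real \<Rightarrow> real" where "continuous_on I V" "\<And>t. t \<le> t0 \<Longrightarrow> V t = 0"
    "\<And>t. t \<in> I \<Longrightarrow> V t \<le> B"
    "\<And>s t. s \<in> I \<Longrightarrow> t \<in> I \<Longrightarrow> t0 \<le> s \<Longrightarrow> s < t \<Longrightarrow> V s + \<rho> (g s) (g t) \<le> V t"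
proof -
  interpret Metric_space "topspace T" \<rho>
    by fact
  have c: "curve T I g"
    using g by (rule lipschitz_curve_curve)
  note X = curveD(3)[OF c]
  define S where "S = (\<lambda>t. {chain_length \<rho> g n u | n u. chain_in (I \<inter> {t0..}) n u \<and> u n = t})"
  define V where "V = (\<lambda>t. if t \<le> t0 then 0 else Sup (S t))"
  have bdd: "bdd_above (S t)" for t
    unfolding S_def using B by (intro bdd_aboveI[of _ B]) auto
  have point: "0 \<in> S t" if "t \<in> I" "t0 \<le> t" for t
    unfolding S_def using that
    by (intro CollectI exI[of _ 0] exI[of _ "\<lambda>_. t"]) (simp add: chain_in_def chain_length_def)
  have start: "chain_length \<rho> g n u = 0" if u: "chain_in (I \<inter> {t0..}) n u" "u n \<le> t0" for n u
  proof (cases n)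
    case (Suc m)
    then have "u m < u n" "t0 \<le> u m"
      using u(1) by (auto simp: chain_in_def)
    then show ?thesis
      using u(2) by simp
  qed (simp add: chain_length_def)
  have V_upper: "chain_length \<rho> g n u \<le> V (u n)" if u: "chain_in (I \<inter> {t0..}) n u" for n u
  proof (cases "u n \<le> t0")
    case True
    then show ?thesis
      using start[OF u] by (simp add: V_def)
  next
    case False
    have "chain_length \<rho> g n u \<in> S (u n)"
      using u unfolding S_def by blast
    then show ?thesis
      using False cSup_upper[OF _ bdd] by (simp add: V_def)
  qed
  have V_least: "V t \<le> b" if t: "t \<in> I" "t0 \<le> t"
    and b: "\<And>n u. chain_in (I \<inter> {t0..}) n u \<Longrightarrow> u n = t \<Longrightarrow> chain_length \<rho> g n u \<le> b" for t b
  proof (cases "t = t0")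
    case True
    then show ?thesis
      using b[of 0 "\<lambda>_. t"] t by (simp add: V_def chain_in_def chain_length_def)
  next
    case False
    have "Sup (S t) \<le> b"
      using point[OF t] b unfolding S_def by (intro cSup_least) auto
    then show ?thesis
      using False t by (simp add: V_def)
  qed
  have append: "chain_length \<rho> g n u + \<rho> (g (u n)) (g t) \<le> V t"
    if u: "chain_in (I \<inter> {t0..}) n u" and t: "t \<in> I" "u n < t" for n u t
  proof -
    let ?u = "u(Suc n := t)"
    have "t0 \<le> u n"
      using u by (auto simp: chain_in_def)
    then have "chain_in (I \<inter> {t0..}) (Suc n) ?u"
      using u t by (auto simp: chain_in_def less_Suc_eq le_Suc_eq)
    moreover have "chain_length \<rho> g (Suc n) ?u = chain_length \<rho> g n u + \<rho> (g (u n)) (g t)"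
      by (simp add: chain_length_def)
    ultimately show ?thesis
      using V_upper[of "Suc n" ?u] by simp
  qed
  have V0: "0 \<le> V t" if "t \<in> I" for t
    using V_upper[of 0 "\<lambda>_. t"] that by (cases "t \<le> t0") (auto simp: V_def chain_in_def chain_length_def)
  have superadditive: "V s + \<rho> (g s) (g t) \<le> V t" if st: "s \<in> I" "t \<in> I" "t0 \<le> s" "s < t" for s t
  proof -
    have "V s \<le> V t - \<rho> (g s) (g t)"
      using append st by (intro V_least) force+
    then show ?thesis
      by simp
  qed
  have V_le_B: "V t \<le> B" if t: "t \<in> I" for t
  proof (cases "t0 \<le> t")
    case True
    then show ?thesis
      using B t by (intro V_least) auto
  next
    case False
    then show ?thesis
      using B[of 0 "\<lambda>_. t0"] t0 by (simp add: V_def chain_in_def chain_length_def)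
  qed
  \<comment> \<open>Induction along the nodes of a polygon: the nodes before \<open>s\<close> are
    absorbed into \<open>V s\<close>, and a segment that jumps over \<open>s\<close> is split there
    by the triangle inequality.\<close>
  have lipschitz: "V t \<le> V s + L * (t - s)"
    if st: "s \<in> I" "t \<in> I" "t0 \<le> s" "s \<le> t" and L: "L \<ge> 0"
      and \<rho>: "\<And>q r. q \<in> I \<Longrightarrow> r \<in> I \<Longrightarrow> s \<le> q \<Longrightarrow> q \<le> r \<Longrightarrow> r \<le> t \<Longrightarrow> \<rho> (g q) (g r) \<le> L * (r - q)" for s t L
  proof (rule V_least)
    fix n u assume "chain_in (I \<inter> {t0..}) n u" "u n = t"
    moreover have "chain_length \<rho> g m u \<le> V s + L * (u m - s)"
      if "chain_in (I \<inter> {t0..}) m u" "s \<le> u m" "u m \<le> t" for m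
      using that
    proof (induction m)
      case 0
      then show ?case
        using V0[OF st(1)] L by (simp add: chain_length_def)
    next
      case (Suc m)
      have chain: "chain_in (I \<inter> {t0..}) m u" and less: "u m < u (Suc m)"
        and I: "u m \<in> I" "u (Suc m) \<in> I"
        using Suc.prems(1) by (auto simp: chain_in_def)
      have split: "chain_length \<rho> g (Suc m) u = chain_length \<rho> g m u + \<rho> (g (u m)) (g (u (Suc m)))"
        by (simp add: chain_length_def)
      show ?case
      proof (cases "s \<le> u m")
        case True
        then have "chain_length \<rho> g m u \<le> V s + L * (u m - s)"
          using Suc.IH chain less Suc.prems(3) by simp
        moreover have "\<rho> (g (u m)) (g (u (Suc m))) \<le> L * (u (Suc m) - u m)"
          using \<rho>[OF I True] less Suc.prems(3) by simp
        ultimately show ?thesis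
          unfolding split by (simp add: algebra_simps)
      next
        case False
        then have "chain_length \<rho> g m u + \<rho> (g (u m)) (g s) \<le> V s"
          using append[OF chain st(1)] by simp
        moreover have "\<rho> (g s) (g (u (Suc m))) \<le> L * (u (Suc m) - s)"
          using \<rho>[OF st(1) I(2)] Suc.prems(2,3) by simp
        moreover have "\<rho> (g (u m)) (g (u (Suc m))) \<le> \<rho> (g (u m)) (g s) + \<rho> (g s) (g (u (Suc m)))"
          using X I st(1) by (intro triangle) auto
        ultimately show ?thesis
          unfolding split by linarith
      qed
    qed
    ultimately show "chain_length \<rho> g n u \<le> V s + L * (t - s)"
      using st(4) by fastforce
  qed (use st in auto)
  have "continuous_on I V"
    unfolding continuous_on_iff
  proof (intro ballI allI impI)
    fix t \<epsilon> :: real assume t: "t \<in> I" and \<epsilon>: "0 < \<epsilon>"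
    obtain e L where e: "e > 0" "L \<ge> 0" "\<And>r s. r \<in> I \<Longrightarrow> s \<in> I \<Longrightarrow> \<bar>r - t\<bar> < e \<Longrightarrow> \<bar>s - t\<bar> < e \<Longrightarrow>
        \<rho> (g r) (g s) \<le> L * \<bar>r - s\<bar>"
      using lipschitz_curveD[OF g t] by metis
    \<comment> \<open>\<open>V\<close> is constant up to \<open>t0\<close>; if \<open>r\<close> lies
      beyond \<open>t0\<close>, a smaller parameter can be moved up to \<open>t0\<close> without
      leaving the neighbourhood of \<open>t\<close>.\<close>
    have V_max: "V s = V (max s t0)" for s
      by (simp add: V_def max_def)
    have step: "\<bar>V r - V s\<bar> \<le> L * (r - s)"
      if rs: "r \<in> I" "s \<in> I" "s \<le> r" "\<bar>r - t\<bar> < e" "\<bar>s - t\<bar> < e" for r s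
    proof (cases "r \<le> t0")
      case True
      then show ?thesis
        using rs e(2) by (simp add: V_def)
    next
      case False
      define s' where "s' = max s t0"
      have s': "s' \<in> I" "t0 \<le> s'" "s' \<le> r" "s \<le> s'" "\<bar>s' - t\<bar> < e"
        using rs t0 False by (auto simp: s'_def max_def)
      have "\<rho> (g q) (g q') \<le> L * (q' - q)" if "q \<in> I" "q' \<in> I" "s' \<le> q" "q \<le> q'" "q' \<le> r" for q q'
      proof -
        have "\<bar>q - t\<bar> < e" "\<bar>q' - t\<bar> < e"
          using that s' rs by (auto simp: abs_less_iff)
        then show ?thesis
          using e(3)[OF that(1,2)] that(4) by simp
      qed
      then have "V r \<le> V s' + L * (r - s')"
        using lipschitz[OF s'(1) rs(1) s'(2,3) e(2)] by blast
      moreover have "L * (r - s') \<le> L * (r - s)"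
        using s'(4) e(2) by (intro mult_left_mono) auto
      moreover have "V s' \<le> V r"
      proof (cases "s' = r")
      case False
      then have "V s' + \<rho> (g s') (g r) \<le> V r"
        using superadditive[OF s'(1) rs(1) s'(2)] s'(3) by simp
      then show ?thesis
        using nonneg[of "g s'" "g r"] by linarith
    qed simp
      ultimately show ?thesis
        using V_max[of s] by (simp add: s'_def)
    qed
    have "dist (V s) (V t) < \<epsilon>" if s: "s \<in> I" "dist s t < min e (\<epsilon> / (L + 1))" for s
    proof -
      have near: "\<bar>s - t\<bar> < e" "\<bar>s - t\<bar> < \<epsilon> / (L + 1)"
        using s(2) by (auto simp: dist_real_def)
      then have "\<bar>V s - V t\<bar> \<le> L * \<bar>s - t\<bar>"
        using step[of s t] step[of t s] s(1) t e(1) by (cases "s \<le> t") (auto simp: abs_minus_commute)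
      also have "\<dots> \<le> (L + 1) * \<bar>s - t\<bar>"
        by (intro mult_right_mono) auto
      also have "\<dots> < \<epsilon>"
        using near(2) e(2) by (simp add: field_simps)
      finally show ?thesis
        by (simp add: dist_real_def)
    qed
    then show "\<exists>d>0. \<forall>s\<in>I. dist s t < d \<longrightarrow> dist (V s) (V t) < \<epsilon>"
      using e(1,2) \<epsilon> by (intro exI[of _ "min e (\<epsilon> / (L + 1))"]) auto
  qed
  then show ?thesis
    using that V_le_B superadditive by (auto simp: V_def)
qed

text \<open>Of a localizing neighbourhood only the length bound is kept. In this form it passes to
  the time reversal, so that past limits are covered by the same argument.\<close>

definition locally_rectifiable :: "'a topology \<Rightarrow> ('a \<Rightarrow> 'a \<Rightarrow> ereal) \<Rightarrow> ('a \<Rightarrow> 'a \<Rightarrow> real) \<Rightarrow> bool" where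
  "locally_rectifiable T l \<rho> \<longleftrightarrow> (\<forall>p\<in>topspace T. \<exists>\<Omega> B. openin T \<Omega> \<and> p \<in> \<Omega> \<and>
    (\<forall>I g n u. rel_curve (strict_le l) (lipschitz_curve T \<rho>) I g \<and> g ` I \<subseteq> \<Omega> \<and> chain_in I n u \<longrightarrow>
      chain_length \<rho> g n u \<le> B))"

text \<open>Up to a fixed parameter \<open>t0\<close> the curve keeps its parameter, from there on it is parametrised
  by arclength, so that it approaches its limit with Lipschitz constant 1.\<close>

lemma limit_extendible_lipschitz:
  assumes metric: "Metric_space (topspace T) \<rho>" and topology: "Metric_space.mtopology (topspace T) \<rho> = T"
    and order: "antisymp_on (topspace T) (causal_le l)" and rect: "locally_rectifiable T l \<rho>"
  shows "limit_extendible T l (lipschitz_curve T \<rho>)"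
  unfolding limit_extendible_def
proof (intro allI ballI impI)
  fix I g p
  assume p: "p \<in> topspace T" and h: "causal_curve l (lipschitz_curve T \<rho>) I g \<and> (\<forall>t\<in>I. \<exists>s\<in>I. t < s) \<and>
    (\<forall>t\<in>I. causal_le l (g t) p) \<and>
    (\<forall>U. openin T U \<and> p \<in> U \<longrightarrow> (\<exists>t\<in>I. \<forall>s\<in>I. t \<le> s \<longrightarrow> g s \<in> U))"
  interpret Metric_space "topspace T" \<rho>
    by fact
  interpret curve_class T "lipschitz_curve T \<rho>"
    using metric by (rule curve_class_lipschitz)
  have lip: "lipschitz_curve T \<rho> I g"
    using h by (simp add: causal_curve_def)
  note X = curve_in[OF lip]
  obtain \<Omega> B where \<Omega>: "openin T \<Omega>" "p \<in> \<Omega>"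
    "\<forall>I g n u. rel_curve (strict_le l) (lipschitz_curve T \<rho>) I g \<and> g ` I \<subseteq> \<Omega> \<and> chain_in I n u \<longrightarrow>
      chain_length \<rho> g n u \<le> B"
    using rect p unfolding locally_rectifiable_def by metis
  obtain t0 where t0: "t0 \<in> I" "\<And>s. s \<in> I \<Longrightarrow> t0 \<le> s \<Longrightarrow> g s \<in> \<Omega>"
    using h[THEN conjunct2, THEN conjunct2, THEN conjunct2, rule_format, OF conjI[OF \<Omega>(1,2)]] by blast
  have "antisymp_on (g ` I) (causal_le l)"
    using X by (intro antisymp_on_subset[OF order]) auto
  from causal_curve_rel_curve[OF this curve_interval[OF lip]] h
  have strict: "rel_curve (strict_le l) (lipschitz_curve T \<rho>) I g"
    by blast
  have "is_interval (I \<inter> {t0..})"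
    using curve_interval[OF lip] by (intro is_interval_Int) (auto simp: is_interval_ci)
  then have "rel_curve (strict_le l) (lipschitz_curve T \<rho>) (I \<inter> {t0..}) g"
    using t0(1) by (intro rel_curve_subinterval[OF strict]) auto
  moreover have "g ` (I \<inter> {t0..}) \<subseteq> \<Omega>"
    using t0(2) by auto
  ultimately have "chain_length \<rho> g n u \<le> B" if "chain_in (I \<inter> {t0..}) n u" for n u
    using \<Omega>(3) that by blast
  then obtain V where V: "continuous_on I V" "\<And>t. t \<le> t0 \<Longrightarrow> V t = 0" "\<And>t. t \<in> I \<Longrightarrow> V t \<le> B"
    "\<And>s t. s \<in> I \<Longrightarrow> t \<in> I \<Longrightarrow> t0 \<le> s \<Longrightarrow> s < t \<Longrightarrow> V s + \<rho> (g s) (g t) \<le> V t"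
    using rectifiable_length_function[OF metric lip t0(1)] by metis
  \<comment> \<open>A length bound is known only from \<open>t0\<close> on, where the curve has
    entered \<open>\<Omega>\<close>; towards the past its length may be infinite. The two parts of
    \<open>\<phi>\<close> fit together because \<open>V t0 = 0\<close>.\<close>
  define \<phi> where "\<phi> = (\<lambda>t. min t t0 + V t)"
  have \<phi>_low: "\<phi> t = t" if "t \<le> t0" for t
    using that V(2) by (simp add: \<phi>_def)
  have \<phi>_high: "\<phi> t = t0 + V t" if "t0 \<le> t" for t
    using that by (simp add: \<phi>_def)
  have arc: "\<rho> (g s) (g t) \<le> \<phi> t - \<phi> s" if "s \<in> I" "t \<in> I" "t0 \<le> s" "s < t" for s t
    using V(4)[OF that] \<phi>_high that by simp
  have pos: "0 < \<rho> (g s) (g t)" if "s \<in> I" "t \<in> I" "s < t" for s t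
    using strict that X mdist_pos_less unfolding rel_curve_def strict_le_def by blast
  have \<phi>_mono: "\<phi> s < \<phi> t" if st: "s \<in> I" "t \<in> I" "s < t" for s t
  proof -
    consider "t \<le> t0" | "s < t0" "t0 < t" | "t0 \<le> s"
      using st(3) by linarith
    then show ?thesis
    proof cases
      case 1
      then show ?thesis
        using st(3) \<phi>_low by simp
    next
      case 2
      then have "\<phi> t0 < \<phi> t"
        using arc[OF t0(1) st(2)] pos[OF t0(1) st(2)] by simp
      then show ?thesis
        using 2 \<phi>_low[of s] \<phi>_low[of t0] by simp
    next
      case 3
      then show ?thesis
        using arc[OF st(1,2)] pos[OF st(1,2)] st(3) by simp
    qed
  qed
  show "future_extendible l (lipschitz_curve T \<rho>) I g"
  proof (rule limit_extension[OF order curve_class_lipschitz[OF metric] _ p, where \<phi> = \<phi>])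
    show mono: "strict_mono_on I \<phi>"
      using \<phi>_mono by (simp add: strict_mono_on_def)
    show "continuous_on I \<phi>"
      unfolding \<phi>_def using V(1) by (intro continuous_intros)
    show "bdd_above (\<phi> ` I)"
      using V(3) by (intro bdd_aboveI[of _ "t0 + B"]) (auto simp: \<phi>_def intro!: add_mono)
    fix \<psi> w
    assume \<psi>: "homeomorphism I (\<phi> ` I) \<phi> \<psi>" and w: "\<And>t. t \<in> I \<Longrightarrow> \<phi> t < w"
      "\<And>r. r < w \<Longrightarrow> \<exists>t\<in>I. r < \<phi> t"
    let ?K = "insert w (\<phi> ` I)" and ?g = "\<lambda>s. if s = w then p else g (\<psi> s)"
    assume K: "curve T ?K ?g"
    interpret cont: curve_class T "curve T"
      by (rule curve_class_curve)
    have inv': "\<psi> (\<phi> t) = t" if "t \<in> I" for t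
      using \<psi> that unfolding homeomorphism_def by auto
    have g_\<phi>: "?g (\<phi> t) = g t" if "t \<in> I" for t
      using inv'[OF that] w(1)[OF that] by simp
    have t0_K: "t0 \<in> ?K" "t0 < w"
      using t0(1) \<phi>_low[of t0] w(1)[of t0] by force+
    have low: "?K \<inter> {..t0} = I \<inter> {..t0}"
    proof (intro equalityI subsetI)
      fix s assume s: "s \<in> ?K \<inter> {..t0}"
      then obtain t where t: "t \<in> I" "s = \<phi> t"
        using t0_K(2) by auto
      have "t \<le> t0"
      proof (rule ccontr)
        assume "\<not> t \<le> t0"
        then show False
          using \<phi>_mono[OF t0(1) t(1)] \<phi>_low[of t0] s t(2) by simp
      qed
      then show "s \<in> I \<inter> {..t0}"
        using t \<phi>_low by simp
    next
      fix s assume s: "s \<in> I \<inter> {..t0}"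
      then have "s = \<phi> s"
        using \<phi>_low by simp
      then show "s \<in> ?K \<inter> {..t0}"
        using s by blast
    qed
    \<comment> \<open>Up to \<open>t0\<close> the parameter is unchanged, so the Lipschitz property
      is inherited from \<open>g\<close>.\<close>
    have "lipschitz_curve T \<rho> (?K \<inter> {..t0}) ?g"
      unfolding low
    proof (rule cong_curve)
      have "is_interval (I \<inter> {..t0})"
        using curve_interval[OF lip] by (intro is_interval_Int) (auto simp: is_interval_ic)
      then show "lipschitz_curve T \<rho> (I \<inter> {..t0}) g"
        using t0(1) by (intro subinterval[OF lip]) auto
      fix t assume t: "t \<in> I \<inter> {..t0}"
      then have "\<phi> t = t"
        using \<phi>_low by simp
      then show "g t = ?g t"
        using g_\<phi>[of t] t by (metis IntD1)
    qed
    moreover have "lipschitz_curve T \<rho> (?K \<inter> {t0..}) ?g"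
    proof (rule lipschitz_curveI)
      have "is_interval (?K \<inter> {t0..})"
        using curveD(1)[OF K] by (intro is_interval_Int) (auto simp: is_interval_ci)
      then show "curve T (?K \<inter> {t0..}) ?g"
        using t0_K(1) by (intro cont.subinterval[OF K]) auto
      have inner: "\<rho> (?g r) (?g s) \<le> s - r" if rs: "r \<in> \<phi> ` I" "s \<in> \<phi> ` I" "t0 \<le> r" "r < s" for r s
      proof -
        obtain q t where qt: "q \<in> I" "r = \<phi> q" "t \<in> I" "s = \<phi> t"
          using rs by blast
        have "t0 \<le> q"
        proof (rule ccontr)
          assume "\<not> t0 \<le> q"
          then show False
            using \<phi>_low[of q] rs(3) qt(2) by simp
        qed
        moreover have "q < t"
          using \<phi>_mono[OF qt(3,1)] rs(4) qt by (metis linorder_neqE_linordered_idom order_less_asym)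
        ultimately show ?thesis
          using arc[OF qt(1,3)] unfolding qt(2,4) g_\<phi>[OF qt(1)] g_\<phi>[OF qt(3)] by simp
      qed
      \<comment> \<open>The estimate of \<open>inner\<close> passes to the end point: parameters
        close to \<open>w\<close> have values within any \<epsilon> of \<open>p\<close>.\<close>
      have top: "\<rho> (?g r) p \<le> w - r" if r: "r \<in> \<phi> ` I" "t0 \<le> r" for r
      proof (rule field_le_epsilon)
        fix \<epsilon> :: real assume \<epsilon>: "0 < \<epsilon>"
        have op: "openin T (mball p \<epsilon>)"
          using openin_mball topology by metis
        have "?g w \<in> mball p \<epsilon>"
          using p \<epsilon> by simp
        from curveD(4)[OF K insertI1 op this]
        obtain e where e: "e > 0" "\<forall>s\<in>?K. \<bar>s - w\<bar> < e \<longrightarrow> ?g s \<in> mball p \<epsilon>"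
          by blast
        have "max r (w - e) < w"
          using r(1) w(1) e(1) by auto
        then obtain t where t: "t \<in> I" "max r (w - e) < \<phi> t"
          using w(2) by blast
        have near: "?g (\<phi> t) \<in> mball p \<epsilon>"
          using t w(1)[OF t(1)] by (intro e(2)[rule_format]) auto
        have rX: "?g r \<in> topspace T"
          using curveD(3)[OF K] r(1) by blast
        have "\<rho> (?g r) p \<le> \<rho> (?g r) (?g (\<phi> t)) + \<rho> (?g (\<phi> t)) p"
          using near p rX by (intro triangle) auto
        also have "\<dots> \<le> (\<phi> t - r) + \<epsilon>"
          using inner[OF r(1) _ r(2), of "\<phi> t"] t near by (intro add_mono) (auto simp: commute)
        also have "\<dots> \<le> w - r + \<epsilon>"
          using w(1)[OF t(1)] by simp
        finally show "\<rho> (?g r) p \<le> w - r + \<epsilon>" .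
      qed
      have less: "\<rho> (?g r) (?g s) \<le> s - r" if rs: "r \<in> ?K" "s \<in> ?K" "t0 \<le> r" "r < s" for r s
      proof -
        have "r \<in> \<phi> ` I" "r \<noteq> w"
          using rs w(1) by fastforce+
        then show ?thesis
          using inner[of r s] top[of r] rs by (cases "s = w") auto
      qed
      have global: "\<rho> (?g r) (?g s) \<le> 1 * \<bar>r - s\<bar>" if rs: "r \<in> ?K \<inter> {t0..}" "s \<in> ?K \<inter> {t0..}" for r s
      proof -
        have "\<rho> (?g r) (?g s) = \<rho> (?g s) (?g r)"
          by (rule commute)
        moreover have "\<rho> (?g r) (?g r) = 0"
          using curveD(3)[OF K] rs(1) by (intro mdist_zero) blast
        ultimately show ?thesis
          using less[of r s] less[of s r] rs by (cases r s rule: linorder_cases) auto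
      qed
      show "\<exists>e>0. \<exists>L. \<forall>r\<in>?K \<inter> {t0..}. \<forall>s\<in>?K \<inter> {t0..}. \<bar>r - t\<bar> < e \<longrightarrow> \<bar>s - t\<bar> < e \<longrightarrow>
          \<rho> (?g r) (?g s) \<le> L * \<bar>r - s\<bar>" for t
        by (rule exI[of _ 1], intro conjI zero_less_one exI[of _ 1] ballI impI, rule global)
    qed
    moreover have "?K \<inter> {..t0} \<union> ?K \<inter> {t0..} = ?K"
      by auto
    ultimately show "lipschitz_curve T \<rho> ?K ?g"
      using glue[of "?K \<inter> {..t0}" ?g "?K \<inter> {t0..}" t0] t0_K(1) by simp
  qed (use h in auto)
qed

lemma locally_rectifiable_reversal:
  assumes metric: "Metric_space (topspace T) \<rho>" and rect: "locally_rectifiable T l \<rho>"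
  shows "locally_rectifiable T (time_reversal l) \<rho>"
  unfolding locally_rectifiable_def
proof
  interpret Metric_space "topspace T" \<rho>
    by fact
  interpret curve_class T "lipschitz_curve T \<rho>"
    using metric by (rule curve_class_lipschitz)
  fix p assume p: "p \<in> topspace T"
  obtain \<Omega> B where \<Omega>: "openin T \<Omega>" "p \<in> \<Omega>"
    "\<forall>I g n u. rel_curve (strict_le l) (lipschitz_curve T \<rho>) I g \<and> g ` I \<subseteq> \<Omega> \<and> chain_in I n u \<longrightarrow>
      chain_length \<rho> g n u \<le> B"
    using rect p unfolding locally_rectifiable_def by metis
  have bound: "chain_length \<rho> g n u \<le> B"
    if g: "rel_curve (strict_le (time_reversal l)) (lipschitz_curve T \<rho>) I g" "g ` I \<subseteq> \<Omega>"
      and u: "chain_in I n u" for I g n u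
  proof -
    \<comment> \<open>Reflection reverses the order of parameters, so the nodes are also listed
      backwards.\<close>
    let ?u = "\<lambda>i. - u (n - i)"
    have "chain_length \<rho> (\<lambda>t. g (- t)) n ?u = (\<Sum>i<n. \<rho> (g (u (n - i))) (g (u (n - Suc i))))"
      by (simp add: chain_length_def)
    also have "\<dots> = (\<Sum>i<n. \<rho> (g (u (Suc (n - Suc i)))) (g (u (n - Suc i))))"
      by (intro sum.cong) (auto simp: Suc_diff_Suc)
    also have "\<dots> = (\<Sum>i<n. \<rho> (g (u (Suc i))) (g (u i)))"
      by (rule sum.nat_diff_reindex[of "\<lambda>i. \<rho> (g (u (Suc i))) (g (u i))"])
    finally have "chain_length \<rho> (\<lambda>t. g (- t)) n ?u = chain_length \<rho> g n u"
      by (simp add: chain_length_def commute)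
    moreover have "chain_in (uminus -` I) n ?u"
    proof -
      have "u (n - Suc i) < u (n - i)" if "i < n" for i
        using u that unfolding chain_in_def by (metis Suc_diff_Suc diff_less zero_less_Suc less_nat_zero_code neq0_conv)
      then show ?thesis
        using u unfolding chain_in_def by auto
    qed
    moreover have "rel_curve (strict_le l) (lipschitz_curve T \<rho>) (uminus -` I) (\<lambda>t. g (- t))"
      using rel_curve_reverse[OF g(1)] by (simp add: strict_le_rev)
    moreover have "(\<lambda>t. g (- t)) ` (uminus -` I) \<subseteq> \<Omega>"
      using g(2) by auto
    ultimately show ?thesis
      using \<Omega>(3) by metis
  qed
  show "\<exists>\<Omega> B. openin T \<Omega> \<and> p \<in> \<Omega> \<and>
    (\<forall>I g n u. rel_curve (strict_le (time_reversal l)) (lipschitz_curve T \<rho>) I g \<and> g ` I \<subseteq> \<Omega> \<and>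
      chain_in I n u \<longrightarrow> chain_length \<rho> g n u \<le> B)"
    by (intro exI[of _ \<Omega>] exI[of _ B] conjI \<Omega>(1,2) allI impI bound) auto
qed

section \<open>The three classes of spacetimes\<close>

lemma lor_length_degenerate: "lor_length l a a g = 0"
proof -
  have "(0, \<lambda>_. a) \<in> partitions a a"
    by (simp add: partitions_def)
  then have "lor_length l a a g \<le> (\<Sum>i<(0::nat). tdist l (g a) (g a))"
    unfolding lor_length_def by (rule INF_lower2) simp
  then show ?thesis
    by simp
qed

text \<open>By antisymmetry a causal curve from \<open>x\<close> to \<open>x\<close> has a single
  parameter. Where distances are suprema of lengths, this excludes
  \<open>chron l x x\<close>.\<close>

lemma (in curve_class) causal_loop_length:
  assumes order: "antisymp_on (topspace T) (causal_le l)"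
    and g: "joins g a b x x" "causal_curve l C {a..b} g"
  shows "lor_length l a b g = 0"
proof -
  have "g ` {a..b} \<subseteq> topspace T"
    using g(2) curve_in unfolding causal_curve_def by blast
  then have "rel_curve (strict_le l) C {a..b} g"
    using g(2) causal_curve_rel_curve[OF antisymp_on_subset[OF order] is_interval_cc] by blast
  then have "\<not> a < b"
    using g(1) unfolding joins_def rel_curve_def strict_le_def by (metis atLeastAtMost_iff order_refl)
  then have "a = b"
    using g(1) by (simp add: joins_def)
  then show ?thesis
    by (simp add: lor_length_degenerate)
qed

text \<open>Timelike curves from and to every point make both chronological boundaries empty, which
  settles the bubbling and spacelike axioms. The sets \<open>J_plus\<close> and
  \<open>J_minus\<close> of a point are closed as slices of the closed causal relation.\<close>

lemma globally_hyperbolic_length_spacetime: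
  assumes C: "curve_class T C" and lps: "lorentzian_prelength_space T l" and sep: "separable_space T"
    and gh: "globally_hyperbolic T l"
    and future: "\<And>x. x \<in> topspace T \<Longrightarrow> \<exists>g. rel_curve (chron l) C {0..1} g \<and> g 0 = x"
    and past: "\<And>x. x \<in> topspace T \<Longrightarrow> \<exists>g. rel_curve (chron l) C {0..1} g \<and> g 1 = x"
    and limits: "limit_extendible T l C" "limit_extendible T (time_reversal l) C"
    and length_sup: "\<And>x y r. chron l x y \<Longrightarrow> x \<in> topspace T \<Longrightarrow> y \<in> topspace T \<Longrightarrow> r < tdist l x y \<Longrightarrow>
      \<exists>a b g. joins g a b x y \<and> causal_curve l C {a..b} g \<and> r < lor_length l a b g"
  shows "length_spacetime T C l"
proof -
  interpret curve_class T C
    by fact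
  have causal: "causal_space T l"
    and closed: "closedin (prod_topology T T) {(x, y). x \<in> topspace T \<and> y \<in> topspace T \<and> causal_le l x y}"
    and compact: "\<And>K. compactin T K \<Longrightarrow>
      compactin T ((\<Union>x\<in>K. J_plus (topspace T) l x) \<inter> (\<Union>x\<in>K. J_minus (topspace T) l x))"
    using gh unfolding globally_hyperbolic_def by auto
  have order: "antisymp_on (topspace T) (causal_le l)"
    using causal by (simp add: causal_space_def)
  have J: "closedin T (J_plus (topspace T) l x)" "closedin T (J_minus (topspace T) l x)"
    if x: "x \<in> topspace T" for x
  proof -
    have "continuous_map T (prod_topology T T) (\<lambda>y. (x, y))" "continuous_map T (prod_topology T T) (\<lambda>y. (y, x))"
      using x by (simp_all add: continuous_map_paired)
    from this[THEN closedin_continuous_map_preimage, OF closed]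
    show "closedin T (J_plus (topspace T) l x)" "closedin T (J_minus (topspace T) l x)"
      using x by (simp_all add: J_plus_def J_minus_def cong: conj_cong)
  qed
  have I_plus: "I_plus (topspace T) l x \<noteq> {}" if x: "x \<in> topspace T" for x
  proof -
    obtain g where g: "rel_curve (chron l) C {0..1} g" "g 0 = x"
      using future[OF x] by blast
    then have "g 1 \<in> I_plus (topspace T) l x"
      using curve_in[of "{0..1}" g 1] by (auto simp: rel_curve_def I_plus_def)
    then show ?thesis
      by blast
  qed
  have I_minus: "I_minus (topspace T) l x \<noteq> {}" if x: "x \<in> topspace T" for x
  proof -
    obtain g where g: "rel_curve (chron l) C {0..1} g" "g 1 = x"
      using past[OF x] by blast
    then have "g 0 \<in> I_minus (topspace T) l x"
      using curve_in[of "{0..1}" g 0] by (auto simp: rel_curve_def I_minus_def)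
    then show ?thesis
      by blast
  qed
  have irrefl: "\<not> chron l x x" if x: "x \<in> topspace T" for x
  proof
    assume xx: "chron l x x"
    then have "0 < tdist l x x"
      by (simp add: chron_def)
    then obtain a b g where g: "joins g a b x x" "causal_curve l C {a..b} g" "0 < lor_length l a b g"
      using length_sup[OF xx x x] by blast
    then show False
      using causal_loop_length[OF order g(1,2)] by simp
  qed
  have diamond: "compactin T (J_plus (topspace T) l x \<inter> J_minus (topspace T) l y)"
    if xy: "x \<in> topspace T" "y \<in> topspace T" for x y
  proof (rule closed_compactin)
    \<comment> \<open>Global hyperbolicity takes the causal future and past of one and the same
      compact set; for the set of both end points their intersection contains the diamond as a
      closed subset.\<close>
    show "compactin T ((\<Union>z\<in>{x, y}. J_plus (topspace T) l z) \<inter> (\<Union>z\<in>{x, y}. J_minus (topspace T) l z))"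
      using xy by (intro compact finite_imp_compactin) auto
    show "closedin T (J_plus (topspace T) l x \<inter> J_minus (topspace T) l y)"
      using J xy by (intro closedin_Int) auto
  qed auto
  have "spacetime T C l"
  proof unfold_locales
    show "compact_causal_diamonds T l"
      unfolding compact_causal_diamonds_def using diamond by blast
    show "\<exists>g. rel_curve (chron l) C {0..1} g \<and> g 0 = x" if "x \<in> topspace T" for x
      by (rule future[OF that])
    show "\<exists>g. rel_curve (chron l) C {0..1} g \<and> g 1 = x" if "x \<in> topspace T" for x
      by (rule past[OF that])
    show "I_plus (topspace T) l x \<noteq> {} \<or> I_minus (topspace T) l x \<noteq> {}" if "x \<in> topspace T" for x
      using I_plus[OF that] by blast
  qed (use lps sep causal limits irrefl J I_plus I_minus in \<open>auto simp: lorentzian_prelength_space_def\<close>)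
  then show ?thesis
    using length_sup by (intro length_spacetime.intro length_spacetime_axioms.intro)
qed

text \<open>A timelike curve with \<open>x\<close> at parameter 1/2 is cut there; its halves,
  rescaled to the unit interval, start and end at \<open>x\<close>.\<close>

lemma bm_length_spacetime:
  assumes lps: "lorentzian_prelength_space T l" and sep: "separable_space T"
    and gh: "globally_hyperbolic T l" and bm: "bm_length_metric_spacetime T l"
  shows "length_spacetime T (curve T) l"
proof (rule globally_hyperbolic_length_spacetime[OF curve_class_curve lps sep gh])
  interpret curve_class T "curve T"
    by (rule curve_class_curve)
  have "antisymp_on (topspace T) (causal_le l)"
    using gh by (simp add: globally_hyperbolic_def causal_space_def)
  moreover from this have "antisymp_on (topspace T) (causal_le (time_reversal l))"
    unfolding causal_le_rev antisymp_on_def by blast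
  ultimately show "limit_extendible T l (curve T)" "limit_extendible T (time_reversal l) (curve T)"
    by (simp_all add: limit_extendible_curve)
  have middle: "\<exists>g. rel_curve (chron l) (curve T) {0..1} g \<and> g (1/2) = x" if "x \<in> topspace T" for x
    using bm that unfolding bm_length_metric_spacetime_def timelike_curve_rel_curve by blast
  fix x assume x: "x \<in> topspace T"
  then obtain g where g: "rel_curve (chron l) (curve T) {0..1} g" "g (1/2) = x"
    using middle by blast
  have "rel_curve (chron l) (curve T) {1/2..1} g" "rel_curve (chron l) (curve T) {0..1/2} g"
    by (rule rel_curve_subinterval[OF g(1)]; auto simp: is_interval_cc)+
  note halves = rel_curve_unit_interval[OF this(1)] rel_curve_unit_interval[OF this(2)]
  show "\<exists>g. rel_curve (chron l) (curve T) {0..1} g \<and> g 0 = x"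
    using halves(1) g(2) by (intro exI[of _ "\<lambda>t. g ((1 - 1/2) * t + 1/2)"]) simp
  show "\<exists>g. rel_curve (chron l) (curve T) {0..1} g \<and> g 1 = x"
    using halves(2) g(2) by (intro exI[of _ "\<lambda>t. g ((1/2 - 0) * t + 0)"]) simp
  have "\<forall>x\<in>topspace T. \<forall>y\<in>topspace T. chron l x y \<longrightarrow> tdist l x y = Sup {lor_length l a b g | a b g.
      joins g a b x y \<and> causal_curve l (curve T) {a..b} g \<and> inj_on g {a..b}}"
    using bm unfolding bm_length_metric_spacetime_def by (elim conjE)
  note length = this[rule_format, OF x]
  fix y r assume "chron l x y" "y \<in> topspace T" "r < tdist l x y"
  then have "r < Sup {lor_length l a b g | a b g.
      joins g a b x y \<and> causal_curve l (curve T) {a..b} g \<and> inj_on g {a..b}}"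
    using length[of y] by (simp only:)
  then show "\<exists>a b g. joins g a b x y \<and> causal_curve l (curve T) {a..b} g \<and> r < lor_length l a b g"
    unfolding less_Sup_iff by blast
qed

text \<open>Localizing neighbourhoods provide points in the chronological future and past of each
  point, which timelike path-connectedness turns into curves; their arclength bound gives local
  rectifiability.\<close>

lemma ks_length_spacetime:
  assumes lps: "lorentzian_prelength_space T l" and sep: "separable_space T"
    and gh: "globally_hyperbolic T l" and ks: "ks_length_space T l \<rho>"
  shows "length_spacetime T (lipschitz_curve T \<rho>) l"
proof -
  have metric: "Metric_space (topspace T) \<rho>" and topology: "Metric_space.mtopology (topspace T) \<rho> = T"
    using ks by (simp_all add: ks_length_space_def ks_prelength_space_def)
  interpret Metric_space "topspace T" \<rho>
    by (rule metric)
  let ?C = "lipschitz_curve T \<rho>"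
  have C: "curve_class T ?C"
    using metric by (rule curve_class_lipschitz)
  interpret curve_class T ?C
    by (rule C)
  have order: "antisymp_on (topspace T) (causal_le l)"
    using gh by (simp add: globally_hyperbolic_def causal_space_def)
  have nbhd: "\<exists>\<Omega>. openin T \<Omega> \<and> x \<in> \<Omega> \<and> ks_localizing_nbhd T l \<rho> \<Omega>" if "x \<in> topspace T" for x
    using ks that by (simp add: ks_length_space_def)
  have length_sup: "\<exists>a b g. joins g a b x y \<and> causal_curve l ?C {a..b} g \<and> r < lor_length l a b g"
    if "chron l x y" "x \<in> topspace T" "y \<in> topspace T" "r < tdist l x y" for x y r
  proof -
    have "\<forall>x\<in>topspace T. \<forall>y\<in>topspace T. chron l x y \<longrightarrow> tdist l x y =
        Sup {lor_length l a b g | a b g. joins g a b x y \<and> causal_curve l ?C {a..b} g}"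
      using ks unfolding ks_length_space_def by (elim conjE)
    from this[rule_format, OF that(2,3,1)] that(4)
    have "r < Sup {lor_length l a b g | a b g. joins g a b x y \<and> causal_curve l ?C {a..b} g}"
      by (simp only:)
    then show ?thesis
      unfolding less_Sup_iff by blast
  qed
  \<comment> \<open>A joining curve on a single parameter would mean \<open>x = y\<close> and thus
    \<open>chron l x x\<close>; a causal loop of positive length would then exist.\<close>
  have irrefl: "a < b"
    if h: "joins g a b x y" "timelike_curve l ?C {a..b} g" "chron l x y" "x \<in> topspace T"
    for g a b x y
  proof (rule ccontr)
    assume "\<not> a < b"
    then have xx: "chron l x x"
      using h(1,3) by (auto simp: joins_def)
    then obtain a b g where g: "joins g a b x x" "causal_curve l ?C {a..b} g" "0 < lor_length l a b g"
      using length_sup[OF xx h(4,4), of 0] unfolding chron_def by blast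
    then show False
      using causal_loop_length[OF order g(1,2)] by simp
  qed
  have timelike: "\<exists>g. rel_curve (chron l) ?C {0..1} g \<and> g 0 = x \<and> g 1 = y"
    if xy: "chron l x y" "x \<in> topspace T" "y \<in> topspace T" for x y
  proof -
    have "timelike_path_connected (topspace T) l ?C"
      using ks by (simp add: ks_length_space_def)
    then obtain a b g where g: "joins g a b x y" "timelike_curve l ?C {a..b} g"
      using xy unfolding timelike_path_connected_def by metis
    then have "a < b" "g a = x" "g b = y"
      using irrefl xy(1,2) by (auto simp: joins_def)
    then show ?thesis
      using rel_curve_unit_interval[OF g(2)[unfolded timelike_curve_rel_curve]]
      by (intro exI[of _ "\<lambda>t. g ((b - a) * t + a)"]) simp
  qed
  have rect: "locally_rectifiable T l \<rho>"
    unfolding locally_rectifiable_def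
  proof
    fix p assume "p \<in> topspace T"
    then obtain \<Omega> where \<Omega>: "openin T \<Omega>" "p \<in> \<Omega>" "ks_localizing_nbhd T l \<rho> \<Omega>"
      using nbhd by blast
    then obtain B :: real where B: "B > 0"
      "\<forall>I g. causal_curve l ?C I g \<and> g ` I \<subseteq> \<Omega> \<longrightarrow> arclength \<rho> I g \<le> ennreal B"
      unfolding ks_localizing_nbhd_def by metis
    have "chain_length \<rho> g n u \<le> B"
      if g: "rel_curve (strict_le l) ?C I g" "g ` I \<subseteq> \<Omega>" and u: "chain_in I n u" for I g n u
    proof -
      have "g ` I \<subseteq> topspace T"
        using g(2) openin_subset[OF \<Omega>(1)] by blast
      moreover have "is_interval I"
        using g(1) curve_interval unfolding rel_curve_def by blast
      ultimately have "causal_curve l ?C I g"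
        using g(1) causal_curve_rel_curve[OF antisymp_on_subset[OF order]] by blast
      then have "arclength \<rho> I g \<le> ennreal B"
        using B(2) g(2) by blast
      moreover have "(\<Sum>i<n. ennreal (\<rho> (g (u i)) (g (u (Suc i))))) \<le> arclength \<rho> I g"
        unfolding arclength_def using u by (intro SUP_upper2[of "(n, u)"]) (auto simp: chain_in_def)
      moreover have "(\<Sum>i<n. ennreal (\<rho> (g (u i)) (g (u (Suc i))))) = ennreal (chain_length \<rho> g n u)"
        by (simp add: chain_length_def sum_ennreal)
      ultimately have "ennreal (chain_length \<rho> g n u) \<le> ennreal B"
        by (metis order_trans)
      then show ?thesis
        using B(1) by (simp add: ennreal_le_iff)
    qed
    then show "\<exists>\<Omega> B. openin T \<Omega> \<and> p \<in> \<Omega> \<and>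
      (\<forall>I g n u. rel_curve (strict_le l) ?C I g \<and> g ` I \<subseteq> \<Omega> \<and> chain_in I n u \<longrightarrow>
        chain_length \<rho> g n u \<le> B)"
      by (intro exI[of _ \<Omega>] exI[of _ B] conjI \<Omega>(1,2) allI impI) auto
  qed
  have order_rev: "antisymp_on (topspace T) (causal_le (time_reversal l))"
    using order unfolding causal_le_rev antisymp_on_def by blast
  show ?thesis
  proof (rule globally_hyperbolic_length_spacetime[OF C lps sep gh _ _ _ _ length_sup])
    show "limit_extendible T l ?C"
      by (rule limit_extendible_lipschitz[OF metric topology order rect])
    show "limit_extendible T (time_reversal l) ?C"
      by (rule limit_extendible_lipschitz[OF metric topology order_rev locally_rectifiable_reversal[OF metric rect]])
    fix x assume x: "x \<in> topspace T"
    then obtain \<Omega> where \<Omega>: "x \<in> \<Omega>" "ks_localizing_nbhd T l \<rho> \<Omega>"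
      using nbhd by blast
    have "\<forall>y\<in>\<Omega>. I_plus (topspace T) l y \<inter> \<Omega> \<noteq> {} \<and> I_minus (topspace T) l y \<inter> \<Omega> \<noteq> {}"
      using \<Omega>(2) unfolding ks_localizing_nbhd_def by (elim conjE)
    then obtain y z where y: "y \<in> topspace T" "chron l x y" and z: "z \<in> topspace T" "chron l z x"
      using \<Omega>(1) unfolding I_plus_def I_minus_def by blast
    show "\<exists>g. rel_curve (chron l) ?C {0..1} g \<and> g 0 = x"
      using timelike[OF y(2) x y(1)] by blast
    show "\<exists>g. rel_curve (chron l) ?C {0..1} g \<and> g 1 = x"
      using timelike[OF z(2,1) x] by blast
  qed
qed

text \<open>The order is defined by inequalities between the functions
  \<open>\<lambda>y. d z y\<close> and \<open>\<lambda>y. d y z\<close>. Continuity of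
  \<open>d\<close> thus makes \<open>J_plus\<close> and \<open>J_minus\<close> intersections of
  closed sets, and since these functions separate points, the order is antisymmetric. Geodesics
  attain \<open>tdist\<close>, which gives \<open>length_sup\<close> at once.\<close>

lemma bms_length_spacetime:
  assumes lps: "lorentzian_prelength_space T l" and sep: "separable_space T"
    and bms: "bms_length_space T l" and diamonds: "compact_causal_diamonds T l"
    and bubbling: "empty_bubbling_boundary (topspace T) l"
    and spacelike: "spacelike_boundary (topspace T) l = {}"
    and extensions: "timelike_extensions (topspace T) l (curve T)"
  shows "length_spacetime T (curve T) l"
proof -
  interpret curve_class T "curve T"
    by (rule curve_class_curve)
  let ?X = "topspace T"
  obtain d where d: "lorentzian_metric_space T d"
    and l_eq: "\<And>x y. x \<in> ?X \<Longrightarrow> y \<in> ?X \<Longrightarrow> l x y = (if bms_le ?X d x y then ereal (d x y) else -\<infinity>)"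
    using bms unfolding bms_length_space_def by blast
  have d0: "0 \<le> d x y" if "x \<in> ?X" "y \<in> ?X" for x y
    using d that by (simp add: lorentzian_metric_space_def)
  have d_triangle: "d x y + d y z \<le> d x z"
    if "x \<in> ?X" "y \<in> ?X" "z \<in> ?X" "0 < d x y" "0 < d y z" for x y z
    using d that by (simp add: lorentzian_metric_space_def)
  have d_cont: "continuous_map (prod_topology T T) euclideanreal (\<lambda>(x, y). d x y)"
    using d by (simp add: lorentzian_metric_space_def)
  have distinguishes: "\<exists>z\<in>?X. d x z \<noteq> d y z \<or> d z x \<noteq> d z y" if "x \<in> ?X" "y \<in> ?X" "x \<noteq> y" for x y
    using d that by (simp add: lorentzian_metric_space_def)
  have le_iff: "causal_le l x y \<longleftrightarrow> bms_le ?X d x y" if "x \<in> ?X" "y \<in> ?X" for x y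
    using that d0 by (simp add: causal_le_def l_eq)
  have order: "antisymp_on ?X (causal_le l)"
  proof (rule antisymp_onI)
    fix x y assume xy: "x \<in> ?X" "y \<in> ?X" "causal_le l x y" "causal_le l y x"
    then have "bms_le ?X d x y" "bms_le ?X d y x"
      using le_iff by auto
    then show "x = y"
      using distinguishes[OF xy(1,2)] unfolding bms_le_def by (metis order_antisym)
  qed
  then have order_rev: "antisymp_on ?X (causal_le (time_reversal l))"
    unfolding causal_le_rev antisymp_on_def by blast
  \<comment> \<open>\<open>d\<close> has finite values, so \<open>d x x + d x x \<le> d x x\<close>
    is impossible for positive \<open>d x x\<close>.\<close>
  have irrefl: "\<not> chron l x x" if x: "x \<in> ?X" for x
    using l_eq[OF x x] d_triangle[OF x x x] by (auto simp: chron_iff split: if_splits)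
  have section_cont: "continuous_map T euclideanreal (\<lambda>y. d z y)" "continuous_map T euclideanreal (\<lambda>y. d y z)"
    if z: "z \<in> ?X" for z
  proof -
    have "continuous_map T (prod_topology T T) (\<lambda>y. (z, y))" "continuous_map T (prod_topology T T) (\<lambda>y. (y, z))"
      using z by (simp_all add: continuous_map_paired)
    from this[THEN continuous_map_compose, OF d_cont]
    show "continuous_map T euclideanreal (\<lambda>y. d z y)" "continuous_map T euclideanreal (\<lambda>y. d y z)"
      by (simp_all add: comp_def)
  qed
  have half_closed: "closedin T {y \<in> ?X. r \<le> d z y}" "closedin T {y \<in> ?X. d z y \<le> r}"
    "closedin T {y \<in> ?X. r \<le> d y z}" "closedin T {y \<in> ?X. d y z \<le> r}" if "z \<in> ?X" for z r
    using section_cont[OF that] unfolding continuous_map_upper_lower_semicontinuous_le by auto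
  have J: "closedin T (J_plus ?X l x)" "closedin T (J_minus ?X l x)" if x: "x \<in> ?X" for x
  proof -
    have "J_plus ?X l x = (\<Inter>z\<in>?X. {y \<in> ?X. d z x \<le> d z y} \<inter> {y \<in> ?X. d y z \<le> d x z})"
      using le_iff x by (auto simp: J_plus_def bms_le_def)
    moreover have "closedin T (\<Inter>z\<in>?X. {y \<in> ?X. d z x \<le> d z y} \<inter> {y \<in> ?X. d y z \<le> d x z})"
      using x half_closed by (intro closedin_INT closedin_Int) auto
    ultimately show "closedin T (J_plus ?X l x)"
      by simp
    have "J_minus ?X l x = (\<Inter>z\<in>?X. {y \<in> ?X. d z y \<le> d z x} \<inter> {y \<in> ?X. d x z \<le> d y z})"
      using le_iff x by (auto simp: J_minus_def bms_le_def)
    moreover have "closedin T (\<Inter>z\<in>?X. {y \<in> ?X. d z y \<le> d z x} \<inter> {y \<in> ?X. d x z \<le> d y z})"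
      using x half_closed by (intro closedin_INT closedin_Int) auto
    ultimately show "closedin T (J_minus ?X l x)"
      by simp
  qed
  have "spacetime T (curve T) l"
  proof unfold_locales
    show "extended_time_separation ?X l"
      using lps by (simp add: lorentzian_prelength_space_def)
    show "causal_space T l"
      using order by (simp add: causal_space_def)
    show "limit_extendible T l (curve T)" "limit_extendible T (time_reversal l) (curve T)"
      using order order_rev by (simp_all add: limit_extendible_curve)
    fix x assume x: "x \<in> ?X"
    show "openin T (I_plus ?X l x)" "openin T (I_minus ?X l x)"
      using lps x by (simp_all add: lorentzian_prelength_space_def)
    show "I_plus ?X l x \<noteq> {} \<or> I_minus ?X l x \<noteq> {}"
      using spacelike x by (auto simp: spacelike_boundary_def ch_boundary_plus_def ch_boundary_minus_def)
    fix y assume y: "y \<in> ?X"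
    { assume s: "strict_le l x y"
      then have "y \<in> J_plus ?X l x" "x \<in> J_minus ?X l y" "x \<noteq> y"
        using x y by (auto simp: strict_le_def J_plus_def J_minus_def)
      then have "x \<notin> ca_boundary_plus ?X l" "y \<notin> ca_boundary_minus ?X l"
        unfolding ca_boundary_plus_def ca_boundary_minus_def by auto
      then show "I_plus ?X l x \<noteq> {}" "I_minus ?X l y \<noteq> {}"
        using bubbling x y unfolding empty_bubbling_boundary_def ch_boundary_plus_def ch_boundary_minus_def
        by auto }
    assume xy: "chron l x y"
    then have "x \<in> ?X - ch_boundary_plus ?X l" "y \<in> ?X - ch_boundary_minus ?X l"
      using x y by (auto simp: ch_boundary_plus_def ch_boundary_minus_def I_plus_def I_minus_def)
    note ext = extensions[unfolded timelike_extensions_def timelike_curve_rel_curve, THEN conjunct1, rule_format, OF this(1)]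
      extensions[unfolded timelike_extensions_def timelike_curve_rel_curve, THEN conjunct2, rule_format, OF this(2)]
    obtain I g a where g: "rel_curve (chron l) (curve T) I g" "\<not> g constant_on I"
      "a \<in> I" "\<forall>t\<in>I. a \<le> t" "g a = x"
      using ext(1) by blast
    obtain b where b: "b \<in> I" "b \<noteq> a"
      using g(2,3) unfolding constant_on_def by metis
    have "a < b"
      using g(4) b by force
    moreover have "rel_curve (chron l) (curve T) {a..b} g"
    proof (rule rel_curve_subinterval[OF g(1)])
      show "{a..b} \<subseteq> I"
        using curve_between[of I g a b] g(1,3) b(1) unfolding rel_curve_def by auto
    qed (use \<open>a < b\<close> is_interval_cc in auto)
    ultimately show "\<exists>g. rel_curve (chron l) (curve T) {0..1} g \<and> g 0 = x"
      using rel_curve_unit_interval g(5) by (intro exI[of _ "\<lambda>t. g ((b - a) * t + a)"]) simp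
    obtain I g b where g: "rel_curve (chron l) (curve T) I g" "\<not> g constant_on I"
      "b \<in> I" "\<forall>t\<in>I. t \<le> b" "g b = y"
      using ext(2) by blast
    obtain a where a: "a \<in> I" "a \<noteq> b"
      using g(2,3) unfolding constant_on_def by metis
    have "a < b"
      using g(4) a by force
    moreover have "rel_curve (chron l) (curve T) {a..b} g"
    proof (rule rel_curve_subinterval[OF g(1)])
      show "{a..b} \<subseteq> I"
        using curve_between[of I g a b] g(1,3) a(1) unfolding rel_curve_def by auto
    qed (use \<open>a < b\<close> is_interval_cc in auto)
    ultimately show "\<exists>g. rel_curve (chron l) (curve T) {0..1} g \<and> g 1 = y"
      using rel_curve_unit_interval g(5) by (intro exI[of _ "\<lambda>t. g ((b - a) * t + a)"]) simp
  qed (use sep diamonds irrefl J in auto)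
  moreover have "\<exists>a b g. joins g a b x y \<and> causal_curve l (curve T) {a..b} g \<and> r < lor_length l a b g"
    if xy: "chron l x y" "x \<in> ?X" "y \<in> ?X" "r < tdist l x y" for x y r
  proof -
    have "geodesic_space ?X l (curve T)"
      using bms by (simp add: bms_length_space_def)
    then obtain a b g where "joins g a b x y" "causal_curve l (curve T) {a..b} g"
      "lor_length l a b g = tdist l x y"
      using chron_imp_causal_le[OF xy(1)] xy(2,3) unfolding geodesic_space_def by metis
    with xy(4) show ?thesis
      by metis
  qed
  ultimately show ?thesis
    by (intro length_spacetime.intro length_spacetime_axioms.intro)
qed

theorem corollary5p13:
  fixes T :: "'a topology" and l :: "'a \<Rightarrow> 'a \<Rightarrow> ereal" and C :: "'a curve_class"
  defines "X \<equiv> topspace T"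
  assumes "lorentzian_prelength_space T l" and "separable_space T"
    and "(C = curve T \<and> first_countable T \<and> bms_length_space T l \<and> compact_causal_diamonds T l \<and>
            empty_bubbling_boundary X l \<and> spacelike_boundary X l = {} \<and> timelike_extensions X l C)
       \<or> (C = curve T \<and> globally_hyperbolic T l \<and> bm_length_metric_spacetime T l)
       \<or> (\<exists>\<rho>. C = lipschitz_curve T \<rho> \<and> globally_hyperbolic T l \<and> ks_length_space T l \<rho>)"
  shows "(strong_cauchy_sets X l C \<noteq> {} \<and> extended_metric_on (strong_cauchy_sets X l C) (d_J l)) \<and>
    (timelike_path_connected X l C \<longrightarrow>
      extended_metric_on (cauchy_sets X l C) (d_J l) \<and>
      ((\<forall>x\<in>X. \<exists>I \<gamma>. cauchy_complete_curve l C I \<gamma> \<and> x \<in> \<gamma> ` I) \<longrightarrow>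
        extended_metric_on (weak_cauchy_sets X l C) (d_J l)))"
proof -
  have "length_spacetime T C l"
    using assms(4) unfolding X_def
  proof (elim disjE exE conjE)
    assume "C = curve T" "bms_length_space T l" "compact_causal_diamonds T l"
      "empty_bubbling_boundary (topspace T) l" "spacelike_boundary (topspace T) l = {}"
      "timelike_extensions (topspace T) l C"
    then show ?thesis
      using bms_length_spacetime[OF assms(2,3)] by simp
  next
    assume "C = curve T" "globally_hyperbolic T l" "bm_length_metric_spacetime T l"
    then show ?thesis
      using bm_length_spacetime[OF assms(2,3)] by simp
  next
    fix \<rho> assume "C = lipschitz_curve T \<rho>" "globally_hyperbolic T l" "ks_length_space T l \<rho>"
    then show ?thesis
      using ks_length_spacetime[OF assms(2,3)] by simp
  qed
  then show ?thesis
    unfolding X_def using length_spacetime.cauchy_sets_extended_metrics[of T C l] by simp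
qed

end
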